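(* The following hold. (i) Let $X$ be a Banach space with $w^*\text{-}\mathrm{dens}\, X^*>\exp_2\mathfrak{c}$. Then both $X$ and $X^*$ contain uncountable symmetrically $(1+)$-separated families of unit vectors. (ii) Let $X$ be a weakly Lindelöf determined (WLD) Banach space with $\mathrm{dens}\, X>\mathfrak{c}$. Then the unit spheres of $X$ and of $X^*$ contain uncountable symmetrically $(1+)$-separated subsets. (iii) Let $\Gamma$ be a set. If $X=c_0(\Gamma)$, then every $(1+)$-separated subset of the unit sphere $S_{c_0(\Gamma)}$ has cardinality at most $\omega_1$.
   Context: Banach spaces are over the real or the complex field (the result covers both cases). $\mathfrak{c}$ is the cardinality of the continuum; for a cardinal $\kappa$, $\exp_1\kappa=2^\kappa$ and $\exp_{n+1}\kappa=2^{\exp_n\kappa}$. $\mathrm{dens}\,X$ is the density character of $X$, and $w^*\text{-}\mathrm{dens}\,X^*$ is the density character of $X^*$ in the $w^*$-topology. A subset $A$ of a normed space is $(1+)$-separated if $\|x-y\|>1$ for all distinct $x,y\in A$, and symmetrically $(1+)$-separated if $\|x- y\|>1$ and $\|x+y\|>1$ for all distinct $x,y\in A$. $S_X$ is the unit sphere of $X$. A compact space is a Corson compact if it is homeomorphic to a compact subset $C$ of $[-1,1]^\Gamma$ for some set $\Gamma$ such that each element of $C$ has only countably many non-zero coordinates. A Banach space $X$ is WLD if the dual ball $B_{X^*}$ with the relative $w^*$-topology is a Corson compact. $c_0(\Gamma)$ carries its canonical supremum norm. *)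

theory Defs
  imports "HOL-Analysis.Analysis"
begin

unbundle cardinal_syntax

definition continuum :: "real rel"
  where "continuum = |UNIV :: real set|"

text \<open>The exponential \<open>2\<^sup>\<kappa>\<close> lives on a new type at each step, so only fixed iterates
  can be defined.\<close>

definition exp1 :: "'b rel \<Rightarrow> ('b \<Rightarrow> bool) rel"
  where "exp1 \<kappa> = ctwo ^c \<kappa>"

definition exp2 :: "'b rel \<Rightarrow> (('b \<Rightarrow> bool) \<Rightarrow> bool) rel"
  where "exp2 \<kappa> = exp1 (exp1 \<kappa>)"

definition dense_subset :: "'b topology \<Rightarrow> 'b set \<Rightarrow> bool"
  where "dense_subset T D \<longleftrightarrow> D \<subseteq> topspace T \<and> T closure_of D = topspace T"

text \<open>The density character is the least cardinality of a dense subset; the choice of the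
  subset attaining it is irrelevant up to order isomorphism.\<close>

definition density_character :: "'b topology \<Rightarrow> 'b rel"
  where "density_character T =
    |SOME D. dense_subset T D \<and> (\<forall>E. dense_subset T E \<longrightarrow> |D| \<le>o |E| )|"

lemma density_character_attained:
  obtains D where "dense_subset T D" "density_character T = |D|"
    "\<And>E. dense_subset T E \<Longrightarrow> |D| \<le>o |E|"
proof -
  have "dense_subset T (topspace T)"
    by (simp add: dense_subset_def)
  then have "{|D| |D. dense_subset T D} \<noteq> {}"
    by blast
  then obtain r where "r \<in> {|D| |D. dense_subset T D}"
      "\<forall>r' \<in> {|D| |D. dense_subset T D}. r \<le>o r'"
    using exists_minim_Card_order[of "{|D| |D. dense_subset T D}"] card_of_Card_order by blast
  then have "\<exists>D. dense_subset T D \<and> (\<forall>E. dense_subset T E \<longrightarrow> |D| \<le>o |E| )"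
    by blast
  from someI_ex[OF this] show thesis
    using that unfolding density_character_def by blast
qed

text \<open>A Banach space over a scalar field \<open>'k\<close> (below, \<open>real\<close> or \<open>complex\<close>) is a type of class
  \<open>banach\<close> together with a scalar multiplication by \<open>'k\<close>. The last assumption says that the
  real structure of the type class is the one obtained by restriction of scalars; for real
  scalars it forces \<open>smul\<close> to be \<open>scaleR\<close>.\<close>

locale normed_space_over = vector_space smul
  for smul :: "'k::real_normed_field \<Rightarrow> 'a::real_normed_vector \<Rightarrow> 'a" +
  assumes norm_scale: "norm (smul c x) = norm c * norm x"
    and scale_of_real: "smul (of_real r) x = r *\<^sub>R x"

text \<open>A bounded real-linear map is a \<open>'k\<close>-linear functional as soon as it commutes with the
  multiplication by scalars in \<open>'k\<close>. The norm on the type of bounded linear maps is the operator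
  norm.\<close>

definition dual_space :: "('k::real_normed_field \<Rightarrow> 'a::real_normed_vector \<Rightarrow> 'a) \<Rightarrow> ('a \<Rightarrow>\<^sub>L 'k) set"
  where "dual_space smul =
    {f. \<forall>c x. blinfun_apply f (smul c x) = c * blinfun_apply f x}"

definition dual_sphere :: "('k::real_normed_field \<Rightarrow> 'a::real_normed_vector \<Rightarrow> 'a) \<Rightarrow> ('a \<Rightarrow>\<^sub>L 'k) set"
  where "dual_sphere smul = {f \<in> dual_space smul. norm f = 1}"

definition dual_ball :: "('k::real_normed_field \<Rightarrow> 'a::real_normed_vector \<Rightarrow> 'a) \<Rightarrow> ('a \<Rightarrow>\<^sub>L 'k) set"
  where "dual_ball smul = {f \<in> dual_space smul. norm f \<le> 1}"

text \<open>For maps into the scalar field, \<open>strong_operator_topology\<close> is the topology of pointwise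
  convergence, that is, the \<open>w\<^sup>*\<close>-topology.\<close>

definition weak_star :: "('k::real_normed_field \<Rightarrow> 'a::real_normed_vector \<Rightarrow> 'a) \<Rightarrow> ('a \<Rightarrow>\<^sub>L 'k) topology"
  where "weak_star smul = subtopology strong_operator_topology (dual_space smul)"

lemma normed_space_over_scaleR:
  "normed_space_over (scaleR :: real \<Rightarrow> 'a::real_normed_vector \<Rightarrow> 'a)"
  by unfold_locales (auto simp: algebra_simps)

lemma dual_space_scaleR: "dual_space (scaleR :: real \<Rightarrow> 'a::real_normed_vector \<Rightarrow> 'a) = UNIV"
  by (auto simp: dual_space_def blinfun.scaleR_right)

text \<open>The index set \<open>\<Gamma>\<close> of the cube is taken in the type \<open>'b \<Rightarrow> real\<close>. This is no restriction:
  see \<open>corson_compactI\<close> below, where the index set lies in an arbitrary type.\<close>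

definition corson_compact :: "'b topology \<Rightarrow> bool"
  where "corson_compact T \<longleftrightarrow>
    (\<exists>(\<Gamma> :: ('b \<Rightarrow> real) set) C.
       compactin (product_topology (\<lambda>_. top_of_set {-1..1::real}) \<Gamma>) C \<and>
       (\<forall>x\<in>C. countable {\<gamma> \<in> \<Gamma>. x \<gamma> \<noteq> 0}) \<and>
       T homeomorphic_space
         subtopology (product_topology (\<lambda>_. top_of_set {-1..1::real}) \<Gamma>) C)"

lemma corson_compactI:
  fixes T :: "'b topology" and \<Delta> :: "'i set"
  defines "Q \<equiv> product_topology (\<lambda>_. top_of_set {-1..1::real}) \<Delta>"
  assumes C: "compactin Q C" and cnt: "\<And>x. x \<in> C \<Longrightarrow> countable {\<delta> \<in> \<Delta>. x \<delta> \<noteq> 0}"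
    and hom: "T homeomorphic_space subtopology Q C"
  shows "corson_compact T"
proof -
  obtain h where h: "homeomorphic_map T (subtopology Q C) h"
    using hom homeomorphic_space by blast
  define g where "g \<delta> x = (if x \<in> topspace T then h x \<delta> else 0)" for \<delta> x
  define \<Gamma> where "\<Gamma> = g ` \<Delta>"
  define P where "P = product_topology (\<lambda>_. top_of_set {-1..1::real}) \<Gamma>"
  define k where "k x = (\<lambda>\<gamma>\<in>\<Gamma>. \<gamma> x)" for x
  have CQ: "C \<subseteq> topspace Q"
    using C compactin_subset_topspace by blast
  have comp: "compact_space T"
    using C hom homeomorphic_compact_space compact_space_subtopology by blast
  have hC: "h x \<in> C" if "x \<in> topspace T" for x
    using homeomorphic_imp_surjective_map[OF h] that CQ by auto
  have inj_h: "inj_on h (topspace T)"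
    using h homeomorphic_imp_injective_map by blast
  have cont_h: "continuous_map T Q h"
    using h homeomorphic_imp_continuous_map continuous_map_in_subtopology by blast
  have cont_g: "continuous_map T (top_of_set {-1..1::real}) (g \<delta>)" if "\<delta> \<in> \<Delta>" for \<delta>
  proof -
    have "continuous_map T (top_of_set {-1..1::real}) (\<lambda>x. h x \<delta>)"
      using cont_h that unfolding Q_def continuous_map_componentwise by blast
    then show ?thesis
      by (rule continuous_map_eq) (simp add: g_def)
  qed
  have cont_k: "continuous_map T P k"
    unfolding P_def continuous_map_componentwise
    using cont_g by (auto simp: k_def \<Gamma>_def)
  have inj_k: "inj_on k (topspace T)"
  proof (rule inj_onI)
    fix x y assume xy: "x \<in> topspace T" "y \<in> topspace T" "k x = k y"
    have "h x \<delta> = h y \<delta>" if "\<delta> \<in> \<Delta>" for \<delta>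
    proof -
      have "k z (g \<delta>) = h z \<delta>" if "z \<in> topspace T" for z
        using that \<open>\<delta> \<in> \<Delta>\<close> by (simp add: k_def \<Gamma>_def g_def)
      then show ?thesis
        using xy by metis
    qed
    moreover have "h x \<in> extensional \<Delta>" "h y \<in> extensional \<Delta>"
      using hC xy CQ by (auto simp: Q_def PiE_def)
    ultimately have "h x = h y"
      by (meson extensionalityI)
    then show "x = y"
      using inj_h xy by (meson inj_onD)
  qed
  have "Hausdorff_space P"
    unfolding P_def by (simp add: Hausdorff_space_product_topology Hausdorff_space_subtopology)
  then have "embedding_map T P k"
    using continuous_imp_embedding_map cont_k comp inj_k by blast
  then have "T homeomorphic_space subtopology P (k ` topspace T)"
    by (rule embedding_map_imp_homeomorphic_space)
  moreover have "compactin P (k ` topspace T)"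
    using cont_k comp image_compactin compact_space_def by blast
  moreover have "countable {\<gamma> \<in> \<Gamma>. z \<gamma> \<noteq> 0}" if z: "z \<in> k ` topspace T" for z
  proof -
    obtain x where x: "x \<in> topspace T" "z = k x"
      using z by blast
    have "{\<gamma> \<in> \<Gamma>. z \<gamma> \<noteq> 0} \<subseteq> g ` {\<delta> \<in> \<Delta>. h x \<delta> \<noteq> 0}"
      using x by (auto simp: \<Gamma>_def k_def g_def)
    then show ?thesis
      by (rule countable_subset) (rule countable_image[OF cnt[OF hC[OF x(1)]]])
  qed
  ultimately show ?thesis
    unfolding corson_compact_def P_def by blast
qed

definition WLD :: "('k::real_normed_field \<Rightarrow> 'a::real_normed_vector \<Rightarrow> 'a) \<Rightarrow> bool"
  where "WLD smul \<longleftrightarrow> corson_compact (subtopology (weak_star smul) (dual_ball smul))"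

text \<open>The norm is a parameter because \<open>c\<^sub>0(\<Gamma>)\<close> is a set of functions, not a normed type.\<close>

definition one_plus_separated :: "('b::minus \<Rightarrow> real) \<Rightarrow> 'b set \<Rightarrow> bool"
  where "one_plus_separated N A \<longleftrightarrow> (\<forall>x\<in>A. \<forall>y\<in>A. x \<noteq> y \<longrightarrow> N (x - y) > 1)"

definition sym_one_plus_separated :: "('b::{plus,minus} \<Rightarrow> real) \<Rightarrow> 'b set \<Rightarrow> bool"
  where "sym_one_plus_separated N A \<longleftrightarrow>
    (\<forall>x\<in>A. \<forall>y\<in>A. x \<noteq> y \<longrightarrow> N (x - y) > 1 \<and> N (x + y) > 1)"

text \<open>Functions on \<open>\<Gamma>\<close> are extended by \<open>0\<close> to the whole type, so that the supremum may be taken over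
  the type (and is \<open>0\<close> when \<open>\<Gamma>\<close> is empty).\<close>

definition c0 :: "'i set \<Rightarrow> ('i \<Rightarrow> 'k::real_normed_vector) set"
  where "c0 \<Gamma> = {x. (\<forall>\<gamma>. \<gamma> \<notin> \<Gamma> \<longrightarrow> x \<gamma> = 0) \<and> (\<forall>\<epsilon>>0. finite {\<gamma> \<in> \<Gamma>. norm (x \<gamma>) \<ge> \<epsilon>})}"

definition sup_norm :: "('i \<Rightarrow> 'k::real_normed_vector) \<Rightarrow> real"
  where "sup_norm x = (SUP \<gamma>. norm (x \<gamma>))"

definition c0_sphere :: "'i set \<Rightarrow> ('i \<Rightarrow> 'k::real_normed_vector) set"
  where "c0_sphere \<Gamma> = {x \<in> c0 \<Gamma>. sup_norm x = 1}"

end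

theory Submission
  imports Defs
begin

text \<open>
Statements (i) and (ii) are about real normed spaces: replacing a complex functional by its real part is an isometry
that respects the weak-star topology. Both follow from one principle. Suppose that unit vectors
\<open>e\<^sub>i\<close> and unit functionals \<open>\<phi>\<^sub>i\<close>, with \<open>i\<close> in an uncountable well-ordered set with countable initial
segments, are biorthogonal, and that for each sign the norms of \<open>e\<^sub>i \<plusminus> e\<^sub>j\<close> are either all at most \<open>1\<close> or all at
least some \<open>1 + \<delta> > 1\<close>. Then there is an uncountable symmetrically \<open>(1+)\<close>-separated set of unit vectors
(\<open>sym_separated_of_homogeneous_biorthogonal\<close>). If neither sign gives norms at most \<open>1\<close>, the \<open>e\<^sub>i\<close> themselves will do. If
\<open>norm (e\<^sub>i - e\<^sub>j) \<le> 1\<close>, one may subtract from \<open>e\<^sub>i\<close> a small convex combination of all the countably many earlier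
vectors without changing its norm; the functional \<open>\<phi>\<^sub>j\<close> then exhibits a difference larger than \<open>1\<close>. For the sums one uses
\<open>\<delta>\<close>, or, when both signs give norms at most \<open>1\<close>, a large common multiple of one fixed \<open>e\<^sub>0\<close>. Since \<open>e\<^sub>i\<close> acts on
functionals by evaluation, the same system serves the dual space.

Such systems are found by reflection (\<open>sym_separated_of_reflected_pair\<close>). A norming pair \<open>(x, f)\<close> is chosen outside a set \<open>R\<close> which is closed under
realising, inside \<open>R\<close>, the type of any point over countably many members of \<open>R\<close>; such sets exist with the cardinality of the
continuum. Copying \<open>(x, f)\<close> along \<open>\<omega>\<^sub>1\<close> gives a system in which the relation of two members depends on the earlier one
only. If the functionals in \<open>R\<close> kill \<open>x\<close> and \<open>f\<close> kills the copies, it is biorthogonal, and the pigeonhole principle makes it homogeneous.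

In (i), weak-star density larger than \<open>exp\<^sub>2 c\<close> says that any \<open>exp\<^sub>2 c\<close> functionals have a common non-trivial zero
(\<open>common_zero_of_few_functionals\<close>), so \<open>x\<close> is easy to find. That \<open>f\<close> kills the copies is achieved by passing to differences in a sequence
that is homogeneous for a real-valued colouring of triples (\<open>sym_separated_of_common_zeros\<close>); this is where two exponentials are
spent. In (ii), the countable supports in the Corson compact provide both conditions for sets \<open>R\<close> of the size of the
continuum (\<open>sym_separated_of_corson_dual_ball\<close>).

For (iii), a delta system of the finite sets of large coordinates reduces the claim to a counting argument about
disjoint petals and countable supports (\<open>separated_c0_sphere_le\<close>).
\<close>

section \<open>Cardinal arithmetic\<close>

lemma card_of_UN_le_cardSuc_natLeq:
  assumes "|I| \<le>o cardSuc natLeq" and "\<And>i. i \<in> I \<Longrightarrow> |A i| \<le>o cardSuc natLeq"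
  shows "|\<Union>i\<in>I. A i| \<le>o cardSuc natLeq"
  using assms natLeq_Cinfinite Cinfinite_cardSuc UNION_Cinfinite_bound by blast

lemma countable_iff_le_natLeq: "countable A \<longleftrightarrow> |A| \<le>o natLeq"
proof
  assume "countable A"
  then obtain f :: "'a \<Rightarrow> nat" where "inj_on f A"
    by (rule countableE)
  then have "|A| \<le>o |UNIV :: nat set|"
    by (rule card_of_ordLeqI) simp
  then show "|A| \<le>o natLeq"
    using card_of_nat ordLeq_ordIso_trans by blast
next
  assume "|A| \<le>o natLeq"
  then have "|A| \<le>o |UNIV :: nat set|"
    using card_of_nat ordIso_symmetric ordLeq_ordIso_trans by blast
  then obtain f :: "'a \<Rightarrow> nat" where "inj_on f A"
    using card_of_ordLeq[of A "UNIV :: nat set"] by auto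
  then show "countable A"
    by (rule countableI)
qed

lemma countable_le_cardSuc_natLeq: "countable A \<Longrightarrow> |A| \<le>o cardSuc natLeq"
  using countable_iff_le_natLeq cardSuc_ordLeq[OF natLeq_Card_order] ordLeq_transitive by blast

lemma uncountable_Field_cardSuc_natLeq: "uncountable (Field (cardSuc natLeq))"
proof
  assume "countable (Field (cardSuc natLeq))"
  then have "|Field (cardSuc natLeq)| \<le>o natLeq"
    by (simp only: countable_iff_le_natLeq)
  then have "cardSuc natLeq \<le>o natLeq"
    using card_of_Field_ordIso[OF cardSuc_Card_order[OF natLeq_Card_order]] ordIso_symmetric ordIso_ordLeq_trans
    by blast
  then show False
    using cardSuc_greater[OF natLeq_Card_order] not_ordLess_ordLeq by blast
qed

lemma pigeonhole_beyond_cardSuc_natLeq: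
  assumes "\<not> |A| \<le>o cardSuc natLeq" and "|I| \<le>o cardSuc natLeq" and "A \<subseteq> (\<Union>i\<in>I. B i)"
  obtains i where "i \<in> I" "\<not> |B i| \<le>o cardSuc natLeq"
proof (rule ccontr)
  assume "\<not> thesis"
  then have "|\<Union>i\<in>I. B i| \<le>o cardSuc natLeq"
    using that by (intro card_of_UN_le_cardSuc_natLeq[OF assms(2)]) blast
  then show False
    using assms(1) ordLeq_transitive[OF card_of_mono1[OF assms(3)]] by blast
qed

lemma card_lists_le:
  assumes "|A| \<le>o |B|" and "infinite B"
  shows "|lists A| \<le>o |B|"
proof -
  have len: "|{xs \<in> lists A. length xs = n}| \<le>o |B|" for n
  proof (induction n)
    case 0
    have eq: "{xs \<in> lists A. length xs = 0} = {[]}"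
      by (intro equalityI subsetI) simp_all
    show ?case
      unfolding eq by (rule card_of_singl_ordLeq) (use assms(2) in auto)
  next
    case (Suc n)
    have "{xs \<in> lists A. length xs = Suc n} \<subseteq> (\<lambda>(a, xs). a # xs) ` (A \<times> {xs \<in> lists A. length xs = n})"
      by (auto simp: length_Suc_conv image_iff)
    then have "|{xs \<in> lists A. length xs = Suc n}| \<le>o |A \<times> {xs \<in> lists A. length xs = n}|"
      by (rule ordLeq_transitive[OF card_of_mono1 card_of_image])
    also have "|A \<times> {xs \<in> lists A. length xs = n}| \<le>o |B|"
      using card_of_Sigma_ordLeq_infinite[OF assms(2,1), of "\<lambda>_. {xs \<in> lists A. length xs = n}"] Suc
      by blast
    finally show ?case .
  qed
  have "lists A = (\<Union>n. {xs \<in> lists A. length xs = n})"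
    by auto
  moreover have "|\<Union>n. {xs \<in> lists A. length xs = n}| \<le>o |B|"
    using assms(2) len by (intro card_of_UNION_ordLeq_infinite) (auto simp: infinite_iff_card_of_nat)
  ultimately show ?thesis
    by simp
qed

lemma card_functions_le:
  assumes "infinite (UNIV :: 'b set)"
    and "|UNIV :: 'a set| \<le>o |UNIV :: 'b set|"
    and "|UNIV :: 'c set| \<le>o |UNIV :: ('b \<Rightarrow> bool) set|"
  shows "|UNIV :: ('a \<Rightarrow> 'c) set| \<le>o |UNIV :: ('b \<Rightarrow> bool) set|"
proof -
  have "|(UNIV :: 'a set) \<times> (UNIV :: 'b set)| \<le>o |UNIV :: 'b set|"
    using card_of_Sigma_ordLeq_infinite[OF assms(1,2), of "\<lambda>_. UNIV :: 'b set"]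
    by (simp add: ordLeq_refl card_of_Card_order)
  then obtain j :: "'a \<times> 'b \<Rightarrow> 'b" where j: "inj j"
    using card_of_ordLeq[of "UNIV :: ('a \<times> 'b) set" "UNIV :: 'b set"] by auto
  obtain \<iota> :: "'c \<Rightarrow> 'b \<Rightarrow> bool" where \<iota>: "inj \<iota>"
    using assms(3) card_of_ordLeq[of "UNIV :: 'c set" "UNIV :: ('b \<Rightarrow> bool) set"] by auto
  define e where "e f b = (b \<in> range j \<and> \<iota> (f (fst (inv j b))) (snd (inv j b)))" for f :: "'a \<Rightarrow> 'c" and b
  have "inj e"
  proof (rule injI)
    fix f g assume "e f = e g"
    then have "e f (j (a, b)) = e g (j (a, b))" for a b
      by simp
    then have "\<iota> (f a) b = \<iota> (g a) b" for a b
      by (simp add: e_def j)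
    then have "\<iota> (f a) = \<iota> (g a)" for a
      by blast
    then show "f = g"
      using \<iota> by (auto dest: injD)
  qed
  then show ?thesis
    using card_of_ordLeq[of UNIV] by blast
qed

lemma card_option_le:
  assumes "infinite (UNIV :: 'b set)"
    and "|UNIV :: 'c set| \<le>o |UNIV :: 'b set|"
  shows "|UNIV :: 'c option set| \<le>o |UNIV :: 'b set|"
proof -
  have "|UNIV :: 'c option set| \<le>o |lists (UNIV :: 'c set)|"
    by (rule card_of_ordLeqI[where f = "case_option [] (\<lambda>c. [c])"])
       (auto simp: inj_on_def split: option.splits)
  then show ?thesis
    using card_lists_le[OF assms(2,1)] ordLeq_transitive by blast
qed

lemma card_le_predicates: "|UNIV :: 'b set| \<le>o |UNIV :: ('b \<Rightarrow> bool) set|"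
  by (rule card_of_ordLeqI[where f = "\<lambda>a b. a = b"]) (auto simp: inj_on_def fun_eq_iff)

lemma infinite_predicates: "infinite (UNIV :: 'b set) \<Longrightarrow> infinite (UNIV :: ('b \<Rightarrow> bool) set)"
  by (rule card_of_ordLeq_infinite[OF card_le_predicates])

section \<open>Reflecting sets and end-homogeneous sequences\<close>

text \<open>Terms over one constant and \<open>'b\<close>-ary operations labelled by \<open>'l\<close>. A term is determined by the
labels met along the finite paths from its root, so there are at most as many terms as functions
on lists. This bounds the size of the set generated by infinitary operations without iterating
the operations transfinitely.\<close>

datatype ('l, 'b) term_tree = Leaf | Node 'l "'b \<Rightarrow> ('l, 'b) term_tree"

primrec node_label :: "('l, 'b) term_tree \<Rightarrow> 'b list \<Rightarrow> 'l option" where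
  "node_label Leaf = (\<lambda>_. None)"
| "node_label (Node l f) = (\<lambda>p. case p of [] \<Rightarrow> Some l | b # q \<Rightarrow> node_label (f b) q)"

primrec eval_tree :: "('l \<Rightarrow> ('b \<Rightarrow> 'p) \<Rightarrow> 'p) \<Rightarrow> 'p \<Rightarrow> ('l, 'b) term_tree \<Rightarrow> 'p" where
  "eval_tree op p Leaf = p"
| "eval_tree op p (Node l f) = op l (\<lambda>b. eval_tree op p (f b))"

lemma inj_node_label: "inj (node_label :: ('l, 'b) term_tree \<Rightarrow> _)"
proof (rule injI)
  fix s t :: "('l, 'b) term_tree"
  show "node_label s = node_label t \<Longrightarrow> s = t"
  proof (induction s arbitrary: t)
    case Leaf
    then have "node_label t [] = None"
      by (metis node_label.simps(1))
    then show ?case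
      by (cases t) auto
  next
    case (Node l f)
    show ?case
    proof (cases t)
      case Leaf
      then have "node_label (Node l f) [] = None"
        using Node.prems by simp
      then show ?thesis
        by simp
    next
      case t: (Node l' f')
      have eq: "node_label (Node l f) p = node_label (Node l' f') p" for p
        using Node.prems t by simp
      have "l = l'"
        using eq[of "[]"] by simp
      moreover have "f b = f' b" for b
        using eq[of "b # q" for q] by (intro Node.IH) auto
      ultimately show ?thesis
        using t by blast
    qed
  qed
qed

text \<open>The values of all terms: there are no more of them than there are terms.\<close>

lemma small_closed_set:
  fixes op :: "'l \<Rightarrow> ('b \<Rightarrow> 'p) \<Rightarrow> 'p" and p :: 'p
  assumes inf: "infinite (UNIV :: 'b set)"
    and l: "|UNIV :: 'l set| \<le>o |UNIV :: ('b \<Rightarrow> bool) set|"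
  obtains R where "|R| \<le>o |UNIV :: ('b \<Rightarrow> bool) set|" "p \<in> R"
    "\<And>l s. range s \<subseteq> R \<Longrightarrow> op l s \<in> R"
proof
  define R where "R = range (eval_tree op p)"
  show "p \<in> R"
    unfolding R_def by (metis eval_tree.simps(1) rangeI)
  have "|UNIV :: 'b list set| \<le>o |UNIV :: 'b set|"
    using card_lists_le[OF ordLeq_refl[OF card_of_Card_order] inf] by simp
  then have "|UNIV :: ('b list \<Rightarrow> 'l option) set| \<le>o |UNIV :: ('b \<Rightarrow> bool) set|"
    using card_functions_le[OF inf] card_option_le[OF infinite_predicates[OF inf] l] by blast
  moreover have "|UNIV :: ('l, 'b) term_tree set| \<le>o |UNIV :: ('b list \<Rightarrow> 'l option) set|"
    by (rule card_of_ordLeqI[OF inj_node_label]) simp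
  moreover have "|R| \<le>o |UNIV :: ('l, 'b) term_tree set|"
    unfolding R_def by (rule card_of_image)
  ultimately show "|R| \<le>o |UNIV :: ('b \<Rightarrow> bool) set|"
    by (meson ordLeq_transitive)
  show "op l s \<in> R" if s: "range s \<subseteq> R" for l s
  proof -
    have "\<forall>b. \<exists>t. s b = eval_tree op p t"
      using s unfolding R_def by blast
    then obtain f where "\<And>b. s b = eval_tree op p (f b)"
      by metis
    then have "s = (\<lambda>b. eval_tree op p (f b))"
      by blast
    then have "op l s = eval_tree op p (Node l f)"
      by simp
    then show ?thesis
      unfolding R_def by blast
  qed
qed

text \<open>The type of \<open>x\<close> over a family \<open>s\<close> consists of the colours of \<open>x\<close> together with two members of \<open>s\<close>. A
reflecting set realises every type over one of its \<open>'b\<close>-indexed families that is realised in \<open>I\<close>, and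
realises it outside the family whenever this is possible. It serves as an elementary submodel that is closed under
\<open>'b\<close>-indexed sequences.\<close>

definition reflecting :: "'p set \<Rightarrow> ('p \<Rightarrow> 'p \<Rightarrow> 'p \<Rightarrow> 'c) \<Rightarrow> 'b itself \<Rightarrow> 'p set \<Rightarrow> bool"
  where "reflecting I col (_ :: 'b itself) R \<longleftrightarrow>
    (\<forall>s :: 'b \<Rightarrow> 'p. range s \<subseteq> R \<longrightarrow> (\<forall>x\<in>I. \<exists>y\<in>R \<inter> I.
       (\<forall>b b'. col (s b) (s b') y = col (s b) (s b') x) \<and> (x \<notin> range s \<longrightarrow> y \<notin> range s)))"

text \<open>One operation that picks a realisation of each type makes a closed set reflecting. The operations
\<open>op\<close> leave room for closure properties specific to an application.\<close>

lemma small_reflecting_set: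
  fixes col :: "'p \<Rightarrow> 'p \<Rightarrow> 'p \<Rightarrow> 'c" and op :: "'l \<Rightarrow> ('b \<Rightarrow> 'p) \<Rightarrow> 'p" and p :: 'p
  assumes inf: "infinite (UNIV :: 'b set)"
    and c: "|UNIV :: 'c set| \<le>o |UNIV :: ('b \<Rightarrow> bool) set|"
    and l: "|UNIV :: 'l set| \<le>o |UNIV :: ('b \<Rightarrow> bool) set|"
  obtains R where "|R| \<le>o |UNIV :: ('b \<Rightarrow> bool) set|" "p \<in> R" "reflecting I col TYPE('b) R"
    "\<And>l s. range s \<subseteq> R \<Longrightarrow> op l s \<in> R"
proof -
  define Q where "Q t s y \<longleftrightarrow> y \<in> I \<and> (\<forall>b b'. col (s b) (s b') y = fst t b b') \<and> (snd t \<longrightarrow> y \<notin> range s)"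
    for t :: "('b \<Rightarrow> 'b \<Rightarrow> 'c) \<times> bool" and s :: "'b \<Rightarrow> 'p" and y
  define op' where "op' m s = (case m of Inl t \<Rightarrow> SOME y. Q t s y | Inr l \<Rightarrow> op l s)" for m s
  have le: "|UNIV :: ('b \<Rightarrow> 'b \<Rightarrow> 'c) set| \<le>o |UNIV :: ('b \<Rightarrow> bool) set|"
    by (intro card_functions_le inf c ordLeq_refl card_of_Card_order)
  have infp: "infinite (UNIV :: ('b \<Rightarrow> bool) set)"
    using infinite_predicates inf by blast
  have "|UNIV :: bool set| \<le>o |UNIV :: ('b \<Rightarrow> bool) set|"
    by (rule card_of_ordLeqI[where f = "\<lambda>c _. c"]) (auto simp: inj_on_def fun_eq_iff)
  then have "|UNIV :: (('b \<Rightarrow> 'b \<Rightarrow> 'c) \<times> bool) set| \<le>o |UNIV :: ('b \<Rightarrow> bool) set|"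
    using card_of_Sigma_ordLeq_infinite[OF infp le, of "\<lambda>_. UNIV :: bool set"] by (simp add: UNIV_Times_UNIV)
  then have "|(UNIV :: (('b \<Rightarrow> 'b \<Rightarrow> 'c) \<times> bool) set) <+> (UNIV :: 'l set)| \<le>o |UNIV :: ('b \<Rightarrow> bool) set|"
    using l infp by (intro card_of_Plus_ordLeq_infinite_Field[OF _ _ _ card_of_Card_order]) (auto simp: Field_card_of)
  then have "|UNIV :: ((('b \<Rightarrow> 'b \<Rightarrow> 'c) \<times> bool) + 'l) set| \<le>o |UNIV :: ('b \<Rightarrow> bool) set|"
    by (simp add: UNIV_Plus_UNIV)
  then obtain R where R: "|R| \<le>o |UNIV :: ('b \<Rightarrow> bool) set|" "p \<in> R"
    "\<And>m s. range s \<subseteq> R \<Longrightarrow> op' m s \<in> R"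
    using small_closed_set[where op = op' and p = p, OF inf] by blast
  moreover have "reflecting I col TYPE('b) R"
    unfolding reflecting_def
  proof (intro allI impI ballI)
    fix s :: "'b \<Rightarrow> 'p" and x assume s: "range s \<subseteq> R" and x: "x \<in> I"
    define t where "t = (\<lambda>b b'. col (s b) (s b') x, x \<notin> range s)"
    define y where "y = (SOME y. Q t s y)"
    have "Q t s x"
      using x by (simp add: Q_def t_def)
    then have "Q t s y"
      unfolding y_def by (rule someI)
    moreover have "y \<in> R"
      using R(3)[OF s, of "Inl t"] by (simp add: op'_def y_def)
    ultimately show "\<exists>y\<in>R \<inter> I. (\<forall>b b'. col (s b) (s b') y = col (s b) (s b') x) \<and> (x \<notin> range s \<longrightarrow> y \<notin> range s)"
      unfolding Q_def t_def by (intro bexI[of _ y]) auto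
  qed
  moreover have "op l s \<in> R" if "range s \<subseteq> R" for l s
    using R(3)[OF that, of "Inr l"] by (simp add: op'_def)
  ultimately show thesis
    using that by blast
qed

text \<open>The recursion of the Erdos--Rado theorem, with the limit point \<open>x\<close> fixed beforehand: at every stage
\<open>x\<close> itself realises its type over what has been constructed, hence so does some new element of the
reflecting set. The colour of a tuple then depends only on its entries below the last one. The set \<open>D\<close> consists of parameters
over which all members of the sequence look like \<open>x\<close>.\<close>

lemma end_homogeneous_sequence:
  fixes col :: "'p \<Rightarrow> 'p \<Rightarrow> 'p \<Rightarrow> 'c" and r :: "'k rel"
  assumes refl: "reflecting I col TYPE('b) R" and inf: "infinite (UNIV :: 'b set)"
    and x: "x \<in> I" "x \<notin> R"
    and D: "D \<subseteq> R" "D \<noteq> {}" "|D| \<le>o |UNIV :: 'b set|"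
    and r: "Well_order r" "\<And>\<xi>. \<xi> \<in> Field r \<Longrightarrow> |underS r \<xi>| \<le>o |UNIV :: 'b set|"
  obtains y where "\<And>\<xi>. \<xi> \<in> Field r \<Longrightarrow> y \<xi> \<in> R \<inter> I"
    "\<And>\<xi> a a'. \<xi> \<in> Field r \<Longrightarrow> a \<in> D \<union> y ` underS r \<xi> \<Longrightarrow> a' \<in> D \<union> y ` underS r \<xi> \<Longrightarrow>
      col a a' (y \<xi>) = col a a' x"
    "\<And>\<xi>. \<xi> \<in> Field r \<Longrightarrow> y \<xi> \<notin> y ` underS r \<xi>"
proof -
  define P where "P f \<xi> v \<longleftrightarrow> (\<xi> \<in> Field r \<longrightarrow> v \<in> R \<inter> I \<and> v \<notin> f ` underS r \<xi> \<and>
      (\<forall>a\<in>D \<union> f ` underS r \<xi>. \<forall>a'\<in>D \<union> f ` underS r \<xi>. col a a' v = col a a' x))" for f \<xi> v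
  have "\<exists>f. \<forall>\<xi>. P f \<xi> (f \<xi>)"
  proof (rule dependent_wf_choice)
    show "wf (r - Id)"
      using r(1) well_order_on_def by blast
    fix f g :: "'k \<Rightarrow> 'p" and \<xi> v
    assume "\<And>\<eta>. (\<eta>, \<xi>) \<in> r - Id \<Longrightarrow> f \<eta> = g \<eta>"
    then have "f ` underS r \<xi> = g ` underS r \<xi>"
      by (intro image_cong) (auto simp: underS_def)
    then show "P f \<xi> v = P g \<xi> v"
      unfolding P_def by simp
  next
    fix \<xi> and f :: "'k \<Rightarrow> 'p"
    assume IH: "\<And>\<eta>. (\<eta>, \<xi>) \<in> r - Id \<Longrightarrow> P f \<eta> (f \<eta>)"
    show "\<exists>v. P f \<xi> v"
    proof (cases "\<xi> \<in> Field r")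
      case True
      define A where "A = D \<union> f ` underS r \<xi>"
      have "f ` underS r \<xi> \<subseteq> R"
      proof
        fix v assume "v \<in> f ` underS r \<xi>"
        then obtain \<eta> where "v = f \<eta>" "(\<eta>, \<xi>) \<in> r - Id"
          by (auto simp: underS_def)
        then show "v \<in> R"
          using IH[of \<eta>] by (auto simp: P_def Field_def)
      qed
      then have AR: "A \<subseteq> R"
        using D unfolding A_def by blast
      have "|f ` underS r \<xi>| \<le>o |UNIV :: 'b set|"
        using r(2)[OF True] card_of_image ordLeq_transitive by blast
      then have "|A| \<le>o |UNIV :: 'b set|"
        using D(3) inf unfolding A_def by (intro card_of_Un_ordLeq_infinite_Field[OF _ _ _ card_of_Card_order]) (auto simp: Field_card_of)
      then obtain s :: "'b \<Rightarrow> 'p" where s: "range s = A"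
        using D(2) card_of_ordLeq2[of A "UNIV :: 'b set"] unfolding A_def by auto
      then obtain y where "y \<in> R \<inter> I" "\<And>b b'. col (s b) (s b') y = col (s b) (s b') x" "y \<notin> A"
        using refl x AR unfolding reflecting_def by blast
      then have "P f \<xi> y"
        unfolding P_def A_def[symmetric] using s A_def by blast
      then show ?thesis
        by blast
    qed (auto simp: P_def)
  qed
  then obtain y where "\<And>\<xi>. P y \<xi> (y \<xi>)"
    by blast
  then show thesis
    by (intro that[of y]) (auto simp: P_def)
qed

section \<open>Norming functionals\<close>

text \<open>Partial extensions are represented by their graphs: linear subspaces of the product with the real line on
which the second component is at most \<open>\<epsilon>\<close> times the norm of the first. Applied to \<open>(0, t)\<close> and \<open>(0, - t)\<close>
the inequality shows that such a subspace is single-valued, so that Zorn's lemma can be used for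
graphs alone.\<close>

lemma Hahn_Banach_extension:
  fixes f :: "'a::real_normed_vector \<Rightarrow> real"
  assumes N: "subspace N"
    and lin: "\<And>x y. x \<in> N \<Longrightarrow> y \<in> N \<Longrightarrow> f (x + y) = f x + f y"
      "\<And>c x. x \<in> N \<Longrightarrow> f (c *\<^sub>R x) = c * f x"
    and bound: "\<And>x. x \<in> N \<Longrightarrow> f x \<le> \<epsilon> * norm x" and \<epsilon>: "\<epsilon> \<ge> 0"
  obtains g :: "'a \<Rightarrow>\<^sub>L real" where "\<And>x. x \<in> N \<Longrightarrow> g x = f x" "norm g \<le> \<epsilon>"
proof -
  define G0 where "G0 = (\<lambda>x. (x, f x)) ` N"
  define \<G> where "\<G> = {G :: ('a \<times> real) set. subspace G \<and> G0 \<subseteq> G \<and> (\<forall>(x, t)\<in>G. t \<le> \<epsilon> * norm x)}"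
  have "f 0 = 0"
    using lin(2)[of 0 0] N subspace_0 by fastforce
  have "subspace G0"
    unfolding subspace_def
  proof (intro conjI allI ballI)
    show "0 \<in> G0"
      using \<open>f 0 = 0\<close> subspace_0[OF N] by (auto simp: G0_def zero_prod_def image_iff)
    show "u + v \<in> G0" if uv: "u \<in> G0" "v \<in> G0" for u v
    proof -
      obtain x y where "u = (x, f x)" "v = (y, f y)" "x \<in> N" "y \<in> N"
        using uv unfolding G0_def by blast
      then show ?thesis
        using lin(1)[of x y] subspace_add[OF N, of x y] by (auto simp: G0_def image_iff)
    qed
    show "c *\<^sub>R u \<in> G0" if uv: "u \<in> G0" for c u
    proof -
      obtain x where "u = (x, f x)" "x \<in> N"
        using uv unfolding G0_def by blast
      then show ?thesis
        using lin(2)[of x c] subspace_scale[OF N, of x c] by (auto simp: G0_def image_iff)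
    qed
  qed
  then have G0: "G0 \<in> \<G>"
    using bound unfolding \<G>_def G0_def by auto
  have "\<exists>M\<in>\<G>. \<forall>X\<in>\<G>. M \<subseteq> X \<longrightarrow> X = M"
  proof (rule subset_Zorn)
    fix C assume C: "subset.chain \<G> C"
    show "\<exists>U\<in>\<G>. \<forall>X\<in>C. X \<subseteq> U"
    proof (cases "C = {}")
      case False
      have sub: "subspace X" "G0 \<subseteq> X" "\<And>x t. (x, t) \<in> X \<Longrightarrow> t \<le> \<epsilon> * norm x" if "X \<in> C" for X
        using C that unfolding subset.chain_def \<G>_def by auto
      have "subspace (\<Union>C)"
        unfolding subspace_def
      proof (intro conjI allI ballI)
        show "0 \<in> \<Union>C"
          using False sub(1) subspace_0 by fastforce
        fix u v assume "u \<in> \<Union>C" "v \<in> \<Union>C"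
        then obtain X where "X \<in> C" "u \<in> X" "v \<in> X"
          using C unfolding subset.chain_def by blast
        then show "u + v \<in> \<Union>C"
          using sub(1) subspace_add by blast
      next
        fix c :: real and u assume "u \<in> \<Union>C"
        then show "c *\<^sub>R u \<in> \<Union>C"
          using sub(1) subspace_scale by blast
      qed
      then have "\<Union>C \<in> \<G>"
        using sub False unfolding \<G>_def by fast
      then show ?thesis
        by blast
    qed (use G0 in blast)
  qed
  then obtain M where M: "M \<in> \<G>" and max: "\<And>X. X \<in> \<G> \<Longrightarrow> M \<subseteq> X \<Longrightarrow> X = M"
    by blast
  have sM: "subspace M" and GM: "G0 \<subseteq> M" and bM: "\<And>x t. (x, t) \<in> M \<Longrightarrow> t \<le> \<epsilon> * norm x"
    using M unfolding \<G>_def by auto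
  have uniq: "t = t'" if "(x, t) \<in> M" "(x, t') \<in> M" for x t t'
  proof -
    have "(x, t) - (x, t') \<in> M" "(x, t') - (x, t) \<in> M"
      using that sM subspace_diff by blast+
    then show ?thesis
      using bM[of 0 "t - t'"] bM[of 0 "t' - t"] by simp
  qed
  have total: "\<exists>t. (x0, t) \<in> M" for x0
  proof -
    define L where "L = {t - \<epsilon> * norm (x - x0) |x t. (x, t) \<in> M}"
    have sep: "t - \<epsilon> * norm (x - x0) \<le> \<epsilon> * norm (x' + x0) - t'" if "(x, t) \<in> M" "(x', t') \<in> M" for x t x' t'
    proof -
      have "t + t' \<le> \<epsilon> * norm (x + x')"
        using subspace_add[OF sM that] bM by simp
      also have "\<dots> \<le> \<epsilon> * (norm (x - x0) + norm (x' + x0))"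
        using \<epsilon> norm_triangle_ineq[of "x - x0" "x' + x0"] by (intro mult_left_mono) auto
      finally show ?thesis
        by (simp add: algebra_simps)
    qed
    have z: "(0, 0) \<in> M"
      using subspace_0[OF sM] unfolding zero_prod_def .
    have L: "L \<noteq> {}" "bdd_above L"
      unfolding L_def using z sep[OF _ z] by (auto intro!: bdd_aboveI)
    \<comment> \<open>By \<open>sep\<close>, this value at \<open>x0\<close> respects the bound on both sides of \<open>x0\<close>.\<close>
    define a where "a = Sup L"
    have a1: "t - \<epsilon> * norm (x - x0) \<le> a" if "(x, t) \<in> M" for x t
      unfolding a_def using L that by (intro cSup_upper) (auto simp: L_def)
    have a2: "a \<le> \<epsilon> * norm (x' + x0) - t'" if "(x', t') \<in> M" for x' t'
      unfolding a_def using L sep that by (intro cSup_least) (auto simp: L_def)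
    define M' where "M' = {u + c *\<^sub>R (x0, a) |u c. u \<in> M}"
    have "subspace M'"
      unfolding subspace_def
    proof (intro conjI allI ballI)
      show "0 \<in> M'"
      proof -
        have "0 = 0 + 0 *\<^sub>R (x0, a)"
          by (simp add: zero_prod_def)
        then show ?thesis
          unfolding M'_def using subspace_0[OF sM] by blast
      qed
      fix v w assume "v \<in> M'" "w \<in> M'"
      then obtain u c u' c' where "v = u + c *\<^sub>R (x0, a)" "w = u' + c' *\<^sub>R (x0, a)" "u \<in> M" "u' \<in> M"
        unfolding M'_def by blast
      then have "v + w = (u + u') + (c + c') *\<^sub>R (x0, a)" "u + u' \<in> M"
        using subspace_add[OF sM] by (auto simp: algebra_simps)
      then show "v + w \<in> M'"
        unfolding M'_def by blast
    next
      fix d :: real and v assume "v \<in> M'"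
      then obtain u c where "v = u + c *\<^sub>R (x0, a)" "u \<in> M"
        unfolding M'_def by blast
      then have "d *\<^sub>R v = d *\<^sub>R u + (d * c) *\<^sub>R (x0, a)" "d *\<^sub>R u \<in> M"
        using subspace_scale[OF sM] by (auto simp: algebra_simps)
      then show "d *\<^sub>R v \<in> M'"
        unfolding M'_def by blast
    qed
    moreover have MM': "M \<subseteq> M'"
    proof
      fix u assume "u \<in> M"
      moreover have "u = u + 0 *\<^sub>R (x0, a)"
        by (simp add: zero_prod_def[symmetric])
      ultimately show "u \<in> M'"
        unfolding M'_def by blast
    qed
    moreover have "s \<le> \<epsilon> * norm y" if ys: "(y, s) \<in> M'" for y s
    proof -
      obtain x t c where eq: "y = x + c *\<^sub>R x0" "s = t + c * a" and xt: "(x, t) \<in> M"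
        using ys unfolding M'_def by auto
      consider "c = 0" | "c > 0" | "c < 0"
        by linarith
      then show ?thesis
      proof cases
        case 1
        then show ?thesis
          using bM xt eq by simp
      next
        case 2
        have "((1 / c) *\<^sub>R x, t / c) \<in> M"
          using subspace_scale[OF sM xt, of "1 / c"] by simp
        from a2[OF this] have "a * c \<le> (\<epsilon> * norm ((1 / c) *\<^sub>R x + x0) - t / c) * c"
          using 2 by (intro mult_right_mono) auto
        also have "\<dots> = \<epsilon> * norm (c *\<^sub>R ((1 / c) *\<^sub>R x + x0)) - t"
          using 2 by (simp only: norm_scaleR abs_of_pos left_diff_distrib mult.assoc) simp
        also have "c *\<^sub>R ((1 / c) *\<^sub>R x + x0) = y"
          using 2 by (simp add: eq algebra_simps)
        finally show ?thesis
          by (simp add: eq algebra_simps)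
      next
        case 3
        have "((- 1 / c) *\<^sub>R x, - t / c) \<in> M"
          using subspace_scale[OF sM xt, of "- 1 / c"] by simp
        from a1[OF this] have "(- t / c - \<epsilon> * norm ((- 1 / c) *\<^sub>R x - x0)) * (- c) \<le> a * (- c)"
          using 3 by (intro mult_right_mono) auto
        moreover have "\<epsilon> * norm ((- 1 / c) *\<^sub>R x - x0) * (- c) = \<epsilon> * norm (- c *\<^sub>R ((- 1 / c) *\<^sub>R x - x0))"
          using 3 by simp
        moreover have "- c *\<^sub>R ((- 1 / c) *\<^sub>R x - x0) = x + c *\<^sub>R x0"
          using 3 by (simp add: algebra_simps)
        ultimately show ?thesis
          using 3 by (simp add: eq algebra_simps)
      qed
    qed
    ultimately have "M' \<in> \<G>"
      using GM unfolding \<G>_def by blast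
    then have "M' = M"
      using max MM' by blast
    moreover have "(x0, a) \<in> M'"
    proof -
      have "(x0, a) = (0, 0) + 1 *\<^sub>R (x0, a)"
        by simp
      then show ?thesis
        unfolding M'_def using z by blast
    qed
    ultimately show ?thesis
      by blast
  qed
  then obtain h where h: "\<And>x. (x, h x) \<in> M"
    by metis
  have hle: "h x \<le> \<epsilon> * norm x" for x
    using bM h by blast
  have add: "h (x + y) = h x + h y" for x y
    using subspace_add[OF sM h[of x] h[of y]] uniq[OF h] by simp
  have scale: "h (c *\<^sub>R x) = c * h x" for c x
    using subspace_scale[OF sM h[of x], of c] uniq[OF h] by simp
  have habs: "\<bar>h x\<bar> \<le> \<epsilon> * norm x" for x
    using hle[of x] hle[of "- x"] scale[of "- 1" x] by simp
  have bl: "bounded_linear h"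
    by (rule bounded_linear_intro[where K = \<epsilon>]) (auto simp: add scale habs mult.commute)
  show thesis
  proof
    show "blinfun_apply (Blinfun h) x = f x" if "x \<in> N" for x
    proof -
      have "(x, f x) \<in> M"
        using GM that unfolding G0_def by blast
      then show ?thesis
        using uniq[OF h] bl by (simp add: bounded_linear_Blinfun_apply)
    qed
    show "norm (Blinfun h) \<le> \<epsilon>"
      using bl habs \<epsilon> by (intro norm_blinfun_bound) (auto simp: bounded_linear_Blinfun_apply)
  qed
qed

lemma norming_functional_exists:
  fixes x :: "'a::real_normed_vector"
  assumes "x \<noteq> 0"
  shows "\<exists>g :: 'a \<Rightarrow>\<^sub>L real. norm g = 1 \<and> blinfun_apply g x = norm x"
proof -
  define f where "f y = (SOME c. y = c *\<^sub>R x) * norm x" for y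
  have f: "f (c *\<^sub>R x) = c * norm x" for c
  proof -
    have "(SOME c'. c *\<^sub>R x = c' *\<^sub>R x) = c"
      by (rule some_equality) (use assms in auto)
    then show ?thesis
      by (simp add: f_def)
  qed
  have h1: "subspace (range (\<lambda>c. c *\<^sub>R x))"
    by (metis span_singleton subspace_span)
  have h3: "f (c *\<^sub>R u) = c * f u" if u: "u \<in> range (\<lambda>c. c *\<^sub>R x)" for c u
  proof -
    obtain a where "u = a *\<^sub>R x"
      using u by blast
    then show ?thesis
      using f[of "c * a"] by (simp add: f)
  qed
  have h2: "f (u + v) = f u + f v" if uv: "u \<in> range (\<lambda>c. c *\<^sub>R x)" "v \<in> range (\<lambda>c. c *\<^sub>R x)" for u v
  proof -
    obtain a b where "u = a *\<^sub>R x" "v = b *\<^sub>R x"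
      using uv by blast
    then show ?thesis
      using f[of "a + b"] by (simp add: f scaleR_add_left distrib_right)
  qed
  have h4: "f u \<le> 1 * norm u" if "u \<in> range (\<lambda>c. c *\<^sub>R x)" for u
    using that by (auto simp: f mult_right_mono)
  obtain g :: "'a \<Rightarrow>\<^sub>L real" where g: "\<And>u. u \<in> range (\<lambda>c. c *\<^sub>R x) \<Longrightarrow> g u = f u" "norm g \<le> 1"
    using Hahn_Banach_extension[OF h1 h2 h3 h4 zero_le_one] by blast
  have gx: "g x = norm x"
    using g(1)[of x] f[of 1] by (metis mult_1 rangeI scaleR_one)
  have "norm x \<le> norm g * norm x"
    using norm_blinfun[of g x] gx by simp
  then have "norm g \<ge> 1"
    using assms by simp
  then show ?thesis
    using g(2) gx by (intro exI[of _ g]) auto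
qed

definition norming :: "'a::real_normed_vector \<Rightarrow> 'a \<Rightarrow>\<^sub>L real"
  where "norming x = (if x = 0 then 0 else (SOME g. norm g = 1 \<and> blinfun_apply g x = norm x))"

lemma norming:
  shows "blinfun_apply (norming x) x = norm x" and "norm (norming x) \<le> 1"
    and "x \<noteq> 0 \<Longrightarrow> norm (norming x) = 1"
  using someI_ex[OF norming_functional_exists[of x]] by (auto simp: norming_def)

section \<open>Homogeneous biorthogonal systems\<close>

text \<open>The vector \<open>q\<close> is the average of the \<open>e i\<close> with weights \<open>1/2, 1/4, \<dots>\<close> along an enumeration of \<open>B\<close>. As an infinite
convex combination it can replace each \<open>e i\<close> in a norm inequality, and still all its coordinates
in \<open>B\<close> are strictly positive.\<close>

lemma infinite_convex_combination:
  fixes e :: "'i \<Rightarrow> 'v::banach" and \<phi> :: "'i \<Rightarrow> 'v \<Rightarrow> real"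
  assumes B: "countable B" "B \<noteq> {}" "B \<subseteq> H"
    and lin: "\<And>i. i \<in> H \<Longrightarrow> bounded_linear (\<phi> i)"
    and bio: "\<And>i j. i \<in> H \<Longrightarrow> j \<in> H \<Longrightarrow> \<phi> i (e j) = (if i = j then 1 else 0)"
    and norm_e: "\<And>i. i \<in> H \<Longrightarrow> norm (e i) \<le> 1"
  obtains q where "norm q \<le> 1"
    "\<And>i. i \<in> H \<Longrightarrow> i \<notin> B \<Longrightarrow> \<phi> i q = 0" "\<And>i. i \<in> B \<Longrightarrow> 0 < \<phi> i q"
    "\<And>v \<sigma>. (\<And>i. i \<in> B \<Longrightarrow> norm (v + \<sigma> *\<^sub>R e i) \<le> 1) \<Longrightarrow> norm (v + \<sigma> *\<^sub>R q) \<le> 1"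
proof -
  define b where "b = from_nat_into B"
  have b: "b n \<in> B" for n
    unfolding b_def by (rule from_nat_into[OF B(2)])
  define f where "f n = (1/2::real) ^ Suc n *\<^sub>R e (b n)" for n
  have half: "(\<lambda>n. (1/2::real) ^ Suc n) sums 1"
    by (rule power_half_series)
  have "summable f"
  proof (rule summable_comparison_test'[OF sums_summable[OF half]])
    show "norm (f n) \<le> (1/2) ^ Suc n" for n
      using norm_e[of "b n"] b B(3) by (auto simp: f_def mult_left_le)
  qed
  then have q: "f sums (suminf f)"
    by (rule summable_sums)
  have comb: "norm (v + \<sigma> *\<^sub>R suminf f) \<le> 1" if le: "\<And>i. i \<in> B \<Longrightarrow> norm (v + \<sigma> *\<^sub>R e i) \<le> 1" for v \<sigma>
  proof -
    have "(\<lambda>n. (1/2::real) ^ Suc n *\<^sub>R v) sums (1 *\<^sub>R v)"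
      by (rule bounded_linear.sums[OF bounded_linear_scaleR_left half])
    moreover have "(\<lambda>n. \<sigma> *\<^sub>R f n) sums (\<sigma> *\<^sub>R suminf f)"
      by (rule bounded_linear.sums[OF bounded_linear_scaleR_right q])
    ultimately have "(\<lambda>n. (1/2::real) ^ Suc n *\<^sub>R v + \<sigma> *\<^sub>R f n) sums (1 *\<^sub>R v + \<sigma> *\<^sub>R suminf f)"
      by (rule sums_add)
    moreover have "(1/2::real) ^ Suc n *\<^sub>R v + \<sigma> *\<^sub>R f n = (1/2) ^ Suc n *\<^sub>R (v + \<sigma> *\<^sub>R e (b n))" for n
      by (simp add: f_def algebra_simps)
    ultimately have s: "(\<lambda>n. (1/2::real) ^ Suc n *\<^sub>R (v + \<sigma> *\<^sub>R e (b n))) sums (v + \<sigma> *\<^sub>R suminf f)"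
      by simp
    have bd: "norm ((1/2::real) ^ Suc n *\<^sub>R (v + \<sigma> *\<^sub>R e (b n))) \<le> (1/2) ^ Suc n" for n
      using le[OF b] by (simp add: mult_left_le)
    show ?thesis
      using norm_sums_le[OF s half bd] by simp
  qed
  have eval: "(\<lambda>n. (1/2::real) ^ Suc n * (if i = b n then 1 else 0)) sums \<phi> i (suminf f)" if i: "i \<in> H" for i
  proof -
    have "\<phi> i (f n) = (1/2::real) ^ Suc n * (if i = b n then 1 else 0)" for n
      using bio[OF i, of "b n"] subsetD[OF B(3) b] linear_scale[OF bounded_linear.linear[OF lin[OF i]]]
      by (auto simp: f_def)
    then have "(\<lambda>n. \<phi> i (f n)) = (\<lambda>n. (1/2::real) ^ Suc n * (if i = b n then 1 else 0))"
      by blast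
    then show ?thesis
      using bounded_linear.sums[OF lin[OF i] q] by (simp only:)
  qed
  show thesis
  proof (rule that[of "suminf f"])
    show "norm (suminf f) \<le> 1"
      using comb[of 0 1] norm_e B(3) by auto
    show "\<phi> i (suminf f) = 0" if "i \<in> H" "i \<notin> B" for i
    proof -
      have "(\<lambda>n. (1/2::real) ^ Suc n * (if i = b n then 1 else 0)) = (\<lambda>_. 0)"
        using b that(2) by (intro ext) (metis mult_zero_right)
      then show ?thesis
        using eval[OF that(1)] sums_0 sums_unique2 by metis
    qed
    show "0 < \<phi> i (suminf f)" if i: "i \<in> B" for i
    proof -
      obtain m where m: "b m = i"
        using from_nat_into_surj[OF B(1) i] unfolding b_def by blast
      have s: "(\<lambda>n. (1/2::real) ^ Suc n * (if i = b n then 1 else 0)) sums \<phi> i (suminf f)"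
        using eval i B(3) by blast
      have "0 < (1/2::real) ^ Suc m * (if i = b m then 1 else 0)"
        using m by simp
      also have "\<dots> \<le> suminf (\<lambda>n. (1/2::real) ^ Suc n * (if i = b n then 1 else 0))"
        using sum_le_suminf[OF sums_summable[OF s], of "{m}"] by simp
      finally show ?thesis
        using sums_unique[OF s] by simp
    qed
    show "norm (v + \<sigma> *\<^sub>R suminf f) \<le> 1" if "\<And>i. i \<in> B \<Longrightarrow> norm (v + \<sigma> *\<^sub>R e i) \<le> 1" for v \<sigma>
      using comb that by blast
  qed
qed

text \<open>If \<open>norm (e i + \<sigma> *\<^sub>R e j) \<le> 1\<close> for all \<open>j\<close> below \<open>i\<close>, then by convexity \<open>e i + (\<sigma> * \<eta>) *\<^sub>R q i\<close>, where \<open>q i\<close> averages the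
earlier vectors, still has norm \<open>1\<close>, as \<open>\<phi> i\<close> shows. For \<open>j\<close> below \<open>i\<close> the functional \<open>\<phi> j\<close> takes on
this vector a value of sign \<open>\<sigma>\<close>, and it takes the value \<open>1\<close> on the vector with index \<open>j\<close>; so one of the two combinations of
the new vectors with indices \<open>i\<close> and \<open>j\<close> has norm greater than \<open>1\<close>. If the other sign has the uniform gap
\<open>\<delta>\<close>, a small \<open>\<eta>\<close> preserves the other combination. If both signs are absorbed, a fixed vector can be
added with coefficient \<open>7/8\<close>: it cancels in differences and dominates in sums.\<close>

theorem sym_separated_of_homogeneous_biorthogonal:
  fixes e :: "'i \<Rightarrow> 'v::banach" and \<phi> :: "'i \<Rightarrow> 'v \<Rightarrow> real" and r :: "'i rel"
  assumes H: "uncountable H"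
    and init: "\<And>i. i \<in> H \<Longrightarrow> countable {j \<in> H. j \<noteq> i \<and> (j, i) \<in> r}"
    and tot: "\<And>i j. i \<in> H \<Longrightarrow> j \<in> H \<Longrightarrow> i \<noteq> j \<Longrightarrow> (i, j) \<in> r \<or> (j, i) \<in> r"
    and lin: "\<And>i. i \<in> H \<Longrightarrow> bounded_linear (\<phi> i)"
    and le: "\<And>i v. i \<in> H \<Longrightarrow> \<bar>\<phi> i v\<bar> \<le> norm v"
    and bio: "\<And>i j. i \<in> H \<Longrightarrow> j \<in> H \<Longrightarrow> \<phi> i (e j) = (if i = j then 1 else 0)"
    and norm_e: "\<And>i. i \<in> H \<Longrightarrow> norm (e i) = 1"
    and plus: "(\<forall>i\<in>H. \<forall>j\<in>H. i \<noteq> j \<longrightarrow> norm (e i + e j) \<le> 1) \<or>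
      (\<exists>\<delta>>0. \<forall>i\<in>H. \<forall>j\<in>H. i \<noteq> j \<longrightarrow> norm (e i + e j) \<ge> 1 + \<delta>)"
    and minus: "(\<forall>i\<in>H. \<forall>j\<in>H. i \<noteq> j \<longrightarrow> norm (e i - e j) \<le> 1) \<or>
      (\<exists>\<delta>>0. \<forall>i\<in>H. \<forall>j\<in>H. i \<noteq> j \<longrightarrow> norm (e i - e j) \<ge> 1 + \<delta>)"
  shows "\<exists>A. A \<subseteq> sphere (0::'v) 1 \<and> uncountable A \<and> sym_one_plus_separated norm A"
proof -
  obtain i0 where i0: "i0 \<in> H"
    using H by fastforce
  define J where "J = {i \<in> H. i \<noteq> i0 \<and> (i0, i) \<in> r}"
  have JH: "J \<subseteq> H"
    unfolding J_def by blast
  have "H \<subseteq> J \<union> insert i0 {j \<in> H. j \<noteq> i0 \<and> (j, i0) \<in> r}"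
    using tot i0 unfolding J_def by blast
  then have J: "uncountable J"
    using H init[OF i0] by (metis countable_Un countable_insert countable_subset)
  define below where "below i = {j \<in> H. j \<noteq> i \<and> (j, i) \<in> r}" for i
  have below_H: "below i \<subseteq> H" and self: "i \<notin> below i" for i
    unfolding below_def by auto
  have below: "countable (below i)" "below i \<noteq> {}" if "i \<in> J" for i
    using that init[of i] i0 unfolding below_def J_def by auto
  have "\<exists>q. \<forall>i\<in>J. norm (q i) \<le> 1 \<and> (\<forall>j\<in>H. j \<notin> below i \<longrightarrow> \<phi> j (q i) = 0) \<and> (\<forall>j\<in>below i. 0 < \<phi> j (q i)) \<and>
     (\<forall>v \<sigma>. (\<forall>j\<in>below i. norm (v + \<sigma> *\<^sub>R e j) \<le> 1) \<longrightarrow> norm (v + \<sigma> *\<^sub>R q i) \<le> 1)"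
  proof (rule bchoice, rule ballI)
    fix i assume i: "i \<in> J"
    obtain q where "norm q \<le> 1"
      "\<And>j. j \<in> H \<Longrightarrow> j \<notin> below i \<Longrightarrow> \<phi> j q = 0" "\<And>j. j \<in> below i \<Longrightarrow> 0 < \<phi> j q"
      "\<And>v \<sigma>. (\<And>j. j \<in> below i \<Longrightarrow> norm (v + \<sigma> *\<^sub>R e j) \<le> 1) \<Longrightarrow> norm (v + \<sigma> *\<^sub>R q) \<le> 1"
      using infinite_convex_combination[OF below[OF i] below_H lin bio] norm_e by (metis order_refl)
    then show "\<exists>q. norm q \<le> 1 \<and> (\<forall>j\<in>H. j \<notin> below i \<longrightarrow> \<phi> j q = 0) \<and> (\<forall>j\<in>below i. 0 < \<phi> j q) \<and>
     (\<forall>v \<sigma>. (\<forall>j\<in>below i. norm (v + \<sigma> *\<^sub>R e j) \<le> 1) \<longrightarrow> norm (v + \<sigma> *\<^sub>R q) \<le> 1)"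
      by blast
  qed
  then obtain q where q_norm: "\<And>i. i \<in> J \<Longrightarrow> norm (q i) \<le> 1"
    and q_zero: "\<And>i j. i \<in> J \<Longrightarrow> j \<in> H \<Longrightarrow> j \<notin> below i \<Longrightarrow> \<phi> j (q i) = 0"
    and q_pos: "\<And>i j. i \<in> J \<Longrightarrow> j \<in> below i \<Longrightarrow> 0 < \<phi> j (q i)"
    and q_comb: "\<And>i v \<sigma>. i \<in> J \<Longrightarrow> (\<And>j. j \<in> below i \<Longrightarrow> norm (v + \<sigma> *\<^sub>R e j) \<le> 1) \<Longrightarrow>
      norm (v + \<sigma> *\<^sub>R q i) \<le> 1"
    by blast
  have sep: ?thesis if z1: "\<And>i. i \<in> J \<Longrightarrow> norm (z i) = 1"
    and z2: "\<And>i j. i \<in> J \<Longrightarrow> j \<in> J \<Longrightarrow> j \<in> below i \<Longrightarrow> norm (z i - z j) > 1 \<and> norm (z i + z j) > 1" for z :: "'i \<Rightarrow> 'v"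
  proof -
    have z: "norm (z i - z j) > 1 \<and> norm (z i + z j) > 1" if ij: "i \<in> J" "j \<in> J" "i \<noteq> j" for i j
    proof -
      have "j \<in> below i \<or> i \<in> below j"
        using tot[of i j] ij JH unfolding below_def by blast
      then show ?thesis
        using z2 ij by (metis norm_minus_commute add.commute)
    qed
    have "inj_on z J"
    proof (rule inj_onI, rule ccontr)
      fix i j assume "i \<in> J" "j \<in> J" "z i = z j" "i \<noteq> j"
      then show False
        using z[of i j] by simp
    qed
    then have "uncountable (z ` J)"
      using J countable_image_inj_on by blast
    moreover have "sym_one_plus_separated norm (z ` J)"
      unfolding sym_one_plus_separated_def using z by auto
    moreover have "z ` J \<subseteq> sphere 0 1"
      using z1 by auto
    ultimately show ?thesis
      by (intro exI[of _ "z ` J"]) simp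
  qed
  note \<phi>_simps = linear_add[OF bounded_linear.linear[OF lin]] linear_diff[OF bounded_linear.linear[OF lin]]
    linear_scale[OF bounded_linear.linear[OF lin]]
  have ne1: "norm v \<ge> 1" if "j \<in> H" "\<phi> j v = 1" for j v
    using le[OF that(1), of v] that(2) by simp
  have one_sign: ?thesis
    if \<sigma>: "\<bar>\<sigma>\<bar> = 1" and \<delta>: "\<delta> > 0"
      and abs: "\<And>i j. i \<in> H \<Longrightarrow> j \<in> H \<Longrightarrow> i \<noteq> j \<Longrightarrow> norm (e i + \<sigma> *\<^sub>R e j) \<le> 1"
      and far: "\<And>i j. i \<in> H \<Longrightarrow> j \<in> H \<Longrightarrow> i \<noteq> j \<Longrightarrow> norm (e i - \<sigma> *\<^sub>R e j) \<ge> 1 + \<delta>" for \<sigma> \<delta> :: real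
  proof -
    define \<eta> where "\<eta> = min 1 \<delta> / 4"
    have \<eta>: "0 < \<eta>" "\<eta> \<le> 1" "2 * \<eta> < \<delta>"
      using \<delta> by (auto simp: \<eta>_def min_def)
    define z where "z i = e i + (\<sigma> * \<eta>) *\<^sub>R q i" for i
    have e_q: "norm (e i + \<sigma> *\<^sub>R q i) \<le> 1" if "i \<in> J" for i
      using q_comb[OF that, of "e i" \<sigma>] abs[of i] that JH self below_H by blast
    have z_le: "norm (z i) \<le> 1" if i: "i \<in> J" for i
    proof -
      have "z i = (1 - \<eta>) *\<^sub>R e i + \<eta> *\<^sub>R (e i + \<sigma> *\<^sub>R q i)"
        by (simp add: z_def algebra_simps)
      also have "norm \<dots> \<le> (1 - \<eta>) * norm (e i) + \<eta> * norm (e i + \<sigma> *\<^sub>R q i)"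
        using \<eta> norm_triangle_ineq[of "(1 - \<eta>) *\<^sub>R e i" "\<eta> *\<^sub>R (e i + \<sigma> *\<^sub>R q i)"] by simp
      also have "\<dots> \<le> (1 - \<eta>) * 1 + \<eta> * 1"
        using \<eta> e_q[OF i] norm_e i JH by (intro add_mono mult_left_mono) auto
      finally show ?thesis
        by simp
    qed
    have \<phi>z: "\<phi> j (z i) = (if j = i then 1 else 0) + \<sigma> * \<eta> * \<phi> j (q i)" if "i \<in> J" "j \<in> H" for i j
      using that JH bio by (auto simp: z_def \<phi>_simps subset_iff)
    have z_eq: "norm (z i) = 1" if i: "i \<in> J" for i
      using z_le[OF i] ne1[of i "z i"] \<phi>z[OF i, of i] q_zero[OF i, of i] self i JH by fastforce
    have near: "norm (z i + \<sigma> *\<^sub>R z j) > 1" if "i \<in> J" "j \<in> J" "j \<in> below i" for i j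
    proof -
      have jH: "j \<in> H" and ij: "j \<noteq> i"
        using that JH self by auto
      have "\<phi> j (z i + \<sigma> *\<^sub>R z j) = \<sigma> * (\<eta> * \<phi> j (q i) + 1)"
        using \<phi>z[OF that(1) jH] \<phi>z[OF that(2) jH] q_zero[OF that(2) jH self] ij
        by (simp add: \<phi>_simps[OF jH] algebra_simps)
      then have "\<bar>\<phi> j (z i + \<sigma> *\<^sub>R z j)\<bar> = \<eta> * \<phi> j (q i) + 1"
        using \<sigma> \<eta> q_pos[OF that(1,3)] by (simp add: abs_mult)
      moreover have "\<eta> * \<phi> j (q i) > 0"
        using \<eta> q_pos[OF that(1,3)] by simp
      ultimately show ?thesis
        using le[OF jH, of "z i + \<sigma> *\<^sub>R z j"] by linarith
    qed
    have distant: "norm (z i - \<sigma> *\<^sub>R z j) > 1" if ij: "i \<in> J" "j \<in> J" "j \<in> below i" for i j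
    proof -
      have "e i - \<sigma> *\<^sub>R e j = (z i - \<sigma> *\<^sub>R z j) - ((\<sigma> * \<eta>) *\<^sub>R q i - (\<sigma> * \<sigma> * \<eta>) *\<^sub>R q j)"
        by (simp add: z_def algebra_simps)
      then have "norm (e i - \<sigma> *\<^sub>R e j) \<le> norm (z i - \<sigma> *\<^sub>R z j) + norm ((\<sigma> * \<eta>) *\<^sub>R q i - (\<sigma> * \<sigma> * \<eta>) *\<^sub>R q j)"
        by (simp only: norm_triangle_ineq4)
      also have "norm ((\<sigma> * \<eta>) *\<^sub>R q i - (\<sigma> * \<sigma> * \<eta>) *\<^sub>R q j) \<le> norm ((\<sigma> * \<eta>) *\<^sub>R q i) + norm ((\<sigma> * \<sigma> * \<eta>) *\<^sub>R q j)"
        by (rule norm_triangle_ineq4)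
      also have "norm ((\<sigma> * \<eta>) *\<^sub>R q i) \<le> \<eta>"
        using q_norm[OF ij(1)] \<sigma> \<eta> by (simp add: abs_mult mult_left_le)
      also have "norm ((\<sigma> * \<sigma> * \<eta>) *\<^sub>R q j) \<le> \<eta>"
        using q_norm[OF ij(2)] \<sigma> \<eta> by (simp add: abs_mult mult_left_le)
      finally have "norm (e i - \<sigma> *\<^sub>R e j) \<le> norm (z i - \<sigma> *\<^sub>R z j) + (\<eta> + \<eta>)"
        by simp
      moreover have "norm (e i - \<sigma> *\<^sub>R e j) \<ge> 1 + \<delta>"
        using far ij JH self below_H by blast
      ultimately show ?thesis
        using \<eta> by linarith
    qed
    have "\<sigma> = 1 \<or> \<sigma> = - 1"
      using \<sigma> by linarith
    then show ?thesis
      using near distant by (intro sep[of z] z_eq) auto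
  qed
  from plus minus show ?thesis
  proof (elim disjE exE conjE)
    assume p: "\<forall>i\<in>H. \<forall>j\<in>H. i \<noteq> j \<longrightarrow> norm (e i + e j) \<le> 1"
      and m: "\<forall>i\<in>H. \<forall>j\<in>H. i \<noteq> j \<longrightarrow> norm (e i - e j) \<le> 1"
    \<comment> \<open>The coefficients add up to \<open>1\<close> against \<open>e i + e i0\<close> and \<open>e i - q i\<close>, so the norm is at most \<open>1\<close>; in a sum, \<open>\<phi> i0\<close> sees at least \<open>7/4 - 1/4\<close>.\<close>
    define z where "z i = e i + (7/8) *\<^sub>R e i0 - (1/8) *\<^sub>R q i" for i
    have e_q: "norm (e i - q i) \<le> 1" if "i \<in> J" for i
    proof -
      have "norm (e i + (- 1) *\<^sub>R e j) \<le> 1" if "j \<in> below i" for j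
      proof -
        have "j \<in> H" "i \<in> H" "i \<noteq> j"
          using that \<open>i \<in> J\<close> by (auto simp: below_def J_def)
        then show ?thesis
          using m by simp
      qed
      then have "norm (e i + (- 1) *\<^sub>R q i) \<le> 1"
        by (rule q_comb[OF that])
      then show ?thesis
        by simp
    qed
    have z_le: "norm (z i) \<le> 1" if i: "i \<in> J" for i
    proof -
      have "z i = (7/8) *\<^sub>R (e i + e i0) + (1/8) *\<^sub>R (e i - q i)"
        by (simp add: z_def algebra_simps flip: scaleR_add_left)
      also have "norm \<dots> \<le> 7/8 * norm (e i + e i0) + 1/8 * norm (e i - q i)"
        using norm_triangle_ineq[of "(7/8) *\<^sub>R (e i + e i0)" "(1/8) *\<^sub>R (e i - q i)"] by simp
      also have "\<dots> \<le> 7/8 * 1 + 1/8 * 1"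
        using e_q[OF i] p i i0 by (intro add_mono mult_left_mono) (auto simp: J_def)
      finally show ?thesis
        by simp
    qed
    have \<phi>z: "\<phi> j (z i) = (if j = i then 1 else 0) + 7/8 * (if j = i0 then 1 else 0) - 1/8 * \<phi> j (q i)"
      if "i \<in> J" "j \<in> H" for i j
      using that JH bio i0 by (auto simp: z_def \<phi>_simps subset_iff)
    have z_eq: "norm (z i) = 1" if i: "i \<in> J" for i
    proof -
      have "i \<in> H" "i \<noteq> i0"
        using i by (auto simp: J_def)
      then have "\<phi> i (z i) = 1"
        using \<phi>z[OF i, of i] q_zero[OF i, of i] self by simp
      then show ?thesis
        using z_le[OF i] ne1[of i "z i"] \<open>i \<in> H\<close> by simp
    qed
    have "norm (z i - z j) > 1 \<and> norm (z i + z j) > 1" if ij: "i \<in> J" "j \<in> J" "j \<in> below i" for i j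
    proof
      have jH: "j \<in> H" "j \<noteq> i" "j \<noteq> i0" "i \<noteq> i0"
        using ij self by (auto simp: J_def)
      have "\<phi> j (z i - z j) = - 1 - 1/8 * \<phi> j (q i)"
        using \<phi>z[OF ij(1) jH(1)] \<phi>z[OF ij(2) jH(1)] q_zero[OF ij(2) jH(1) self] jH
        by (simp add: \<phi>_simps)
      then show "norm (z i - z j) > 1"
        using le[OF jH(1), of "z i - z j"] q_pos[OF ij(1,3)] by linarith
      have "\<phi> i0 (z i + z j) = 7/4 - 1/8 * (\<phi> i0 (q i) + \<phi> i0 (q j))"
        using \<phi>z[OF ij(1) i0] \<phi>z[OF ij(2) i0] jH i0 by (simp add: \<phi>_simps add_divide_distrib)
      moreover have "\<bar>\<phi> i0 (q i)\<bar> \<le> 1" "\<bar>\<phi> i0 (q j)\<bar> \<le> 1"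
        using le[OF i0] q_norm ij by (meson order_trans)+
      ultimately have "\<phi> i0 (z i + z j) > 1"
        unfolding abs_le_iff by argo
      then show "norm (z i + z j) > 1"
        using le[OF i0, of "z i + z j"] by simp
    qed
    then show ?thesis
      by (intro sep[of z] z_eq) auto
  next
    fix \<delta> :: real
    assume "\<forall>i\<in>H. \<forall>j\<in>H. i \<noteq> j \<longrightarrow> norm (e i + e j) \<le> 1" "\<delta> > 0"
      and "\<forall>i\<in>H. \<forall>j\<in>H. i \<noteq> j \<longrightarrow> norm (e i - e j) \<ge> 1 + \<delta>"
    then show ?thesis
      by (intro one_sign[of 1 \<delta>]) auto
  next
    fix \<delta> :: real
    assume "\<forall>i\<in>H. \<forall>j\<in>H. i \<noteq> j \<longrightarrow> norm (e i - e j) \<le> 1" "\<delta> > 0"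
      and "\<forall>i\<in>H. \<forall>j\<in>H. i \<noteq> j \<longrightarrow> norm (e i + e j) \<ge> 1 + \<delta>"
    then show ?thesis
      by (intro one_sign[of "-1" \<delta>]) auto
  next
    fix \<delta> \<delta>' :: real
    assume "\<delta> > 0" "\<delta>' > 0" and p: "\<forall>i\<in>H. \<forall>j\<in>H. i \<noteq> j \<longrightarrow> norm (e i + e j) \<ge> 1 + \<delta>"
      and m: "\<forall>i\<in>H. \<forall>j\<in>H. i \<noteq> j \<longrightarrow> norm (e i - e j) \<ge> 1 + \<delta>'"
    then have "norm (e i - e j) > 1 \<and> norm (e i + e j) > 1" if "i \<in> J" "j \<in> J" "j \<in> below i" for i j
      using that JH self by (smt (verit, best) subsetD)
    then show ?thesis
      using norm_e JH by (intro sep[of e]) auto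
  qed
qed

section \<open>Separated subsets of the sphere of \<open>c\<^sub>0(\<Gamma>)\<close>\<close>

text \<open>Induction on the common size \<open>n\<close>. Either a maximal pairwise disjoint subfamily is large, and the root
is empty, or its union has at most \<open>\<omega>\<^sub>1\<close> points and meets every \<open>F x\<close>; then one of these points lies
in \<open>F x\<close> for a large set of \<open>x\<close> and can be removed.\<close>

lemma delta_system:
  fixes F :: "'a \<Rightarrow> 'i set"
  assumes "\<not> |A| \<le>o cardSuc natLeq" and "\<And>x. x \<in> A \<Longrightarrow> finite (F x) \<and> card (F x) = n"
  obtains E A' where "finite E" "A' \<subseteq> A" "\<not> |A'| \<le>o cardSuc natLeq"
    "\<And>x. x \<in> A' \<Longrightarrow> E \<subseteq> F x" "\<And>x y. x \<in> A' \<Longrightarrow> y \<in> A' \<Longrightarrow> x \<noteq> y \<Longrightarrow> (F x - E) \<inter> (F y - E) = {}"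
  using assms
proof (induction n arbitrary: A F thesis)
  case 0
  show ?case
  proof (rule "0.prems"(1)[of "{}" A])
    show "(F x - {}) \<inter> (F y - {}) = {}" if "x \<in> A" "y \<in> A" for x y
      using "0.prems"(3)[OF that(1)] by auto
  qed (use "0.prems"(2) in auto)
next
  case (Suc n)
  define \<D> where "\<D> = {D. D \<subseteq> A \<and> (\<forall>x\<in>D. \<forall>y\<in>D. x \<noteq> y \<longrightarrow> F x \<inter> F y = {})}"
  have "\<exists>M\<in>\<D>. \<forall>X\<in>\<D>. M \<subseteq> X \<longrightarrow> X = M"
  proof (rule subset_Zorn)
    fix C assume C: "subset.chain \<D> C"
    have "\<Union>C \<in> \<D>"
      unfolding \<D>_def
    proof (intro CollectI conjI ballI impI)
      show "\<Union>C \<subseteq> A"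
        using C unfolding subset.chain_def \<D>_def by blast
      fix x y assume "x \<in> \<Union>C" "y \<in> \<Union>C" "x \<noteq> y"
      then obtain X where "X \<in> C" "x \<in> X" "y \<in> X"
        using C unfolding subset.chain_def by blast
      then show "F x \<inter> F y = {}"
        using C \<open>x \<noteq> y\<close> unfolding subset.chain_def \<D>_def by blast
    qed
    then show "\<exists>U\<in>\<D>. \<forall>X\<in>C. X \<subseteq> U"
      by blast
  qed
  then obtain M where M: "M \<in> \<D>" and max: "\<And>X. X \<in> \<D> \<Longrightarrow> M \<subseteq> X \<Longrightarrow> X = M"
    by blast
  show ?case
  proof (cases "|M| \<le>o cardSuc natLeq")
    case False
    then show ?thesis
      using M by (intro Suc.prems(1)[of "{}" M]) (auto simp: \<D>_def)
  next
    case True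
    define U where "U = (\<Union>x\<in>M. F x)"
    have U: "|U| \<le>o cardSuc natLeq"
      unfolding U_def
    proof (rule card_of_UN_le_cardSuc_natLeq[OF True])
      show "|F x| \<le>o cardSuc natLeq" if "x \<in> M" for x
        using that M Suc.prems(3)[of x] by (intro countable_le_cardSuc_natLeq countable_finite) (auto simp: \<D>_def)
    qed
    have hit: "F x \<inter> U \<noteq> {}" if x: "x \<in> A" for x
    proof
      assume disj: "F x \<inter> U = {}"
      then have "insert x M \<in> \<D>"
        using M x unfolding \<D>_def U_def by auto
      then have "x \<in> M"
        using max by blast
      then have "F x = {}"
        using disj unfolding U_def by blast
      then show False
        using Suc.prems(3)[OF x] by simp
    qed
    have "A \<subseteq> (\<Union>\<gamma>\<in>U. {x \<in> A. \<gamma> \<in> F x})"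
      using hit by blast
    then obtain \<gamma> where \<gamma>: "\<not> |{x \<in> A. \<gamma> \<in> F x}| \<le>o cardSuc natLeq"
      by (rule pigeonhole_beyond_cardSuc_natLeq[OF Suc.prems(2) U])
    have "finite (F x - {\<gamma>}) \<and> card (F x - {\<gamma>}) = n" if "x \<in> {x \<in> A. \<gamma> \<in> F x}" for x
      using Suc.prems(3) that by auto
    then obtain E A' where E: "finite E" "A' \<subseteq> {x \<in> A. \<gamma> \<in> F x}" "\<not> |A'| \<le>o cardSuc natLeq"
      "\<And>x. x \<in> A' \<Longrightarrow> E \<subseteq> F x - {\<gamma>}"
      "\<And>x y. x \<in> A' \<Longrightarrow> y \<in> A' \<Longrightarrow> x \<noteq> y \<Longrightarrow> (F x - {\<gamma>} - E) \<inter> (F y - {\<gamma>} - E) = {}"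
      using Suc.IH[OF _ \<gamma>, of "\<lambda>x. F x - {\<gamma>}"] by blast
    show ?thesis
    proof (rule Suc.prems(1)[of "insert \<gamma> E" A'])
      show "(F x - insert \<gamma> E) \<inter> (F y - insert \<gamma> E) = {}" if "x \<in> A'" "y \<in> A'" "x \<noteq> y" for x y
        using E(5)[OF that] by blast
    qed (use E in auto)
  qed
qed

text \<open>If \<open>norm (x \<gamma> - y \<gamma>) > 1\<close>, then one of the two values has norm at least \<open>1/2\<close>. After passing to a delta
system for the finite sets \<open>F x\<close> of such coordinates, with nearly equal values on the root, \<open>\<gamma>\<close> must lie in the
petal of one vector and in the support of the other. Petals are disjoint and supports are countable,
so the support of \<open>y\<close> meets the petals of countably many \<open>x\<close> only. For more than \<open>\<omega>\<^sub>1\<close> vectors this is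
impossible: some \<open>y\<close> has a petal that misses the supports of \<open>\<omega>\<^sub>1\<close> many other vectors \<open>x\<close>, and all their
petals would have to meet the support of \<open>y\<close>.\<close>

theorem separated_c0_sphere_le:
  fixes A :: "('i \<Rightarrow> 'k::{real_normed_vector, second_countable_topology}) set"
  assumes A: "A \<subseteq> c0_sphere \<Gamma>" and sep: "one_plus_separated sup_norm A"
  shows "|A| \<le>o cardSuc natLeq"
proof (rule ccontr)
  assume big: "\<not> |A| \<le>o cardSuc natLeq"
  have c0: "x \<gamma> = 0" if "x \<in> A" "\<gamma> \<notin> \<Gamma>" for x \<gamma>
    using A that unfolding c0_sphere_def c0_def by blast
  have fin: "finite {\<gamma>. norm (x \<gamma>) \<ge> \<epsilon>}" if "x \<in> A" "\<epsilon> > 0" for x \<epsilon>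
  proof -
    have "{\<gamma>. norm (x \<gamma>) \<ge> \<epsilon>} = {\<gamma> \<in> \<Gamma>. norm (x \<gamma>) \<ge> \<epsilon>}"
      using c0[OF that(1)] that(2) by force
    then show ?thesis
      using A that unfolding c0_sphere_def c0_def by auto
  qed
  have le1: "norm (x \<gamma>) \<le> 1" if x: "x \<in> A" for x \<gamma>
  proof -
    have "range (\<lambda>\<gamma>. norm (x \<gamma>)) \<subseteq> {..1} \<union> (\<lambda>\<gamma>. norm (x \<gamma>)) ` {\<gamma>. norm (x \<gamma>) \<ge> 1}"
      by force
    moreover have "bdd_above ({..1::real} \<union> (\<lambda>\<gamma>. norm (x \<gamma>)) ` {\<gamma>. norm (x \<gamma>) \<ge> 1})"
      using fin[OF x, of 1] by (simp add: bdd_above_finite)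
    ultimately have "bdd_above (range (\<lambda>\<gamma>. norm (x \<gamma>)))"
      by (rule bdd_above_mono[rotated])
    then have "norm (x \<gamma>) \<le> sup_norm x"
      unfolding sup_norm_def by (intro cSUP_upper) auto
    then show ?thesis
      using A x unfolding c0_sphere_def by auto
  qed
  have far: "\<exists>\<gamma>. norm (x \<gamma> - y \<gamma>) > 1" if "x \<in> A" "y \<in> A" "x \<noteq> y" for x y
  proof (rule ccontr)
    assume "\<not> ?thesis"
    then have "sup_norm (x - y) \<le> 1"
      unfolding sup_norm_def by (intro cSUP_least) (auto simp: not_less)
    then show False
      using sep that unfolding one_plus_separated_def by (meson not_less)
  qed
  have supp: "countable {\<gamma>. x \<gamma> \<noteq> 0}" if x: "x \<in> A" for x
  proof -
    have "{\<gamma>. x \<gamma> \<noteq> 0} \<subseteq> (\<Union>n. {\<gamma>. norm (x \<gamma>) \<ge> 1 / real (Suc n)})"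
    proof
      fix \<gamma> assume "\<gamma> \<in> {\<gamma>. x \<gamma> \<noteq> 0}"
      then obtain n where "1 / real (Suc n) < norm (x \<gamma>)"
        using nat_approx_posE[of "norm (x \<gamma>)"] by auto
      then show "\<gamma> \<in> (\<Union>n. {\<gamma>. norm (x \<gamma>) \<ge> 1 / real (Suc n)})"
        by (auto intro: less_imp_le)
    qed
    moreover have "countable (\<Union>n. {\<gamma>. norm (x \<gamma>) \<ge> 1 / real (Suc n)})"
      using fin[OF x] by (intro countable_UN) (auto intro: countable_finite)
    ultimately show ?thesis
      by (rule countable_subset)
  qed
  define F where "F x = {\<gamma>. norm (x \<gamma>) \<ge> 1/2}" for x :: "'i \<Rightarrow> 'k"
  have "A \<subseteq> (\<Union>n. {x \<in> A. card (F x) = n})"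
    by auto
  then obtain n where n: "\<not> |{x \<in> A. card (F x) = n}| \<le>o cardSuc natLeq"
    by (rule pigeonhole_beyond_cardSuc_natLeq[OF big countable_le_cardSuc_natLeq[OF countableI_type]])
  have card_n: "finite (F x) \<and> card (F x) = n" if "x \<in> {x \<in> A. card (F x) = n}" for x
    using that fin[of x "1/2"] unfolding F_def by simp
  obtain E A1 where E: "finite E" and A1: "A1 \<subseteq> {x \<in> A. card (F x) = n}" "\<not> |A1| \<le>o cardSuc natLeq"
    and "\<And>x. x \<in> A1 \<Longrightarrow> E \<subseteq> F x"
    and petals: "\<And>x y. x \<in> A1 \<Longrightarrow> y \<in> A1 \<Longrightarrow> x \<noteq> y \<Longrightarrow> (F x - E) \<inter> (F y - E) = {}"
  proof (rule delta_system[OF n card_n])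
    fix E A' assume "finite E" "A' \<subseteq> {x \<in> A. card (F x) = n}" "\<not> |A'| \<le>o cardSuc natLeq"
      "\<And>x. x \<in> A' \<Longrightarrow> E \<subseteq> F x"
      "\<And>x y. x \<in> A' \<Longrightarrow> y \<in> A' \<Longrightarrow> x \<noteq> y \<Longrightarrow> (F x - E) \<inter> (F y - E) = {}"
    then show thesis
      by (rule that)
  qed
  obtain Q :: "'k set" where Q: "countable Q" "\<And>U. open U \<Longrightarrow> U \<noteq> {} \<Longrightarrow> \<exists>d\<in>Q. d \<in> U"
    using countable_dense_exists by blast
  have "\<exists>d\<in>Q. dist v d < 1/4" for v :: 'k
    using Q(2)[of "ball v (1/4)"] by auto
  then obtain near where near: "\<And>v :: 'k. near v \<in> Q" "\<And>v. dist v (near v) < 1/4"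
    by metis
  define code where "code x = restrict (\<lambda>\<gamma>. near (x \<gamma>)) E" for x :: "'i \<Rightarrow> 'k"
  have "countable (E \<rightarrow>\<^sub>E Q)"
    using E Q(1) by (intro countable_PiE) auto
  then have "|E \<rightarrow>\<^sub>E Q| \<le>o cardSuc natLeq"
    by (rule countable_le_cardSuc_natLeq)
  moreover have "A1 \<subseteq> (\<Union>c\<in>E \<rightarrow>\<^sub>E Q. {x \<in> A1. code x = c})"
    using near(1) by (auto simp: code_def)
  ultimately obtain c where c: "\<not> |{x \<in> A1. code x = c}| \<le>o cardSuc natLeq"
    by (rule pigeonhole_beyond_cardSuc_natLeq[OF A1(2)])
  define A2 where "A2 = {x \<in> A1. code x = c}"
  have A2: "A2 \<subseteq> A" "A2 \<subseteq> A1" "\<not> |A2| \<le>o cardSuc natLeq"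
    using A1 c unfolding A2_def by auto
  have root: "norm (x \<gamma> - y \<gamma>) \<le> 1" if "x \<in> A2" "y \<in> A2" "\<gamma> \<in> E" for x y \<gamma>
  proof -
    have "code x \<gamma> = code y \<gamma>"
      using that(1,2) by (simp add: A2_def)
    then have "near (x \<gamma>) = near (y \<gamma>)"
      using that(3) by (simp add: code_def)
    then have "dist (x \<gamma>) (y \<gamma>) \<le> 1/4 + 1/4"
      using near(2)[of "x \<gamma>"] near(2)[of "y \<gamma>"] by (smt (verit) dist_commute dist_triangle)
    then show ?thesis
      by (simp add: dist_norm)
  qed
  define hits where "hits y = {x \<in> A2. (F x - E) \<inter> {\<gamma>. y \<gamma> \<noteq> 0} \<noteq> {}}" for y :: "'i \<Rightarrow> 'k"
  have hits: "countable (hits y)" if y: "y \<in> A" for y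
  proof -
    have "\<exists>\<gamma>. \<gamma> \<in> (F x - E) \<inter> {\<gamma>. y \<gamma> \<noteq> 0}" if "x \<in> hits y" for x
      using that unfolding hits_def by blast
    then obtain g where g: "\<And>x. x \<in> hits y \<Longrightarrow> g x \<in> (F x - E) \<inter> {\<gamma>. y \<gamma> \<noteq> 0}"
      by metis
    have "inj_on g (hits y)"
    proof (rule inj_onI, rule ccontr)
      fix x x' assume xx: "x \<in> hits y" "x' \<in> hits y" "g x = g x'" "x \<noteq> x'"
      then have "(F x - E) \<inter> (F x' - E) = {}"
        using A2 by (intro petals) (auto simp: hits_def)
      then show False
        using g[OF xx(1)] g[OF xx(2)] xx(3) by auto
    qed
    moreover have "g ` hits y \<subseteq> {\<gamma>. y \<gamma> \<noteq> 0}"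
      using g by blast
    ultimately show ?thesis
      using supp[OF y] countable_image_inj_on countable_subset by blast
  qed
  have linked: "x \<in> hits y \<or> y \<in> hits x" if xy: "x \<in> A2" "y \<in> A2" "x \<noteq> y" for x y
  proof -
    obtain \<gamma> where \<gamma>: "norm (x \<gamma> - y \<gamma>) > 1"
      using far xy A2 by blast
    have "\<gamma> \<notin> E"
      using root[OF xy(1,2)] \<gamma> by (meson not_less)
    have "x \<gamma> \<noteq> 0" "y \<gamma> \<noteq> 0"
      using \<gamma> le1[of x \<gamma>] le1[of y \<gamma>] xy A2 by auto
    moreover have "\<gamma> \<in> F x \<or> \<gamma> \<in> F y"
      using \<gamma> norm_triangle_ineq4[of "x \<gamma>" "y \<gamma>"] unfolding F_def by auto
    ultimately show ?thesis
      using xy \<open>\<gamma> \<notin> E\<close> unfolding hits_def by blast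
  qed
  have co: "Card_order (cardSuc natLeq)"
    by (rule cardSuc_Card_order[OF natLeq_Card_order])
  have "cardSuc natLeq \<le>o |A2|"
    using A2(3) co card_of_Well_order card_order_on_well_order_on not_ordLeq_iff_ordLess ordLess_imp_ordLeq by blast
  then have "|Field (cardSuc natLeq)| \<le>o |A2|"
    using card_of_Field_ordIso[OF co] ordIso_ordLeq_trans by blast
  then obtain b where b: "inj_on b (Field (cardSuc natLeq))" "b ` Field (cardSuc natLeq) \<subseteq> A2"
    using card_of_ordLeq[of "Field (cardSuc natLeq)" A2] by auto
  define B where "B = b ` Field (cardSuc natLeq)"
  have B: "B \<subseteq> A2" "uncountable B"
    using b uncountable_Field_cardSuc_natLeq countable_image_inj_on unfolding B_def by blast+
  have B_le: "|B| \<le>o cardSuc natLeq"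
    unfolding B_def using card_of_image card_of_Field_ordIso[OF co] ordLeq_ordIso_trans by blast
  have "|B \<union> (\<Union>x\<in>B. hits x)| \<le>o cardSuc natLeq"
  proof -
    have "B \<union> (\<Union>x\<in>B. hits x) = (\<Union>x\<in>B. insert x (hits x))"
      by blast
    moreover have "|\<Union>x\<in>B. insert x (hits x)| \<le>o cardSuc natLeq"
      using hits B(1) A2(1)
      by (intro card_of_UN_le_cardSuc_natLeq[OF B_le] countable_le_cardSuc_natLeq) auto
    ultimately show ?thesis
      by simp
  qed
  then have "\<not> A2 \<subseteq> B \<union> (\<Union>x\<in>B. hits x)"
    using A2(3) ordLeq_transitive[OF card_of_mono1] by metis
  then obtain y where y: "y \<in> A2" "y \<notin> B" "\<And>x. x \<in> B \<Longrightarrow> y \<notin> hits x"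
    by blast
  then have "B \<subseteq> hits y"
    using linked B(1) by blast
  then show False
    using hits y(1) A2(1) B(2) countable_subset by blast
qed

section \<open>Biorthogonal systems by reflection\<close>

definition contains_sym_separated :: "'v::real_normed_vector set \<Rightarrow> bool"
  where "contains_sym_separated S \<longleftrightarrow> (\<exists>A. A \<subseteq> S \<and> uncountable A \<and> sym_one_plus_separated norm A)"

lemma card_reals: "|UNIV :: (nat \<Rightarrow> bool) set| =o |UNIV :: real set|"
proof -
  obtain f :: "nat set \<Rightarrow> real" where "bij f"
    using nat_sets_eqpoll_reals unfolding eqpoll_def by blast
  moreover have "bij (Collect :: (nat \<Rightarrow> bool) \<Rightarrow> nat set)"
    by (rule bij_betwI'[of UNIV Collect UNIV]) (auto simp: fun_eq_iff set_eq_iff intro: exI[of _ "\<lambda>x. x \<in> _"])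
  ultimately have "bij (f \<circ> Collect)"
    by (rule bij_comp[rotated])
  then show ?thesis
    using card_of_ordIso by blast
qed

lemma exp1_card_UNIV: "exp1 |UNIV :: 'b set| = |UNIV :: ('b \<Rightarrow> bool) set|"
  unfolding exp1_def cexp_def ctwo_def by (simp add: Field_card_of Func_def)

lemma exp2_continuum: "exp2 continuum = |UNIV :: ((real \<Rightarrow> bool) \<Rightarrow> bool) set|"
  unfolding exp2_def continuum_def exp1_card_UNIV ..

lemma card_prod_le:
  assumes "|UNIV :: 'a set| \<le>o |B|" "|UNIV :: 'c set| \<le>o |B|" "infinite B"
  shows "|UNIV :: ('a \<times> 'c) set| \<le>o |B|"
  using card_of_Sigma_ordLeq_infinite[OF assms(3,1), of "\<lambda>_. UNIV :: 'c set"] assms(2)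
  by (simp add: UNIV_Times_UNIV)

lemma underS_cardSuc_le:
  assumes "\<xi> \<in> Field (cardSuc |A| )"
  shows "|underS (cardSuc |A| ) \<xi>| \<le>o |A|"
  using card_of_underS[OF cardSuc_Card_order[OF card_of_Card_order] assms]
  by (simp only: cardSuc_ordLeq_ordLess[OF card_of_Card_order card_of_Card_order])

lemma Well_order_total:
  "Well_order r \<Longrightarrow> x \<in> Field r \<Longrightarrow> y \<in> Field r \<Longrightarrow> x \<noteq> y \<Longrightarrow> (x, y) \<in> r \<or> (y, x) \<in> r"
  by (simp add: well_order_on_def linear_order_on_def total_on_def)

text \<open>The successor of the cardinality of \<open>A\<close> is regular: the initial segments determined by \<open>S\<close> have at most
\<open>|A|\<close> elements each, so they do not cover \<open>H\<close>.\<close>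

lemma strict_upper_bound:
  assumes inf: "infinite A" and H: "H \<subseteq> Field (cardSuc |A| )" "\<not> |H| \<le>o |A|"
    and S: "S \<subseteq> Field (cardSuc |A| )" "|S| \<le>o |A|"
  obtains x where "x \<in> H" "\<And>s. s \<in> S \<Longrightarrow> s \<in> underS (cardSuc |A| ) x"
proof -
  let ?r = "cardSuc |A|"
  have wo: "Well_order ?r"
    using cardSuc_Card_order[OF card_of_Card_order] card_order_on_well_order_on by blast
  have "|insert s (underS ?r s)| \<le>o |A|" if "s \<in> S" for s
  proof -
    have "|{s} \<union> underS ?r s| \<le>o |A|"
      using underS_cardSuc_le[of s A] that S(1) inf card_of_singl_ordLeq[of A s]
      by (intro card_of_Un_ordLeq_infinite_Field[OF _ _ _ card_of_Card_order]) (auto simp: Field_card_of)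
    then show ?thesis
      by simp
  qed
  then have "|\<Union>s\<in>S. insert s (underS ?r s)| \<le>o |A|"
    using inf S(2) by (intro card_of_UNION_ordLeq_infinite) auto
  then have "\<not> H \<subseteq> (\<Union>s\<in>S. insert s (underS ?r s))"
    using H(2) ordLeq_transitive[OF card_of_mono1] by blast
  then obtain x where x: "x \<in> H" "\<And>s. s \<in> S \<Longrightarrow> x \<noteq> s \<and> x \<notin> underS ?r s"
    by blast
  have "s \<in> underS ?r x" if s: "s \<in> S" for s
  proof -
    have "(s, x) \<in> ?r \<or> (x, s) \<in> ?r"
      using Well_order_total[OF wo, of s x] x s S(1) H(1) by blast
    then show ?thesis
      using x(2)[OF s] by (auto simp: underS_def)
  qed
  then show thesis
    using that x(1) by blast
qed

text \<open>All that is needed about a vector-functional pair \<open>z\<close> relative to another pair \<open>p\<close>: the mutual evaluations, the norms that occur in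
symmetric separation, in the space and in its dual, and the data of \<open>z\<close> alone which show that a copy of a
norming pair of unit length is again such a pair.\<close>

definition pair_type ::
  "'a::real_normed_vector \<times> ('a \<Rightarrow>\<^sub>L real) \<Rightarrow> 'a \<times> ('a \<Rightarrow>\<^sub>L real) \<Rightarrow>
    (real \<times> real) \<times> (real \<times> real) \<times> (real \<times> real) \<times> (real \<times> real \<times> real)"
  where "pair_type p z =
    ((blinfun_apply (snd p) (fst z), blinfun_apply (snd z) (fst p)), (norm (fst p + fst z), norm (fst p - fst z)),
     (norm (snd p + snd z), norm (snd p - snd z)), (norm (fst z), norm (snd z), blinfun_apply (snd z) (fst z)))"

lemma card_pair_type:
  "|UNIV :: ((real \<times> real) \<times> (real \<times> real) \<times> (real \<times> real) \<times> (real \<times> real \<times> real)) set|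
    \<le>o |UNIV :: (nat \<Rightarrow> bool) set|"
proof -
  have "|UNIV :: real set| \<le>o |UNIV :: (nat \<Rightarrow> bool) set|"
    using card_reals ordIso_symmetric ordIso_imp_ordLeq by blast
  moreover have "infinite (UNIV :: (nat \<Rightarrow> bool) set)"
    by (rule infinite_predicates) simp
  ultimately show ?thesis
    by (intro card_prod_le)
qed

text \<open>A countable partition of the real line; a class other than \<open>0\<close> carries a uniform gap above \<open>1\<close>.\<close>

definition excess_class :: "real \<Rightarrow> nat"
  where "excess_class v = (if v \<le> 1 then 0 else nat \<lceil>1 / (v - 1)\<rceil>)"

lemma excess_class_0: "excess_class v = 0 \<Longrightarrow> v \<le> 1"
proof (rule ccontr)
  assume "excess_class v = 0" "\<not> v \<le> 1"
  then have "\<lceil>1 / (v - 1)\<rceil> \<le> 0" "1 / (v - 1) > 0"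
    by (auto simp: excess_class_def)
  then show False
    by linarith
qed

lemma excess_class_pos:
  assumes "excess_class v = n" "n > 0"
  shows "v \<ge> 1 + 1 / real n"
proof -
  have v: "v > 1" and n: "n = nat \<lceil>1 / (v - 1)\<rceil>"
    using assms by (auto simp: excess_class_def split: if_splits)
  have "1 / (v - 1) \<le> real n"
    unfolding n by linarith
  then have "1 / real n \<le> v - 1"
    using v assms(2) by (simp add: field_simps)
  then show ?thesis
    by simp
qed

lemma excess_class_dichotomy:
  assumes "\<And>i j. i \<in> H \<Longrightarrow> j \<in> H \<Longrightarrow> i \<noteq> j \<Longrightarrow> excess_class (g i j) = n"
  shows "(\<forall>i\<in>H. \<forall>j\<in>H. i \<noteq> j \<longrightarrow> g i j \<le> 1) \<or> (\<exists>\<delta>>0. \<forall>i\<in>H. \<forall>j\<in>H. i \<noteq> j \<longrightarrow> g i j \<ge> 1 + \<delta>)"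
proof (cases "n = 0")
  case True
  then show ?thesis
    using assms excess_class_0 by blast
next
  case False
  then have "\<forall>i\<in>H. \<forall>j\<in>H. i \<noteq> j \<longrightarrow> g i j \<ge> 1 + 1 / real n"
    using assms excess_class_pos by blast
  then show ?thesis
    using False by (intro disjI2 exI[of _ "1 / real n"]) simp
qed

text \<open>Copies of \<open>(x, f)\<close> are chosen along \<open>\<omega>\<^sub>1\<close>, each over its predecessors. Whatever \<open>(x, f)\<close> satisfies with
respect to a member of the sequence is satisfied by all later members: by \<open>top\<close> the copies form a biorthogonal
system, and the norms of sums and differences depend on the smaller index only. An uncountable set of
indices belongs to one excess class, and the resulting homogeneous system can be used twice: with vectors and
functionals in their roles, and with the roles exchanged through evaluation.\<close>

theorem sym_separated_of_reflected_pair: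
  fixes x :: "'a::banach" and f :: "'a \<Rightarrow>\<^sub>L real"
  assumes refl: "reflecting I (\<lambda>p _. pair_type p) TYPE(nat) R"
    and xf: "(x, f) \<in> I" "(x, f) \<notin> R" "norm x = 1" "norm f = 1" "f x = 1"
    and D: "D \<subseteq> R" "D \<noteq> {}" "countable D"
    and top: "\<And>y g. (y, g) \<in> R \<inter> I \<Longrightarrow> (\<And>d. d \<in> D \<Longrightarrow> pair_type d (y, g) = pair_type d (x, f)) \<Longrightarrow>
      blinfun_apply g x = 0 \<and> blinfun_apply f y = 0"
  shows "contains_sym_separated (sphere (0::'a) 1)"
    and "contains_sym_separated (sphere (0::'a \<Rightarrow>\<^sub>L real) 1)"
proof -
  define r where "r = cardSuc |UNIV :: nat set|"
  have co: "Card_order r"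
    unfolding r_def by (rule cardSuc_Card_order[OF card_of_Card_order])
  have wo: "Well_order r"
    using co card_order_on_well_order_on by blast
  have nat_le: "|A| \<le>o |UNIV :: nat set| \<longleftrightarrow> countable A" for A :: "'s set"
    unfolding countable_iff_le_natLeq
    using ordLeq_ordIso_trans[OF _ card_of_nat] ordLeq_ordIso_trans[OF _ ordIso_symmetric[OF card_of_nat]] by blast
  have under: "|underS r \<xi>| \<le>o |UNIV :: nat set|" if "\<xi> \<in> Field r" for \<xi>
    using that unfolding r_def by (rule underS_cardSuc_le)
  have D_le: "|D| \<le>o |UNIV :: nat set|"
    using D(3) nat_le by blast
  obtain y where yR: "\<And>\<xi>. \<xi> \<in> Field r \<Longrightarrow> y \<xi> \<in> R \<inter> I"
    and y_col: "\<And>\<xi> a a'. \<xi> \<in> Field r \<Longrightarrow> a \<in> D \<union> y ` underS r \<xi> \<Longrightarrow> a' \<in> D \<union> y ` underS r \<xi> \<Longrightarrow>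
      pair_type a (y \<xi>) = pair_type a (x, f)"
    and "\<And>\<xi>. \<xi> \<in> Field r \<Longrightarrow> y \<xi> \<notin> y ` underS r \<xi>"
    by (rule end_homogeneous_sequence[OF refl infinite_UNIV_nat xf(1,2) D(1,2) D_le wo under]) blast+
  define e where "e i = fst (y i)" for i
  define \<phi> where "\<phi> i = snd (y i)" for i
  have col: "pair_type a (e i, \<phi> i) = pair_type a (x, f)" if "i \<in> Field r" "a \<in> D \<union> y ` underS r i" for i a
    using y_col[OF that(1,2,2)] by (simp add: e_def \<phi>_def)
  have unit: "norm (e i) = 1" "norm (\<phi> i) = 1" "\<phi> i (e i) = 1" if i: "i \<in> Field r" for i
  proof -
    obtain d where "d \<in> D"
      using D(2) by blast
    then have "pair_type d (e i, \<phi> i) = pair_type d (x, f)"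
      using col[OF i] by blast
    then show "norm (e i) = 1" "norm (\<phi> i) = 1" "\<phi> i (e i) = 1"
      using xf by (auto simp: pair_type_def)
  qed
  have zero: "\<phi> i x = 0" "f (e i) = 0" if "i \<in> Field r" for i
    using top[of "e i" "\<phi> i"] yR[OF that] col[OF that] by (auto simp: e_def \<phi>_def)
  have later: "\<phi> j (e i) = 0" "\<phi> i (e j) = 0" "norm (e j + e i) = norm (e j + x)" "norm (e j - e i) = norm (e j - x)"
    "norm (\<phi> j + \<phi> i) = norm (\<phi> j + f)" "norm (\<phi> j - \<phi> i) = norm (\<phi> j - f)"
    if i: "i \<in> Field r" and j: "j \<in> underS r i" for i j
  proof -
    have "j \<in> Field r"
      using j by (auto simp: underS_def Field_def)
    have "pair_type (y j) (e i, \<phi> i) = pair_type (y j) (x, f)"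
      using col[OF i] j by blast
    then show "\<phi> j (e i) = 0" "\<phi> i (e j) = 0" "norm (e j + e i) = norm (e j + x)" "norm (e j - e i) = norm (e j - x)"
      "norm (\<phi> j + \<phi> i) = norm (\<phi> j + f)" "norm (\<phi> j - \<phi> i) = norm (\<phi> j - f)"
      using zero[OF \<open>j \<in> Field r\<close>] by (auto simp: pair_type_def e_def \<phi>_def)
  qed
  define cls where "cls j = (excess_class (norm (e j + x)), excess_class (norm (e j - x)),
    excess_class (norm (\<phi> j + f)), excess_class (norm (\<phi> j - f)))" for j
  have "\<exists>c. uncountable {j \<in> Field r. cls j = c}"
  proof (rule ccontr)
    assume "\<not> ?thesis"
    then have "countable (\<Union>c. {j \<in> Field r. cls j = c})"
      by (intro countable_UN) auto
    moreover have "(\<Union>c. {j \<in> Field r. cls j = c}) = Field r"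
      by auto
    ultimately have "|Field r| \<le>o |UNIV :: nat set|"
      using nat_le by metis
    then have "r \<le>o |UNIV :: nat set|"
      using card_of_Field_ordIso[OF co] ordIso_symmetric ordIso_ordLeq_trans by blast
    then show False
      unfolding r_def using cardSuc_greater[OF card_of_Card_order] not_ordLess_ordLeq by blast
  qed
  then obtain c where "uncountable {j \<in> Field r. cls j = c}"
    by blast
  moreover obtain n1 n2 n3 n4 where "c = (n1, n2, n3, n4)"
    by (metis prod.exhaust)
  ultimately have unc: "uncountable {j \<in> Field r. cls j = (n1, n2, n3, n4)}"
    by simp
  define H where "H = {j \<in> Field r. cls j = (n1, n2, n3, n4)}"
  have H: "uncountable H" "H \<subseteq> Field r"
    using unc unfolding H_def by auto
  have init: "countable {j \<in> H. j \<noteq> i \<and> (j, i) \<in> r}" if "i \<in> H" for i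
  proof (rule countable_subset)
    show "{j \<in> H. j \<noteq> i \<and> (j, i) \<in> r} \<subseteq> underS r i"
      by (auto simp: underS_def)
    show "countable (underS r i)"
      using under nat_le that H(2) by blast
  qed
  have tot: "(i, j) \<in> r \<or> (j, i) \<in> r" if "i \<in> H" "j \<in> H" "i \<noteq> j" for i j
    using Well_order_total[OF wo, of i j] that H(2) by blast
  have pair: "\<phi> i (e j) = 0 \<and> excess_class (norm (e i + e j)) = n1 \<and> excess_class (norm (e i - e j)) = n2 \<and>
      excess_class (norm (\<phi> i + \<phi> j)) = n3 \<and> excess_class (norm (\<phi> i - \<phi> j)) = n4"
    if ij: "i \<in> H" "j \<in> H" "i \<noteq> j" for i j
  proof -
    have cases: "i \<in> underS r j \<or> j \<in> underS r i"
      using tot[OF ij] ij(3) by (auto simp: underS_def)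
    have F: "i \<in> Field r" "j \<in> Field r" "cls i = (n1, n2, n3, n4)" "cls j = (n1, n2, n3, n4)"
      using ij by (auto simp: H_def)
    from cases show ?thesis
    proof
      assume "i \<in> underS r j"
      from later[OF F(2) this] F(3) show ?thesis
        by (simp add: cls_def)
    next
      assume "j \<in> underS r i"
      from later[OF F(1) this] F(4) show ?thesis
        by (simp add: cls_def add.commute[of _ "e j"] add.commute[of _ "\<phi> j"] norm_minus_commute[of _ "e j"]
            norm_minus_commute[of _ "\<phi> j"])
    qed
  qed
  show "contains_sym_separated (sphere (0::'a) 1)"
    unfolding contains_sym_separated_def
  proof (rule sym_separated_of_homogeneous_biorthogonal[OF H(1) init tot])
    show "bounded_linear (blinfun_apply (\<phi> i))" for i
      by (rule blinfun.bounded_linear_right)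
    show "\<bar>\<phi> i v\<bar> \<le> norm v" if "i \<in> H" for i v
      using norm_blinfun[of "\<phi> i" v] unit(2)[of i] that H(2) by auto
    show "\<phi> i (e j) = (if i = j then 1 else 0)" if "i \<in> H" "j \<in> H" for i j
      using pair[OF that] unit(3)[of i] that H(2) by auto
    show "norm (e i) = 1" if "i \<in> H" for i
      using unit(1) that H(2) by blast
    show "(\<forall>i\<in>H. \<forall>j\<in>H. i \<noteq> j \<longrightarrow> norm (e i + e j) \<le> 1) \<or> (\<exists>\<delta>>0. \<forall>i\<in>H. \<forall>j\<in>H. i \<noteq> j \<longrightarrow> norm (e i + e j) \<ge> 1 + \<delta>)"
      by (rule excess_class_dichotomy[where n = n1]) (use pair in blast)
    show "(\<forall>i\<in>H. \<forall>j\<in>H. i \<noteq> j \<longrightarrow> norm (e i - e j) \<le> 1) \<or> (\<exists>\<delta>>0. \<forall>i\<in>H. \<forall>j\<in>H. i \<noteq> j \<longrightarrow> norm (e i - e j) \<ge> 1 + \<delta>)"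
      by (rule excess_class_dichotomy[where n = n2]) (use pair in blast)
  qed
  show "contains_sym_separated (sphere (0::'a \<Rightarrow>\<^sub>L real) 1)"
    unfolding contains_sym_separated_def
  proof (rule sym_separated_of_homogeneous_biorthogonal[OF H(1) init tot, where e = \<phi> and \<phi> = "\<lambda>i k. blinfun_apply k (e i)"])
    show "bounded_linear (\<lambda>k. blinfun_apply k (e i))" for i
      by (rule blinfun.bounded_linear_left)
    show "\<bar>blinfun_apply k (e i)\<bar> \<le> norm k" if "i \<in> H" for i k
      using norm_blinfun[of k "e i"] unit(1)[of i] that H(2) by auto
    show "\<phi> j (e i) = (if i = j then 1 else 0)" if "i \<in> H" "j \<in> H" for i j
      using pair[OF that(2,1)] unit(3)[of i] that H(2) by auto
    show "norm (\<phi> i) = 1" if "i \<in> H" for i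
      using unit(2) that H(2) by blast
    show "(\<forall>i\<in>H. \<forall>j\<in>H. i \<noteq> j \<longrightarrow> norm (\<phi> i + \<phi> j) \<le> 1) \<or> (\<exists>\<delta>>0. \<forall>i\<in>H. \<forall>j\<in>H. i \<noteq> j \<longrightarrow> norm (\<phi> i + \<phi> j) \<ge> 1 + \<delta>)"
      by (rule excess_class_dichotomy[where n = n3]) (use pair in blast)
    show "(\<forall>i\<in>H. \<forall>j\<in>H. i \<noteq> j \<longrightarrow> norm (\<phi> i - \<phi> j) \<le> 1) \<or> (\<exists>\<delta>>0. \<forall>i\<in>H. \<forall>j\<in>H. i \<noteq> j \<longrightarrow> norm (\<phi> i - \<phi> j) \<ge> 1 + \<delta>)"
      by (rule excess_class_dichotomy[where n = n4]) (use pair in blast)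
  qed
qed

text \<open>Here the point to be copied is supplied by \<open>ext\<close> for the whole of a reflecting set of cardinality
at most the continuum.\<close>

theorem sym_separated_of_extendable_family:
  fixes I :: "('a::banach \<times> ('a \<Rightarrow>\<^sub>L real)) set"
  assumes I: "\<And>x f. (x, f) \<in> I \<Longrightarrow> norm x = 1 \<and> norm f = 1 \<and> blinfun_apply f x = 1"
    and ext: "\<And>R. |R| \<le>o continuum \<Longrightarrow> \<exists>x f. (x, f) \<in> I \<and>
      (\<forall>y g. (y, g) \<in> R \<inter> I \<longrightarrow> blinfun_apply g x = 0 \<and> blinfun_apply f y = 0)"
  shows "contains_sym_separated (sphere (0::'a) 1) \<and> contains_sym_separated (sphere (0::'a \<Rightarrow>\<^sub>L real) 1)"
proof -
  have unit: "|UNIV :: unit set| \<le>o |UNIV :: (nat \<Rightarrow> bool) set|"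
    by (rule card_of_ordLeqI[where f = "\<lambda>_ _. True"]) (auto simp: inj_on_def)
  obtain R where R: "|R| \<le>o |UNIV :: (nat \<Rightarrow> bool) set|" "(0, 0) \<in> R" "reflecting I (\<lambda>p _. pair_type p) TYPE(nat) R"
    by (rule small_reflecting_set[OF infinite_UNIV_nat card_pair_type unit, of "(0, 0)" I "\<lambda>p _. pair_type p" "\<lambda>_ _. (0, 0)"])
  have "|R| \<le>o continuum"
    unfolding continuum_def using R(1) card_reals ordLeq_ordIso_trans by blast
  then obtain x f where xf: "(x, f) \<in> I"
    "\<And>y g. (y, g) \<in> R \<inter> I \<Longrightarrow> blinfun_apply g x = 0 \<and> blinfun_apply f y = 0"
    using ext by meson
  have "(x, f) \<notin> R"
    using xf I[OF xf(1)] by fastforce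
  then show ?thesis
    using sym_separated_of_reflected_pair[OF R(3) xf(1), of "{(0, 0)}"] I[OF xf(1)] R(2) xf(2) by simp
qed

section \<open>Spaces in which few functionals have a common zero\<close>

text \<open>A vector on which the norming functionals of \<open>R1\<close> vanish yields, by copying, a long sequence in which norming functionals
of earlier vectors vanish on later vectors. On earlier vectors they may take other values. To remove these, one
uses normalised differences \<open>v \<iota> - v \<kappa>\<close> with norming functionals \<open>n (v \<iota> - v \<kappa>)\<close>: if the value of
\<open>n (v \<kappa> - v \<mu>)\<close> at \<open>v \<iota>\<close> is the same for all \<open>\<iota> < \<kappa> < \<mu>\<close>, it cancels on earlier differences. Homogeneity for triples with
real colours takes three reductions: a sequence of length \<open>(2\<^sup>c)\<^sup>+\<close> in which the last index
does not matter, a subsequence of length \<open>c\<^sup>+\<close> in which the middle one does not matter either, and a fibre of the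
remaining real-valued function. The first of these needs vectors killed by \<open>exp\<^sub>2 c\<close> many functionals.\<close>

theorem sym_separated_of_common_zeros:
  assumes G: "\<And>F :: ('a::banach \<Rightarrow>\<^sub>L real) set. |F| \<le>o exp2 continuum \<Longrightarrow>
    \<exists>x. x \<noteq> 0 \<and> (\<forall>f\<in>F. blinfun_apply f x = 0)"
  shows "contains_sym_separated (sphere (0::'a) 1) \<and> contains_sym_separated (sphere (0::'a \<Rightarrow>\<^sub>L real) 1)"
proof -
  define U1 where "U1 = (UNIV :: (real \<Rightarrow> bool) set)"
  define U2 where "U2 = (UNIV :: real set)"
  have inf2: "infinite U2" and inf1: "infinite U1"
    unfolding U1_def U2_def using infinite_UNIV_char_0 infinite_predicates by auto
  have infE: "infinite (UNIV :: ((real \<Rightarrow> bool) \<Rightarrow> bool) set)"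
    using infinite_predicates inf1 unfolding U1_def by blast
  have real_1: "|UNIV :: real set| \<le>o |UNIV :: (real \<Rightarrow> bool) set|"
    by (rule card_le_predicates)
  have real_E: "|UNIV :: real set| \<le>o |UNIV :: ((real \<Rightarrow> bool) \<Rightarrow> bool) set|"
    using ordLeq_transitive[OF real_1 card_le_predicates] .
  have unitc: "|UNIV :: unit set| \<le>o |UNIV :: ('z \<Rightarrow> bool) set|"
    by (rule card_of_ordLeqI[where f = "\<lambda>_ _. True"]) (auto simp: inj_on_def)
  define n where "n = (norming :: 'a \<Rightarrow> 'a \<Rightarrow>\<^sub>L real)"
  define col where "col a b z = (n a z, n (a - b) z, n (b - z) a)" for a b z
  have col_card: "|UNIV :: (real \<times> real \<times> real) set| \<le>o |UNIV :: ((real \<Rightarrow> bool) \<Rightarrow> bool) set|"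
    by (intro card_prod_le real_E infE)
  obtain R1 where R1: "|R1| \<le>o |UNIV :: ((real \<Rightarrow> bool) \<Rightarrow> bool) set|" "0 \<in> R1"
    "reflecting (sphere 0 1) col TYPE(real \<Rightarrow> bool) R1"
    by (rule small_reflecting_set[OF inf1[unfolded U1_def] col_card unitc, of 0 "sphere 0 1" col "\<lambda>_ _. 0"]) blast+
  define F where "F = n ` R1 \<union> (\<lambda>(a, b). n (a - b)) ` (R1 \<times> R1)"
  have "|F| \<le>o exp2 continuum"
  proof -
    have "|R1 \<times> R1| \<le>o |UNIV :: ((real \<Rightarrow> bool) \<Rightarrow> bool) set|"
      using R1(1) by (intro card_of_Sigma_ordLeq_infinite[OF infE]) auto
    then have "|(\<lambda>(a, b). n (a - b)) ` (R1 \<times> R1)| \<le>o |UNIV :: ((real \<Rightarrow> bool) \<Rightarrow> bool) set|"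
      by (rule ordLeq_transitive[OF card_of_image])
    moreover have "|n ` R1| \<le>o |UNIV :: ((real \<Rightarrow> bool) \<Rightarrow> bool) set|"
      by (rule ordLeq_transitive[OF card_of_image R1(1)])
    ultimately show ?thesis
      unfolding exp2_continuum F_def using infE
      by (intro card_of_Un_ordLeq_infinite_Field[OF _ _ _ card_of_Card_order]) (auto simp: Field_card_of)
  qed
  then obtain x0 where x0: "x0 \<noteq> 0" "\<And>f. f \<in> F \<Longrightarrow> blinfun_apply f x0 = 0"
    using G by blast
  define x where "x = (1 / norm x0) *\<^sub>R x0"
  have x1: "norm x = 1"
    using x0(1) by (simp add: x_def)
  have Fx: "blinfun_apply f x = 0" if "f \<in> F" for f
    using x0(2)[OF that] by (simp add: x_def blinfun.scaleR_right)
  have nx: "blinfun_apply (n a) x = 0" "blinfun_apply (n (a - b)) x = 0" if "a \<in> R1" "b \<in> R1" for a b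
    using that by (auto intro!: Fx simp: F_def)
  have xR: "x \<notin> R1"
    using nx(1)[of x x] norming(1)[of x] x1 by (auto simp: n_def)
  \<comment> \<open>The length of the first sequence is the successor of \<open>2\<^sup>c\<close>: its proper initial segments are indexed by \<open>real \<Rightarrow> bool\<close>.\<close>
  define r1 where "r1 = cardSuc |U1|"
  have co1: "Card_order r1"
    unfolding r1_def by (rule cardSuc_Card_order[OF card_of_Card_order])
  have wo1: "Well_order r1"
    using co1 card_order_on_well_order_on by blast
  have under1: "|underS r1 \<xi>| \<le>o |UNIV :: (real \<Rightarrow> bool) set|" if "\<xi> \<in> Field r1" for \<xi>
    using that underS_cardSuc_le unfolding r1_def U1_def by blast
  have sing: "|{p}| \<le>o |UNIV :: 'z set|" for p :: 's
    by (rule card_of_singl_ordLeq) simp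
  have xS: "x \<in> sphere 0 1" and R10: "{0} \<subseteq> R1" "{0} \<noteq> {}"
    using x1 R1(2) by auto
  obtain y where yR: "\<And>\<xi>. \<xi> \<in> Field r1 \<Longrightarrow> y \<xi> \<in> R1 \<inter> sphere 0 1"
    and y_col: "\<And>\<xi> a a'. \<xi> \<in> Field r1 \<Longrightarrow> a \<in> {0} \<union> y ` underS r1 \<xi> \<Longrightarrow> a' \<in> {0} \<union> y ` underS r1 \<xi> \<Longrightarrow>
      col a a' (y \<xi>) = col a a' x"
    and y_new: "\<And>\<xi>. \<xi> \<in> Field r1 \<Longrightarrow> y \<xi> \<notin> y ` underS r1 \<xi>"
    by (rule end_homogeneous_sequence[OF R1(3) inf1[unfolded U1_def] xS xR R10 sing wo1 under1]) blast+
  define g where "g \<eta> \<zeta> = n (y \<zeta> - x) (y \<eta>)" for \<eta> \<zeta>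
  have triple: "n (y \<zeta> - y \<xi>) (y \<eta>) = g \<eta> \<zeta>" "n (y \<eta> - y \<zeta>) (y \<xi>) = 0"
    if "\<xi> \<in> Field r1" "\<eta> \<in> underS r1 \<xi>" "\<zeta> \<in> underS r1 \<xi>" for \<eta> \<zeta> \<xi>
  proof -
    have "col (y \<eta>) (y \<zeta>) (y \<xi>) = col (y \<eta>) (y \<zeta>) x"
      using y_col that by blast
    moreover have "\<eta> \<in> Field r1" "\<zeta> \<in> Field r1"
      using that by (auto simp: underS_def Field_def)
    ultimately show "n (y \<zeta> - y \<xi>) (y \<eta>) = g \<eta> \<zeta>" "n (y \<eta> - y \<zeta>) (y \<xi>) = 0"
      using nx(2)[of "y \<eta>" "y \<zeta>"] yR by (auto simp: col_def g_def)
  qed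
  \<comment> \<open>The second component makes the subsequence increasing, since \<open>x'\<close> lies above all of \<open>R2\<close>.\<close>
  define col2 where "col2 \<eta> (\<eta>' :: (real \<Rightarrow> bool) set) \<zeta> = (g \<eta> \<zeta>, \<eta> \<in> underS r1 \<zeta>)" for \<eta> \<eta>' \<zeta>
  have "|UNIV :: bool set| \<le>o |UNIV :: (real \<Rightarrow> bool) set|"
    by (rule card_of_ordLeqI[where f = "\<lambda>c _. c"]) (auto simp: inj_on_def fun_eq_iff)
  then have col2_card: "|UNIV :: (real \<times> bool) set| \<le>o |UNIV :: (real \<Rightarrow> bool) set|"
    by (rule card_prod_le[OF real_1 _ inf1[unfolded U1_def]])
  obtain R2 where R2: "|R2| \<le>o |UNIV :: (real \<Rightarrow> bool) set|" "undefined \<in> R2"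
    "reflecting (Field r1) col2 TYPE(real) R2"
    by (rule small_reflecting_set[OF infinite_UNIV_char_0 col2_card unitc, of undefined "Field r1" col2 "\<lambda>_ _. undefined"]) blast+
  have "\<not> |Field r1| \<le>o |U1|"
    using card_of_Field_ordIso[OF co1] cardSuc_greater[OF card_of_Card_order, of U1] unfolding r1_def
    by (metis not_ordLess_ordLeq ordIso_ordLeq_trans ordIso_symmetric)
  moreover have "|R2 \<inter> Field r1| \<le>o |U1|"
    using R2(1) ordLeq_transitive[OF card_of_mono1] unfolding U1_def by blast
  ultimately obtain x' where x': "x' \<in> Field r1" "\<And>s. s \<in> R2 \<inter> Field r1 \<Longrightarrow> s \<in> underS r1 x'"
    using strict_upper_bound[OF inf1, of "Field r1" "R2 \<inter> Field r1"] unfolding r1_def by blast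
  have x'R: "x' \<notin> R2"
    using x' by (auto simp: underS_def)
  define r2 where "r2 = cardSuc |U2|"
  have co2: "Card_order r2"
    unfolding r2_def by (rule cardSuc_Card_order[OF card_of_Card_order])
  have wo2: "Well_order r2"
    using co2 card_order_on_well_order_on by blast
  have under2: "|underS r2 \<xi>| \<le>o |UNIV :: real set|" if "\<xi> \<in> Field r2" for \<xi>
    using that underS_cardSuc_le unfolding r2_def U2_def by blast
  have R20: "{undefined} \<subseteq> R2" "{undefined} \<noteq> {}"
    using R2(2) by auto
  obtain z where zR: "\<And>\<xi>. \<xi> \<in> Field r2 \<Longrightarrow> z \<xi> \<in> R2 \<inter> Field r1"
    and z_col: "\<And>\<xi> a a'. \<xi> \<in> Field r2 \<Longrightarrow> a \<in> {undefined} \<union> z ` underS r2 \<xi> \<Longrightarrow>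
      a' \<in> {undefined} \<union> z ` underS r2 \<xi> \<Longrightarrow> col2 a a' (z \<xi>) = col2 a a' x'"
    and "\<And>\<xi>. \<xi> \<in> Field r2 \<Longrightarrow> z \<xi> \<notin> z ` underS r2 \<xi>"
    by (rule end_homogeneous_sequence[OF R2(3) infinite_UNIV_char_0 x'(1) x'R R20 sing wo2 under2]) blast+
  define b where "b \<iota> = g (z \<iota>) x'" for \<iota>
  have pair: "g (z \<iota>) (z \<kappa>) = b \<iota>" "z \<iota> \<in> underS r1 (z \<kappa>)" if "\<kappa> \<in> Field r2" "\<iota> \<in> underS r2 \<kappa>" for \<iota> \<kappa>
  proof -
    have "\<iota> \<in> Field r2"
      using that by (auto simp: underS_def Field_def)
    then have "z \<iota> \<in> underS r1 x'"
      using zR x'(2) by blast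
    moreover have "col2 (z \<iota>) (z \<iota>) (z \<kappa>) = col2 (z \<iota>) (z \<iota>) x'"
      using z_col that by blast
    ultimately show "g (z \<iota>) (z \<kappa>) = b \<iota>" "z \<iota> \<in> underS r1 (z \<kappa>)"
      by (auto simp: col2_def b_def)
  qed
  define v where "v \<iota> = y (z \<iota>)" for \<iota>
  have v_triple: "n (v \<kappa> - v \<mu>) (v \<iota>) = b \<iota>" "n (v \<iota> - v \<kappa>) (v \<mu>) = 0"
    if "\<mu> \<in> Field r2" "\<kappa> \<in> underS r2 \<mu>" "\<iota> \<in> underS r2 \<mu>" "\<iota> \<in> underS r2 \<kappa>" for \<iota> \<kappa> \<mu>
  proof -
    have "\<kappa> \<in> Field r2"
      using that by (auto simp: underS_def Field_def)
    then have g: "g (z \<iota>) (z \<kappa>) = b \<iota>"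
      using pair(1) that(4) by blast
    have z: "z \<mu> \<in> Field r1" "z \<iota> \<in> underS r1 (z \<mu>)" "z \<kappa> \<in> underS r1 (z \<mu>)"
      using pair(2) zR that by blast+
    show "n (v \<kappa> - v \<mu>) (v \<iota>) = b \<iota>" "n (v \<iota> - v \<kappa>) (v \<mu>) = 0"
      unfolding v_def g[symmetric] by (rule triple[OF z])+
  qed
  have v_ne: "v \<iota> \<noteq> v \<kappa>" if "\<kappa> \<in> Field r2" "\<iota> \<in> underS r2 \<kappa>" for \<iota> \<kappa>
  proof -
    have "v \<iota> \<in> y ` underS r1 (z \<kappa>)"
      unfolding v_def by (rule imageI[OF pair(2)[OF that]])
    moreover have "v \<kappa> \<notin> y ` underS r1 (z \<kappa>)"
      unfolding v_def using zR[OF that(1)] by (intro y_new) simp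
    ultimately show ?thesis
      by metis
  qed
  have "\<exists>\<beta>. \<not> |{\<iota> \<in> Field r2. b \<iota> = \<beta>}| \<le>o |U2|"
  proof (rule ccontr)
    assume "\<not> ?thesis"
    then have "|\<Union>\<beta>\<in>U2. {\<iota> \<in> Field r2. b \<iota> = \<beta>}| \<le>o |U2|"
      using inf2 by (intro card_of_UNION_ordLeq_infinite) (auto simp: ordLeq_refl card_of_Card_order)
    moreover have "(\<Union>\<beta>\<in>U2. {\<iota> \<in> Field r2. b \<iota> = \<beta>}) = Field r2"
      unfolding U2_def by auto
    ultimately have "|Field r2| \<le>o |U2|"
      by simp
    then have "r2 \<le>o |U2|"
      using card_of_Field_ordIso[OF co2] ordIso_symmetric ordIso_ordLeq_trans by blast
    then show False
      unfolding r2_def using cardSuc_greater[OF card_of_Card_order] not_ordLess_ordLeq by blast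
  qed
  then obtain \<beta> where \<beta>: "\<not> |{\<iota> \<in> Field r2. b \<iota> = \<beta>}| \<le>o |U2|"
    by blast
  define H where "H = {\<iota> \<in> Field r2. b \<iota> = \<beta>}"
  have H: "H \<subseteq> Field r2" "\<not> |H| \<le>o |U2|"
    using \<beta> unfolding H_def by auto
  define e where "e \<iota> \<kappa> = (1 / norm (v \<iota> - v \<kappa>)) *\<^sub>R (v \<iota> - v \<kappa>)" for \<iota> \<kappa>
  define I where "I = {(e \<iota> \<kappa>, n (v \<iota> - v \<kappa>)) |\<iota> \<kappa>. \<iota> \<in> H \<and> \<kappa> \<in> H \<and> \<iota> \<in> underS r2 \<kappa>}"
  have trans2: "\<iota> \<in> underS r2 \<mu>" if "\<iota> \<in> underS r2 \<kappa>" "\<kappa> \<in> underS r2 \<mu>" for \<iota> \<kappa> \<mu>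
  proof -
    have "trans r2" "antisym r2"
      using wo2 by (simp_all add: order_on_defs)
    then show ?thesis
      using that unfolding underS_def trans_def antisym_def by blast
  qed
  show ?thesis
  proof (rule sym_separated_of_extendable_family[of I])
    show "norm u = 1 \<and> norm f = 1 \<and> blinfun_apply f u = 1" if uf: "(u, f) \<in> I" for u f
    proof -
      obtain \<iota> \<kappa> where "u = e \<iota> \<kappa>" "f = n (v \<iota> - v \<kappa>)" "\<kappa> \<in> Field r2" "\<iota> \<in> underS r2 \<kappa>"
        using uf H(1) unfolding I_def by blast
      then show ?thesis
        using v_ne[of \<kappa> \<iota>] norming(1,3)[of "v \<iota> - v \<kappa>"] by (simp add: e_def n_def blinfun.scaleR_right)
    qed
  next
    fix R :: "('a \<times> ('a \<Rightarrow>\<^sub>L real)) set" assume R: "|R| \<le>o continuum"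
    have "\<exists>\<iota> \<kappa>. \<iota> \<in> H \<and> \<kappa> \<in> H \<and> \<iota> \<in> underS r2 \<kappa> \<and> p = (e \<iota> \<kappa>, n (v \<iota> - v \<kappa>))" if "p \<in> I" for p
      using that unfolding I_def by blast
    then obtain i k where ik: "\<And>p. p \<in> I \<Longrightarrow> i p \<in> H \<and> k p \<in> H \<and> i p \<in> underS r2 (k p) \<and>
        p = (e (i p) (k p), n (v (i p) - v (k p)))"
      by metis
    define S where "S = k ` (R \<inter> I)"
    have S: "S \<subseteq> Field r2" "|S| \<le>o |U2|"
    proof -
      show "S \<subseteq> Field r2"
        unfolding S_def using ik H(1) by blast
      have "|R \<inter> I| \<le>o |U2|"
        using R ordLeq_transitive[OF card_of_mono1] unfolding continuum_def U2_def by blast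
      then show "|S| \<le>o |U2|"
        unfolding S_def using ordLeq_transitive[OF card_of_image] by blast
    qed
    obtain \<iota> where \<iota>: "\<iota> \<in> H" "\<And>s. s \<in> S \<Longrightarrow> s \<in> underS r2 \<iota>"
      by (rule strict_upper_bound[OF inf2 H[unfolded r2_def] S[unfolded r2_def]]) (auto simp: r2_def)
    have "{\<iota>} \<subseteq> Field (cardSuc |U2| )" "|{\<iota>}| \<le>o |U2|"
      using H(1) \<iota>(1) sing[of \<iota>] unfolding r2_def U2_def by auto
    then obtain \<kappa> where \<kappa>: "\<kappa> \<in> H" "\<And>s. s \<in> {\<iota>} \<Longrightarrow> s \<in> underS r2 \<kappa>"
      by (rule strict_upper_bound[OF inf2 H[unfolded r2_def]]) (auto simp: r2_def)
    show "\<exists>u f. (u, f) \<in> I \<and> (\<forall>w h. (w, h) \<in> R \<inter> I \<longrightarrow> blinfun_apply h u = 0 \<and> blinfun_apply f w = 0)"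
    proof (intro exI conjI allI impI)
      show "(e \<iota> \<kappa>, n (v \<iota> - v \<kappa>)) \<in> I"
        unfolding I_def using \<iota> \<kappa> by blast
      fix w h assume wh: "(w, h) \<in> R \<inter> I"
      define i' k' where "i' = i (w, h)" and "k' = k (w, h)"
      have ik': "i' \<in> H" "k' \<in> H" "i' \<in> underS r2 k'" "w = e i' k'" "h = n (v i' - v k')" "k' \<in> S"
        using ik[of "(w, h)"] wh unfolding i'_def k'_def S_def by auto
      have below: "k' \<in> underS r2 \<iota>" "k' \<in> underS r2 \<kappa>" "i' \<in> underS r2 \<iota>" "i' \<in> underS r2 \<kappa>" "\<iota> \<in> underS r2 \<kappa>"
        using \<iota>(2)[OF ik'(6)] \<kappa>(2)[of \<iota>] ik'(3) trans2 by blast+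
      have F: "\<iota> \<in> Field r2" "\<kappa> \<in> Field r2"
        using \<iota>(1) \<kappa>(1) H(1) by auto
      show "blinfun_apply h (e \<iota> \<kappa>) = 0"
        using v_triple(2)[OF F(1) below(1,3) ik'(3)] v_triple(2)[OF F(2) below(2,4) ik'(3)]
        by (simp add: ik' e_def blinfun.scaleR_right blinfun.diff_right)
      have "b i' = b k'"
        using ik'(1,2) by (simp add: H_def)
      then show "blinfun_apply (n (v \<iota> - v \<kappa>)) w = 0"
        using v_triple(1)[OF F(2) below(5,4,3)] v_triple(1)[OF F(2) below(5,2,1)]
        by (simp add: ik' e_def blinfun.scaleR_right blinfun.diff_right)
    qed
  qed
qed

section \<open>Weakly Lindelof determined spaces\<close>

text \<open>The closed set where \<open>\<bar>u p\<bar> \<ge> \<epsilon>\<close> is covered by the open sets where some \<open>w v\<close> does not vanish; a finite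
subcover provides \<open>V\<close>.\<close>

lemma finite_detection:
  fixes u :: "'t \<Rightarrow> real" and w :: "'v \<Rightarrow> 't \<Rightarrow> real"
  assumes T: "compact_space T" and u: "continuous_map T euclideanreal u"
    and w: "\<And>v. v \<in> Y \<Longrightarrow> continuous_map T euclideanreal (w v)"
    and zero: "\<And>p. p \<in> topspace T \<Longrightarrow> (\<And>v. v \<in> Y \<Longrightarrow> w v p = 0) \<Longrightarrow> u p = 0"
    and \<epsilon>: "\<epsilon> > 0"
  obtains V where "finite V" "V \<subseteq> Y" "\<And>p. p \<in> topspace T \<Longrightarrow> (\<And>v. v \<in> V \<Longrightarrow> w v p = 0) \<Longrightarrow> \<bar>u p\<bar> < \<epsilon>"
proof -
  define C where "C = {p \<in> topspace T. u p \<in> {t. \<epsilon> \<le> \<bar>t\<bar>}}"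
  define O' where "O' v = {p \<in> topspace T. w v p \<in> - {0}}" for v
  have "closed {t :: real. \<epsilon> \<le> \<bar>t\<bar>}"
    by (intro closed_Collect_le continuous_intros)
  then have "closedin T C"
    unfolding C_def using u by (intro closedin_continuous_map_preimage) auto
  then have C: "compactin T C"
    using T closedin_compact_space by blast
  have open_O: "openin T U" if U: "U \<in> O' ` Y" for U
  proof -
    obtain v where "v \<in> Y" "U = O' v"
      using U by blast
    then show ?thesis
      unfolding O'_def using openin_continuous_map_preimage[OF w, of v "- {0}"] by (simp add: open_Compl)
  qed
  have "C \<subseteq> \<Union>(O' ` Y)"
    using zero \<epsilon> unfolding C_def O'_def by force
  then obtain \<F> where "finite \<F>" "\<F> \<subseteq> O' ` Y" "C \<subseteq> \<Union>\<F>"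
    using compactinD[OF C open_O] by metis
  then obtain V where V: "finite V" "V \<subseteq> Y" "C \<subseteq> \<Union>(O' ` V)"
    by (metis finite_subset_image)
  show thesis
  proof (rule that[OF V(1,2)])
    fix p assume p: "p \<in> topspace T" "\<And>v. v \<in> V \<Longrightarrow> w v p = 0"
    then have "p \<notin> C"
      using V(3) unfolding O'_def by fastforce
    then show "\<bar>u p\<bar> < \<epsilon>"
      using p(1) unfolding C_def by auto
  qed
qed

text \<open>A cluster point of the sequence, described by the only property used later: continuous functions that are
eventually constant along the sequence take that constant value at the point.\<close>

lemma compact_cluster_point:
  assumes T: "compact_space T" and s: "\<And>n :: nat. s n \<in> topspace T"
  obtains k where "k \<in> topspace T"
    "\<And>u c N. continuous_map T euclideanreal u \<Longrightarrow> (\<And>n. n \<ge> N \<Longrightarrow> u (s n) = c) \<Longrightarrow> u k = (c::real)"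
proof -
  define C where "C N = T closure_of (s ` {N..})" for N :: nat
  have tail: "s n \<in> C N" if "N \<le> n" for n N
    unfolding C_def using s that by (intro subsetD[OF closure_of_subset]) auto
  have "\<Inter>(range C) \<noteq> {}"
  proof -
    have "\<Inter>\<F> \<noteq> {}" if F: "finite \<F>" "\<F> \<subseteq> range C" for \<F>
    proof -
      obtain M where M: "finite M" "\<F> = C ` M"
        using F finite_subset_image by metis
      obtain n where "\<And>N. N \<in> M \<Longrightarrow> N \<le> n"
        using M(1) by (meson finite_nat_set_iff_bounded_le)
      then have "s n \<in> \<Inter>\<F>"
        unfolding M(2) using tail by blast
      then show ?thesis
        by blast
    qed
    moreover have "\<forall>c\<in>range C. closedin T c"
      by (auto simp: C_def)
    moreover have "(\<forall>c\<in>range C. closedin T c) \<and> (\<forall>\<F>. finite \<F> \<and> \<F> \<subseteq> range C \<longrightarrow> \<Inter>\<F> \<noteq> {}) \<longrightarrow>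
        \<Inter>(range C) \<noteq> {}"
      using T unfolding compact_space_fip by (rule spec)
    ultimately show ?thesis
      by simp
  qed
  then obtain k where k: "\<And>N. k \<in> C N"
    by blast
  show thesis
  proof (rule that)
    show "k \<in> topspace T"
      using k[of 0] subsetD[OF closure_of_subset_topspace] unfolding C_def by metis
    fix u :: "'a \<Rightarrow> real" and c N assume u: "continuous_map T euclideanreal u" and eq: "\<And>n. n \<ge> N \<Longrightarrow> u (s n) = c"
    have "closedin T {p \<in> topspace T. u p \<in> {c}}"
      using u by (intro closedin_continuous_map_preimage) auto
    moreover have "s ` {N..} \<subseteq> {p \<in> topspace T. u p \<in> {c}}"
      using eq s by auto
    ultimately have "C N \<subseteq> {p \<in> topspace T. u p \<in> {c}}"
      unfolding C_def by (rule closure_of_minimal[rotated])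
    then show "u k = c"
      using k by blast
  qed
qed

lemma functional_in_span_of_finitely_many:
  fixes w :: "'v \<Rightarrow> 'z::real_vector \<Rightarrow> real" and \<theta> :: "'z \<Rightarrow> real"
  assumes "finite V" and Z: "subspace Z" and w: "\<And>v. v \<in> V \<Longrightarrow> linear (w v)" and "linear \<theta>"
    and "\<And>z. z \<in> Z \<Longrightarrow> (\<And>v. v \<in> V \<Longrightarrow> w v z = 0) \<Longrightarrow> \<theta> z = 0"
  shows "\<exists>c. \<forall>z\<in>Z. \<theta> z = (\<Sum>v\<in>V. c v * w v z)"
  using assms(1,3-)
proof (induction V arbitrary: \<theta> rule: finite_induct)
  case empty
  then show ?case
    by auto
next
  case (insert v V)
  have lin: "linear (w u)" if "u \<in> insert v V" for u
    using insert.prems(1) that .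
  show ?case
  proof (cases "\<exists>z\<in>Z. (\<forall>u\<in>V. w u z = 0) \<and> w v z \<noteq> 0")
    case False
    then have "\<exists>c. \<forall>z\<in>Z. \<theta> z = (\<Sum>u\<in>V. c u * w u z)"
      using insert.prems by (intro insert.IH) blast+
    then obtain c where c: "\<forall>z\<in>Z. \<theta> z = (\<Sum>u\<in>V. c u * w u z)"
      by blast
    have "(\<Sum>u\<in>insert v V. (c(v := 0)) u * w u z) = (\<Sum>u\<in>V. c u * w u z)" for z
      using insert.hyps by (auto intro!: sum.cong)
    then show ?thesis
      using c by (intro exI[of _ "c(v := 0)"]) auto
  next
    case True
    then obtain z1 where z1: "z1 \<in> Z" "\<forall>u\<in>V. w u z1 = 0" "w v z1 \<noteq> 0"
      by blast
    define z0 where "z0 = (1 / w v z1) *\<^sub>R z1"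
    have z0: "z0 \<in> Z" "\<forall>u\<in>V. w u z0 = 0" "w v z0 = 1"
      using z1 subspace_scale[OF Z] lin by (auto simp: z0_def linear_scale)
    define \<theta>' where "\<theta>' z = \<theta> z - \<theta> z0 * w v z" for z
    have "linear \<theta>'"
      using insert.prems(2) lin[of v] unfolding \<theta>'_def
      by (intro linearI) (auto simp: linear_add linear_scale algebra_simps)
    moreover have "\<theta>' z = 0" if z: "z \<in> Z" "\<And>u. u \<in> V \<Longrightarrow> w u z = 0" for z
    proof -
      have "\<theta> (z - w v z *\<^sub>R z0) = 0"
      proof (rule insert.prems(3))
        show "z - w v z *\<^sub>R z0 \<in> Z"
          using z(1) z0(1) Z subspace_diff subspace_scale by blast
        show "w u (z - w v z *\<^sub>R z0) = 0" if "u \<in> insert v V" for u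
          using that z(2) z0(2,3) lin[OF that] by (auto simp: linear_diff linear_scale)
      qed
      then show ?thesis
        using insert.prems(2) by (simp add: \<theta>'_def linear_diff linear_scale)
    qed
    ultimately have "\<exists>c. \<forall>z\<in>Z. \<theta>' z = (\<Sum>u\<in>V. c u * w u z)"
      using lin by (intro insert.IH) auto
    then obtain c where c: "\<And>z. z \<in> Z \<Longrightarrow> \<theta>' z = (\<Sum>u\<in>V. c u * w u z)"
      by blast
    have "(\<Sum>u\<in>insert v V. (c(v := \<theta> z0)) u * w u z) = \<theta> z0 * w v z + (\<Sum>u\<in>V. c u * w u z)" for z
    proof -
      have "(\<Sum>u\<in>V. (c(v := \<theta> z0)) u * w u z) = (\<Sum>u\<in>V. c u * w u z)"
        using insert.hyps(2) by (intro sum.cong) auto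
      then show ?thesis
        using insert.hyps by simp
    qed
    then show ?thesis
      using c by (intro exI[of _ "c(v := \<theta> z0)"]) (auto simp: \<theta>'_def[abs_def] algebra_simps)
  qed
qed

text \<open>The maps \<open>h \<gamma>\<close> are the coordinates of an embedding of the dual ball into a Corson compact. Let \<open>Y\<close> and \<open>F\<close> be the vectors
and the functionals of norm at most one in a suitably closed set \<open>R\<close>, and let \<open>\<Gamma>0\<close> be the set of coordinates
that do not vanish on all of \<open>F\<close>. Two facts make the reflection argument work without exponentials larger than the
continuum.

First, every functional \<open>\<psi>\<close> in the ball agrees on \<open>Y\<close> with a member of \<open>F\<close>, namely with the one whose
coordinates are those of \<open>\<psi>\<close> on \<open>\<Gamma>0\<close> and \<open>0\<close> elsewhere. So the values of a norming functional \<open>f\<close> on \<open>Y\<close> are coded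
by a single parameter \<open>k \<in> F\<close>, and copies taken over \<open>k\<close> are killed by \<open>f\<close>.

Second, a vector \<open>x\<close> outside the closed span of \<open>Y\<close> differs by a vector of that closed span from one which \<open>F\<close> kills. Indeed \<open>F\<close> is compact
and separated by \<open>Y\<close>; so finitely many members of \<open>Y\<close> control \<open>x\<close> on \<open>F\<close> up to \<open>\<epsilon>\<close>, and the Hahn-Banach theorem in the dual
turns this into an approximation of \<open>x\<close> on \<open>F\<close> by a vector in the span of \<open>Y\<close>. These approximations converge,
because \<open>F\<close> is norming for \<open>Y\<close>.\<close>

theorem sym_separated_of_corson_dual_ball:
  fixes h :: "'g \<Rightarrow> ('a::banach \<Rightarrow>\<^sub>L real) \<Rightarrow> real" and \<Gamma> :: "'g set"
  defines "B \<equiv> cball (0 :: 'a \<Rightarrow>\<^sub>L real) 1"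
  defines "\<tau> \<equiv> subtopology strong_operator_topology B"
  assumes comp: "compact_space \<tau>"
    and cont: "\<And>\<gamma>. \<gamma> \<in> \<Gamma> \<Longrightarrow> continuous_map \<tau> euclideanreal (h \<gamma>)"
    and inj: "\<And>k k'. k \<in> B \<Longrightarrow> k' \<in> B \<Longrightarrow> (\<And>\<gamma>. \<gamma> \<in> \<Gamma> \<Longrightarrow> h \<gamma> k = h \<gamma> k') \<Longrightarrow> k = k'"
    and cnt: "\<And>k. k \<in> B \<Longrightarrow> countable {\<gamma> \<in> \<Gamma>. h \<gamma> k \<noteq> 0}"
    and dens: "\<And>Y :: 'a set. |Y| \<le>o continuum \<Longrightarrow> closure (span Y) \<noteq> UNIV"
  shows "contains_sym_separated (sphere (0::'a) 1) \<and> contains_sym_separated (sphere (0::'a \<Rightarrow>\<^sub>L real) 1)"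
proof -
  have top\<tau>: "topspace \<tau> = B"
    by (simp add: \<tau>_def strong_operator_topology_topspace)
  have eval: "continuous_map \<tau> euclideanreal (\<lambda>k. blinfun_apply k v)" for v
    unfolding \<tau>_def by (intro continuous_map_from_subtopology strong_operator_topology_continuous_evaluation)
  have B: "k \<in> B \<longleftrightarrow> norm k \<le> 1" for k
    by (simp add: B_def)
  \<comment> \<open>By compactness, each coordinate depends on countably many vectors only.\<close>
  have "\<exists>V. countable V \<and> (\<forall>k\<in>B. \<forall>k'\<in>B. (\<forall>v\<in>V. blinfun_apply k v = blinfun_apply k' v) \<longrightarrow> h \<gamma> k = h \<gamma> k')"
    if \<gamma>: "\<gamma> \<in> \<Gamma>" for \<gamma>
  proof -
    let ?T = "prod_topology \<tau> \<tau>"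
    have cT: "compact_space ?T"
      using comp by (simp add: compact_space_prod_topology)
    have diff: "continuous_map ?T euclideanreal (\<lambda>p. g (fst p) - g (snd p))" if "continuous_map \<tau> euclideanreal g" for g
    proof (rule continuous_map_diff)
      show "continuous_map ?T euclideanreal (\<lambda>p. g (fst p))"
        using continuous_map_compose[OF continuous_map_fst that, of \<tau>] by (simp add: o_def)
      show "continuous_map ?T euclideanreal (\<lambda>p. g (snd p))"
        using continuous_map_compose[OF continuous_map_snd that, of \<tau>] by (simp add: o_def)
    qed
    have "\<exists>V. finite V \<and> (\<forall>p\<in>topspace ?T. (\<forall>v\<in>V. blinfun_apply (fst p) v - blinfun_apply (snd p) v = 0) \<longrightarrow>
        \<bar>h \<gamma> (fst p) - h \<gamma> (snd p)\<bar> < 1 / real (Suc n))" for n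
    proof -
      have "h \<gamma> (fst p) - h \<gamma> (snd p) = 0"
        if "\<And>v. v \<in> UNIV \<Longrightarrow> blinfun_apply (fst p) v - blinfun_apply (snd p) v = 0" for p
      proof -
        have "fst p = snd p"
          using that by (intro blinfun_eqI) simp
        then show ?thesis
          by simp
      qed
      note zero = this
      obtain V :: "'a set" where "finite V" "\<And>p. p \<in> topspace ?T \<Longrightarrow>
          (\<And>v. v \<in> V \<Longrightarrow> blinfun_apply (fst p) v - blinfun_apply (snd p) v = 0) \<Longrightarrow>
          \<bar>h \<gamma> (fst p) - h \<gamma> (snd p)\<bar> < 1 / real (Suc n)"
      proof (rule finite_detection[where w = "\<lambda>v p. blinfun_apply (fst p) v - blinfun_apply (snd p) v" and Y = UNIV,
            OF cT diff[OF cont[OF \<gamma>]] diff[OF eval] zero])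
        show "0 < 1 / real (Suc n)"
          by simp
      qed blast+
      then show ?thesis
        by blast
    qed
    then obtain V where V: "\<And>n. finite (V n)" "\<And>n p. p \<in> topspace ?T \<Longrightarrow>
        (\<And>v. v \<in> V n \<Longrightarrow> blinfun_apply (fst p) v - blinfun_apply (snd p) v = 0) \<Longrightarrow>
        \<bar>h \<gamma> (fst p) - h \<gamma> (snd p)\<bar> < 1 / real (Suc n)"
      by metis
    have "h \<gamma> k = h \<gamma> k'" if k: "k \<in> B" "k' \<in> B" "\<forall>v\<in>\<Union>n. V n. blinfun_apply k v = blinfun_apply k' v" for k k'
    proof (rule ccontr)
      assume "h \<gamma> k \<noteq> h \<gamma> k'"
      then obtain n where "1 / real (Suc n) < \<bar>h \<gamma> k - h \<gamma> k'\<bar>"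
        using nat_approx_posE[of "\<bar>h \<gamma> k - h \<gamma> k'\<bar>"] by auto
      moreover have "\<bar>h \<gamma> k - h \<gamma> k'\<bar> < 1 / real (Suc n)"
        using V(2)[of "(k, k')" n] k by (auto simp: top\<tau>)
      ultimately show False
        by simp
    qed
    moreover have "countable (\<Union>n. V n)"
      using V(1) by (intro countable_UN countableI_type) (auto intro: countable_finite)
    ultimately show ?thesis
      by (intro exI[of _ "\<Union>n. V n"]) blast
  qed
  then obtain V where V: "\<And>\<gamma>. \<gamma> \<in> \<Gamma> \<Longrightarrow> countable (V \<gamma>)"
    "\<And>\<gamma> k k'. \<gamma> \<in> \<Gamma> \<Longrightarrow> k \<in> B \<Longrightarrow> k' \<in> B \<Longrightarrow> (\<And>v. v \<in> V \<gamma> \<Longrightarrow> blinfun_apply k v = blinfun_apply k' v) \<Longrightarrow> h \<gamma> k = h \<gamma> k'"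
    by metis
  define W where "W k = (\<Union>\<gamma>\<in>{\<gamma> \<in> \<Gamma>. h \<gamma> k \<noteq> 0}. V \<gamma>)" for k
  have W: "countable (W k)" if "k \<in> B" for k
    unfolding W_def using V(1) cnt[OF that] by (intro countable_UN) auto
  define cluster where "cluster s k \<longleftrightarrow> k \<in> B \<and>
    (\<forall>u c N. continuous_map \<tau> euclideanreal u \<longrightarrow> (\<forall>n\<ge>N. u (s n) = c) \<longrightarrow> u k = c)"
    for s :: "nat \<Rightarrow> 'a \<Rightarrow>\<^sub>L real" and k
  have cluster_ex: "\<exists>k. cluster s k" if s: "\<And>n. s n \<in> B" for s
  proof -
    obtain k where "k \<in> topspace \<tau>"
      "\<And>u c N. continuous_map \<tau> euclideanreal u \<Longrightarrow> (\<And>n. n \<ge> N \<Longrightarrow> u (s n) = c) \<Longrightarrow> u k = (c::real)"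
      using compact_cluster_point[OF comp, of s] s top\<tau> by metis
    then show ?thesis
      unfolding cluster_def top\<tau> by blast
  qed
  \<comment> \<open>Closure under cluster points of sequences, linear combinations, and the vectors on which the non-zero coordinates of a functional depend; the numbers in the label select the operation.\<close>
  define op :: "nat \<times> real \<times> real \<Rightarrow> (nat \<Rightarrow> 'a \<times> ('a \<Rightarrow>\<^sub>L real)) \<Rightarrow> 'a \<times> ('a \<Rightarrow>\<^sub>L real)" where
    "op l s = (case l of (n, a, b) \<Rightarrow>
       if n = 0 then (0, SOME k. cluster (\<lambda>i. snd (s i)) k)
       else if n = 1 then (0, a *\<^sub>R snd (s 0) + b *\<^sub>R snd (s 1))
       else (from_nat_into (W (snd (s 0))) (n - 2), 0))" for l s
  have label: "|UNIV :: (nat \<times> real \<times> real) set| \<le>o |UNIV :: (nat \<Rightarrow> bool) set|"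
  proof -
    have "|UNIV :: real set| \<le>o |UNIV :: (nat \<Rightarrow> bool) set|"
      using card_reals ordIso_symmetric ordIso_imp_ordLeq by blast
    moreover have "infinite (UNIV :: (nat \<Rightarrow> bool) set)"
      by (rule infinite_predicates) simp
    ultimately show ?thesis
      using card_le_predicates by (intro card_prod_le)
  qed
  obtain R where R: "|R| \<le>o |UNIV :: (nat \<Rightarrow> bool) set|" "(0, 0) \<in> R"
    "reflecting UNIV (\<lambda>p _. pair_type p) TYPE(nat) R" "\<And>l s. range s \<subseteq> R \<Longrightarrow> op l s \<in> R"
    by (rule small_reflecting_set[OF infinite_UNIV_nat card_pair_type label, of "(0, 0)" UNIV "\<lambda>p _. pair_type p" op]) blast+
  define Y where "Y = fst ` R"
  define F where "F = snd ` R \<inter> B"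
  have "|Y| \<le>o |UNIV :: (nat \<Rightarrow> bool) set|"
    unfolding Y_def using R(1) ordLeq_transitive[OF card_of_image] by blast
  then have Y_card: "|Y| \<le>o continuum"
    unfolding continuum_def using card_reals ordLeq_ordIso_trans by blast
  have FB: "F \<subseteq> B"
    unfolding F_def by blast
  have inF: "k \<in> F" if "(v, k) \<in> R" "norm k \<le> 1" for v k
    using imageI[OF that(1), of snd] that(2) by (simp add: F_def B)
  have fromF: "\<exists>v. (v, k) \<in> R" if "k \<in> F" for k
    using that unfolding F_def by auto
  have lin: "(0, a *\<^sub>R k + b *\<^sub>R k') \<in> R" if kk: "k \<in> F" "k' \<in> F" for a b k k'
  proof -
    obtain v v' where "(v, k) \<in> R" "(v', k') \<in> R"
      using fromF kk by blast
    then have "op (1, a, b) (\<lambda>i. if i = 0 then (v, k) else (v', k')) \<in> R"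
      by (intro R(4)) auto
    then show ?thesis
      by (simp add: op_def)
  qed
  have linF: "a *\<^sub>R k + b *\<^sub>R k' \<in> F" if "k \<in> F" "k' \<in> F" "norm (a *\<^sub>R k + b *\<^sub>R k') \<le> 1" for a b k k'
    by (rule inF[OF lin[OF that(1,2)] that(3)])
  have zeroF: "0 \<in> F"
    by (rule inF[OF R(2)]) simp
  have WY: "W k \<subseteq> Y" if k: "k \<in> F" for k
  proof
    fix v assume v: "v \<in> W k"
    then have "W k \<noteq> {}"
      by blast
    obtain n where n: "from_nat_into (W k) n = v"
      using from_nat_into_surj[OF W v] k FB by blast
    obtain u where "(u, k) \<in> R"
      using k unfolding F_def by auto
    then have "op (n + 2, 0, 0) (\<lambda>_. (u, k)) \<in> R"
      by (intro R(4)) auto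
    then show "v \<in> Y"
      unfolding Y_def using n by (force simp: op_def)
  qed
  \<comment> \<open>The type of \<open>(0, \<psi>)\<close> contains the values of \<open>\<psi>\<close>.\<close>
  have refl: "\<exists>k\<in>F. \<forall>v\<in>A. blinfun_apply k v = blinfun_apply \<psi> v" if A: "countable A" "A \<subseteq> Y" and \<psi>: "\<psi> \<in> B" for A \<psi>
  proof -
    obtain Q where Q: "countable Q" "Q \<subseteq> R" "A = fst ` Q"
      using A countable_subset_image[of A fst R] unfolding Y_def by blast
    define s where "s = from_nat_into (insert (0, 0) Q)"
    have s: "range s = insert (0, 0) Q"
      unfolding s_def using Q(1) by (intro range_from_nat_into) auto
    then have "range s \<subseteq> R"
      using Q(2) R(2) by auto
    then obtain y where y: "y \<in> R" "\<And>b. pair_type (s b) y = pair_type (s b) (0, \<psi>)"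
      using R(3)[unfolded reflecting_def, rule_format, OF _ UNIV_I, of s "(0, \<psi>)"] by blast
    have "norm (snd y) = norm \<psi>"
      using y(2)[of 0] by (simp add: pair_type_def)
    then have "snd y \<in> F"
      using y(1) \<psi> by (intro inF[of "fst y"]) (simp_all add: B)
    moreover have "blinfun_apply (snd y) v = blinfun_apply \<psi> v" if "v \<in> A" for v
    proof -
      obtain b where "fst (s b) = v"
        using \<open>v \<in> A\<close> Q(3) s by (metis image_iff insertI2 rangeE)
      then show ?thesis
        using y(2)[of b] by (simp add: pair_type_def)
    qed
    ultimately show ?thesis
      by blast
  qed
  define \<Gamma>0 where "\<Gamma>0 = (\<Union>k\<in>F. {\<gamma> \<in> \<Gamma>. h \<gamma> k \<noteq> 0})"
  have \<Gamma>0: "\<Gamma>0 \<subseteq> \<Gamma>" "\<And>\<gamma>. \<gamma> \<in> \<Gamma>0 \<Longrightarrow> V \<gamma> \<subseteq> Y"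
    using WY unfolding \<Gamma>0_def W_def by blast+
  have off: "h \<gamma> k = 0" if "k \<in> F" "\<gamma> \<in> \<Gamma> - \<Gamma>0" for \<gamma> k
    using that unfolding \<Gamma>0_def by blast
  have extend1: "\<exists>k\<in>F. blinfun_apply k y = blinfun_apply \<psi> y \<and> (\<forall>\<gamma>\<in>\<Gamma>0. h \<gamma> k = h \<gamma> \<psi>)"
    if y: "y \<in> Y" and \<psi>: "\<psi> \<in> B" for y \<psi>
  proof -
    define E where "E = {\<gamma> \<in> \<Gamma>0. h \<gamma> \<psi> \<noteq> 0}"
    have E: "countable E"
      unfolding E_def by (rule countable_subset[OF _ cnt[OF \<psi>]]) (use \<Gamma>0(1) in blast)
    obtain kk where kk: "\<And>A. countable A \<Longrightarrow> A \<subseteq> Y \<Longrightarrow> kk A \<in> F \<and> (\<forall>v\<in>A. blinfun_apply (kk A) v = blinfun_apply \<psi> v)"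
      using refl[OF _ _ \<psi>] by metis
    \<comment> \<open>The sets \<open>A n\<close> decide more and more coordinates. A coordinate that is ever non-zero on some \<open>k m\<close>, or non-zero on \<open>\<psi>\<close>, is eventually equal to that of \<open>\<psi>\<close>; all others vanish throughout. A cluster point of \<open>k\<close> therefore has the required coordinates.\<close>
    define A where "A = rec_nat (insert y (\<Union>\<gamma>\<in>E. V \<gamma>)) (\<lambda>_ A. A \<union> W (kk A))"
    have A0: "A 0 = insert y (\<Union>\<gamma>\<in>E. V \<gamma>)" and ASuc: "A (Suc n) = A n \<union> W (kk (A n))" for n
      by (simp_all add: A_def)
    have A: "countable (A n) \<and> A n \<subseteq> Y" for n
    proof (induction n)
      case 0
      have "countable (\<Union>\<gamma>\<in>E. V \<gamma>)"
        using E V(1) \<Gamma>0(1) by (intro countable_UN) (auto simp: E_def)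
      then show ?case
        using y \<Gamma>0(2) by (auto simp: A0 E_def)
    next
      case (Suc n)
      then have "kk (A n) \<in> F"
        using kk by blast
      then show ?case
        using Suc WY W FB by (auto simp: ASuc)
    qed
    define k where "k n = kk (A n)" for n
    have k: "k n \<in> F" "\<And>v. v \<in> A n \<Longrightarrow> blinfun_apply (k n) v = blinfun_apply \<psi> v" for n
      using kk A unfolding k_def by blast+
    have mono: "A m \<subseteq> A n" if "m \<le> n" for m n
      using that by (rule lift_Suc_mono_le[rotated]) (auto simp: ASuc)
    have "\<exists>p. p \<in> R \<and> snd p = k n" for n
      using fromF[OF k(1)[of n]] by auto
    then obtain p where p: "\<And>n. p n \<in> R" "\<And>n. snd (p n) = k n"
      by metis
    define l where "l = (SOME l. cluster k l)"
    have "cluster k l"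
      unfolding l_def by (rule someI_ex, rule cluster_ex, rule subsetD[OF FB k(1)])
    then have l: "l \<in> B" "\<And>u c N. continuous_map \<tau> euclideanreal u \<Longrightarrow> (\<And>n. n \<ge> N \<Longrightarrow> u (k n) = c) \<Longrightarrow> u l = c"
      unfolding cluster_def by blast+
    have "op (0, 0, 0) p \<in> R"
      using p(1) by (intro R(4)) blast
    then have "l \<in> F"
      using l(1) by (intro inF[of 0]) (simp_all add: op_def p(2) l_def[symmetric] B)
    moreover have "blinfun_apply l y = blinfun_apply \<psi> y"
      using k(2) mono[of 0] by (intro l(2)[OF eval, of 0]) (auto simp: A0)
    moreover have "h \<gamma> l = h \<gamma> \<psi>" if \<gamma>: "\<gamma> \<in> \<Gamma>0" for \<gamma>
    proof -
      have \<gamma>': "\<gamma> \<in> \<Gamma>"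
        using \<gamma> \<Gamma>0(1) by blast
      consider m where "V \<gamma> \<subseteq> A m" | "h \<gamma> \<psi> = 0" "\<And>n. h \<gamma> (k n) = 0"
      proof (cases "\<gamma> \<in> E \<or> (\<exists>m. h \<gamma> (k m) \<noteq> 0)")
        case True
        then show ?thesis
        proof
          assume "\<gamma> \<in> E"
          then show ?thesis
            by (intro that(1)[of 0]) (auto simp: A0)
        next
          assume "\<exists>m. h \<gamma> (k m) \<noteq> 0"
          then obtain m where "V \<gamma> \<subseteq> W (kk (A m))"
            using \<gamma>' unfolding W_def k_def by blast
          then show ?thesis
            by (intro that(1)[of "Suc m"]) (auto simp: ASuc)
        qed
      next
        case False
        then show ?thesis
          using \<gamma> by (intro that(2)) (auto simp: E_def)
      qed
      then show ?thesis
      proof cases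
        case (1 m)
        show ?thesis
        proof (rule l(2)[OF cont[OF \<gamma>'], of m])
          fix n assume "m \<le> n"
          then show "h \<gamma> (k n) = h \<gamma> \<psi>"
            using 1 mono[of m n] k FB by (intro V(2)[OF \<gamma>' _ \<psi>]) blast+
        qed
      next
        case 2
        then show ?thesis
          by (intro l(2)[OF cont[OF \<gamma>'], of 0]) auto
      qed
    qed
    ultimately show ?thesis
      by blast
  qed
  \<comment> \<open>The coordinates determine the functional, so the same \<open>k\<close> works for all \<open>y \<in> Y\<close>.\<close>
  have extend: "\<exists>k\<in>F. (\<forall>v\<in>Y. blinfun_apply k v = blinfun_apply \<psi> v) \<and> (\<forall>\<gamma>\<in>\<Gamma>0. h \<gamma> k = h \<gamma> \<psi>)"
    if \<psi>: "\<psi> \<in> B" for \<psi>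
  proof -
    have "0 \<in> Y"
      using R(2) unfolding Y_def by force
    then obtain k where k: "k \<in> F" "\<forall>\<gamma>\<in>\<Gamma>0. h \<gamma> k = h \<gamma> \<psi>"
      using extend1[OF _ \<psi>] by blast
    have "blinfun_apply k v = blinfun_apply \<psi> v" if v: "v \<in> Y" for v
    proof -
      obtain k' where k': "k' \<in> F" "blinfun_apply k' v = blinfun_apply \<psi> v" "\<forall>\<gamma>\<in>\<Gamma>0. h \<gamma> k' = h \<gamma> \<psi>"
        using extend1[OF v \<psi>] by blast
      have "k = k'"
      proof (rule inj)
        show "h \<gamma> k = h \<gamma> k'" if "\<gamma> \<in> \<Gamma>" for \<gamma>
          using that k k' off by (cases "\<gamma> \<in> \<Gamma>0") auto
      qed (use k k' FB in auto)
      then show ?thesis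
        using k' by simp
    qed
    then show ?thesis
      using k by blast
  qed
  \<comment> \<open>This description shows that \<open>F\<close> is compact.\<close>
  have F_eq: "F = {k \<in> topspace \<tau>. \<forall>\<gamma>\<in>\<Gamma> - \<Gamma>0. h \<gamma> k = 0}"
  proof
    show "F \<subseteq> {k \<in> topspace \<tau>. \<forall>\<gamma>\<in>\<Gamma> - \<Gamma>0. h \<gamma> k = 0}"
      using FB off top\<tau> by auto
    show "{k \<in> topspace \<tau>. \<forall>\<gamma>\<in>\<Gamma> - \<Gamma>0. h \<gamma> k = 0} \<subseteq> F"
    proof
      fix k assume "k \<in> {k \<in> topspace \<tau>. \<forall>\<gamma>\<in>\<Gamma> - \<Gamma>0. h \<gamma> k = 0}"
      then have k: "k \<in> B" "\<And>\<gamma>. \<gamma> \<in> \<Gamma> - \<Gamma>0 \<Longrightarrow> h \<gamma> k = 0"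
        using top\<tau> by auto
      obtain k' where k': "k' \<in> F" "\<forall>\<gamma>\<in>\<Gamma>0. h \<gamma> k' = h \<gamma> k"
        using extend[OF k(1)] by blast
      have "k' = k"
      proof (rule inj)
        show "h \<gamma> k' = h \<gamma> k" if "\<gamma> \<in> \<Gamma>" for \<gamma>
          using that k k' off by (cases "\<gamma> \<in> \<Gamma>0") auto
      qed (use k k' FB in auto)
      then show "k \<in> F"
        using k' by simp
    qed
  qed
  have "closedin \<tau> F"
  proof -
    have "closedin \<tau> {k \<in> topspace \<tau>. h \<gamma> k \<in> {0}}" if "\<gamma> \<in> \<Gamma> - \<Gamma>0" for \<gamma>
      using that cont by (intro closedin_continuous_map_preimage) auto
    then have "closedin \<tau> (\<Inter>(insert (topspace \<tau>) ((\<lambda>\<gamma>. {k \<in> topspace \<tau>. h \<gamma> k \<in> {0}}) ` (\<Gamma> - \<Gamma>0))))"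
      by (intro closedin_Inter) blast+
    then have "closedin \<tau> (topspace \<tau> \<inter> (\<Inter>\<gamma>\<in>\<Gamma> - \<Gamma>0. {k \<in> topspace \<tau>. h \<gamma> k \<in> {0}}))"
      by simp
    moreover have "F = topspace \<tau> \<inter> (\<Inter>\<gamma>\<in>\<Gamma> - \<Gamma>0. {k \<in> topspace \<tau>. h \<gamma> k \<in> {0}})"
      unfolding F_eq by auto
    ultimately show ?thesis
      by simp
  qed
  then have compF: "compact_space (subtopology \<tau> F)"
    using comp closedin_compact_space compact_space_subtopology by blast
  have topF: "topspace (subtopology \<tau> F) = F"
    using FB top\<tau> by auto
  have Y_sep: "k = 0" if "k \<in> F" "\<And>v. v \<in> Y \<Longrightarrow> blinfun_apply k v = 0" for k
  proof (rule inj)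
    show "h \<gamma> k = h \<gamma> 0" if "\<gamma> \<in> \<Gamma>" for \<gamma>
    proof (cases "\<gamma> \<in> \<Gamma>0")
      case True
      show ?thesis
      proof (rule V(2)[OF \<open>\<gamma> \<in> \<Gamma>\<close>])
        show "blinfun_apply k v = blinfun_apply 0 v" if "v \<in> V \<gamma>" for v
          using \<open>\<And>v. v \<in> Y \<Longrightarrow> blinfun_apply k v = 0\<close> \<Gamma>0(2)[OF True] that by auto
      qed (use \<open>k \<in> F\<close> zeroF FB in auto)
    qed (use off \<open>k \<in> F\<close> zeroF \<open>\<gamma> \<in> \<Gamma>\<close> in auto)
  qed (use that zeroF FB in auto)
  define Z where "Z = {c *\<^sub>R k |c k. k \<in> F}"
  have FZ: "k \<in> Z" if "k \<in> F" for k
    unfolding Z_def using that by (auto intro!: exI[of _ 1])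
  have ZF: "k \<in> F" if "k \<in> Z" "norm k \<le> 1" for k
    using that linF[OF _ zeroF, of _ _ 0] unfolding Z_def by auto
  have Z: "subspace Z"
    unfolding subspace_def
  proof (intro conjI allI ballI)
    show "0 \<in> Z"
      using FZ zeroF by blast
    show "c *\<^sub>R k \<in> Z" if kZ: "k \<in> Z" for c k
    proof -
      obtain a l where "k = a *\<^sub>R l" "l \<in> F"
        using kZ unfolding Z_def by blast
      then have "c *\<^sub>R k = (c * a) *\<^sub>R l" "l \<in> F"
        by simp_all
      then show ?thesis
        unfolding Z_def by blast
    qed
    fix k k' assume "k \<in> Z" "k' \<in> Z"
    then obtain c l c' l' where l: "k = c *\<^sub>R l" "k' = c' *\<^sub>R l'" "l \<in> F" "l' \<in> F"
      unfolding Z_def by blast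
    define M where "M = \<bar>c\<bar> + \<bar>c'\<bar> + 1"
    have M: "M > 0"
      unfolding M_def by linarith
    have "norm ((c / M) *\<^sub>R l + (c' / M) *\<^sub>R l') \<le> \<bar>c / M\<bar> * 1 + \<bar>c' / M\<bar> * 1"
    proof (intro order_trans[OF norm_triangle_ineq] add_mono)
      show "norm ((c / M) *\<^sub>R l) \<le> \<bar>c / M\<bar> * 1" "norm ((c' / M) *\<^sub>R l') \<le> \<bar>c' / M\<bar> * 1"
        using subsetD[OF FB l(3)] subsetD[OF FB l(4)] unfolding norm_scaleR B by (intro mult_left_mono; simp)+
    qed
    also have "\<dots> \<le> 1"
      using M by (simp add: M_def abs_divide add_divide_distrib[symmetric])
    finally have "(c / M) *\<^sub>R l + (c' / M) *\<^sub>R l' \<in> F"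
      using linF[OF l(3,4)] by blast
    moreover have "k + k' = M *\<^sub>R ((c / M) *\<^sub>R l + (c' / M) *\<^sub>R l')"
      using M by (simp add: l scaleR_right_distrib)
    ultimately show "k + k' \<in> Z"
      unfolding Z_def by blast
  qed
  \<comment> \<open>On the subspace \<open>N\<close> where finitely many members of \<open>Y\<close> vanish, evaluation at \<open>x\<close> has norm at most \<open>\<epsilon>\<close>. Subtracting an extension \<open>g\<close> of the same norm leaves a functional that vanishes on \<open>N\<close>, that is, evaluation at a combination of those members.\<close>
  have approx: "\<exists>y\<in>span Y. \<forall>k\<in>F. \<bar>blinfun_apply k x - blinfun_apply k y\<bar> \<le> \<epsilon>" if \<epsilon>: "\<epsilon> > 0" for x and \<epsilon> :: real
  proof -
    have evalF: "continuous_map (subtopology \<tau> F) euclideanreal (\<lambda>k. blinfun_apply k v)" for v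
      by (intro continuous_map_from_subtopology eval)
    have zero: "blinfun_apply k x = 0" if "k \<in> topspace (subtopology \<tau> F)" "\<And>v. v \<in> Y \<Longrightarrow> blinfun_apply k v = 0" for k
    proof -
      have "k = 0"
        using that by (intro Y_sep) (auto simp: topF)
      then show ?thesis
        by simp
    qed
    obtain U where U: "finite U" "U \<subseteq> Y"
      "\<And>k. k \<in> F \<Longrightarrow> (\<And>v. v \<in> U \<Longrightarrow> blinfun_apply k v = 0) \<Longrightarrow> \<bar>blinfun_apply k x\<bar> < \<epsilon>"
    proof (rule finite_detection[where w = "\<lambda>v k. blinfun_apply k v" and Y = Y, OF compF evalF[of x] evalF zero \<epsilon>, unfolded topF])
      fix U assume "finite U" "U \<subseteq> Y"
        "\<And>k. k \<in> F \<Longrightarrow> (\<And>v. v \<in> U \<Longrightarrow> blinfun_apply k v = 0) \<Longrightarrow> \<bar>blinfun_apply k x\<bar> < \<epsilon>"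
      then show thesis
        by (rule that) blast+
    qed (simp_all add: topF)
    define N where "N = {k \<in> Z. \<forall>v\<in>U. blinfun_apply k v = 0}"
    have N: "subspace N"
      using Z unfolding N_def subspace_def by (auto simp: blinfun.add_left blinfun.scaleR_left)
    have bound: "blinfun_apply k x \<le> \<epsilon> * norm k" if k: "k \<in> N" for k
    proof (cases "k = 0")
      case False
      define k1 where "k1 = (1 / norm k) *\<^sub>R k"
      have "k1 \<in> N"
        unfolding k1_def using N k subspace_scale by blast
      then have "k1 \<in> F"
        using ZF[of k1] False unfolding N_def by (simp add: k1_def)
      then have "\<bar>blinfun_apply k1 x\<bar> < \<epsilon>"
        using U(3)[of k1] \<open>k1 \<in> N\<close> unfolding N_def by blast
      then have "\<bar>blinfun_apply k x\<bar> / norm k < \<epsilon>"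
        by (simp add: k1_def blinfun.scaleR_left)
      then have "\<bar>blinfun_apply k x\<bar> < \<epsilon> * norm k"
        using False by (simp add: divide_less_eq)
      then show ?thesis
        by linarith
    qed simp
    obtain g :: "('a \<Rightarrow>\<^sub>L real) \<Rightarrow>\<^sub>L real" where g: "\<And>k. k \<in> N \<Longrightarrow> blinfun_apply g k = blinfun_apply k x" "norm g \<le> \<epsilon>"
      by (rule Hahn_Banach_extension[OF N, of "\<lambda>k. blinfun_apply k x" \<epsilon>])
         (use bound \<epsilon> in \<open>auto simp: blinfun.add_left blinfun.scaleR_left\<close>)
    have "\<exists>c. \<forall>k\<in>Z. blinfun_apply k x - blinfun_apply g k = (\<Sum>v\<in>U. c v * blinfun_apply k v)"
    proof (rule functional_in_span_of_finitely_many[OF U(1) Z])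
      show "linear (\<lambda>k. blinfun_apply k v)" for v :: 'a
        by (intro bounded_linear.linear blinfun.bounded_linear_left)
      show "linear (\<lambda>k. blinfun_apply k x - blinfun_apply g k)"
        by (intro linear_compose_sub bounded_linear.linear blinfun.bounded_linear_left blinfun.bounded_linear_right)
      show "blinfun_apply k x - blinfun_apply g k = 0" if "k \<in> Z" "\<And>v. v \<in> U \<Longrightarrow> blinfun_apply k v = 0" for k
        using that g(1)[of k] unfolding N_def by simp
    qed
    then obtain c where c: "\<And>k. k \<in> Z \<Longrightarrow> blinfun_apply k x - blinfun_apply g k = (\<Sum>v\<in>U. c v * blinfun_apply k v)"
      by blast
    define y where "y = (\<Sum>v\<in>U. c v *\<^sub>R v)"
    have "y \<in> span Y"
      unfolding y_def using U(2) by (intro span_sum span_scale span_base) auto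
    moreover have "\<bar>blinfun_apply k x - blinfun_apply k y\<bar> \<le> \<epsilon>" if k: "k \<in> F" for k
    proof -
      have "blinfun_apply k x - blinfun_apply k y = blinfun_apply g k"
        using c[OF FZ[OF k]] by (simp add: y_def blinfun.sum_right blinfun.scaleR_right)
      moreover have "\<bar>blinfun_apply g k\<bar> \<le> \<epsilon> * 1"
        using norm_blinfun[of g k] g(2) k FB \<epsilon>
        by (intro order_trans[OF _ mult_mono[of "norm g" \<epsilon> "norm k" 1]]) (auto simp: B subset_iff)
      ultimately show ?thesis
        by simp
    qed
    ultimately show ?thesis
      by blast
  qed
  obtain x where x: "x \<notin> closure (span Y)"
    using dens[OF Y_card] by blast
  have "\<exists>y. \<forall>n. y n \<in> span Y \<and> (\<forall>k\<in>F. \<bar>blinfun_apply k x - blinfun_apply k (y n)\<bar> \<le> 1 / real (Suc n))"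
    using approx[of "1 / real (Suc _)" x] by (intro choice allI) fastforce
  then obtain y where y: "\<And>n. y n \<in> span Y"
    "\<And>n k. k \<in> F \<Longrightarrow> \<bar>blinfun_apply k x - blinfun_apply k (y n)\<bar> \<le> 1 / real (Suc n)"
    by blast
  have dist_y: "norm (y n - y m) \<le> 1 / real (Suc n) + 1 / real (Suc m)" for n m
  proof -
    define v where "v = y n - y m"
    have "norming v \<in> B"
      unfolding B by (rule norming(2))
    then obtain k where k: "k \<in> F" "\<forall>u\<in>Y. blinfun_apply k u = blinfun_apply (norming v) u"
      using extend by blast
    have "v \<in> span Y"
      unfolding v_def by (intro span_diff y(1))
    then have "blinfun_apply k v = blinfun_apply (norming v) v"
      using k(2) linear_eq_on[of "blinfun_apply k" "blinfun_apply (norming v)" v Y]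
      by (auto intro: bounded_linear.linear blinfun.bounded_linear_right)
    then have "norm v = blinfun_apply k v"
      by (simp add: norming(1))
    also have "\<dots> = (blinfun_apply k x - blinfun_apply k (y m)) - (blinfun_apply k x - blinfun_apply k (y n))"
      by (simp add: v_def blinfun.diff_right)
    also have "\<dots> \<le> 1 / real (Suc n) + 1 / real (Suc m)"
      using y(2)[OF k(1), of n] y(2)[OF k(1), of m] by linarith
    finally show ?thesis
      by (simp add: v_def)
  qed
  have "Cauchy y"
  proof (rule CauchyI)
    fix e :: real assume "e > 0"
    then obtain M where M: "1 / real (Suc M) < e / 2"
      using nat_approx_posE[of "e / 2"] by auto
    have "norm (y m - y n) < e" if "m \<ge> M" "n \<ge> M" for m n
    proof -
      have "1 / real (Suc m) \<le> 1 / real (Suc M)" "1 / real (Suc n) \<le> 1 / real (Suc M)"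
        using that by (auto intro!: divide_left_mono)
      then show ?thesis
        using dist_y[of m n] M by linarith
    qed
    then show "\<exists>M. \<forall>m\<ge>M. \<forall>n\<ge>M. norm (y m - y n) < e"
      by blast
  qed
  then obtain y' where y': "y \<longlonglongrightarrow> y'"
    using Cauchy_convergent convergent_def by blast
  have "y' \<in> closure (span Y)"
    using y(1) y' closure_sequential by blast
  then have "x - y' \<noteq> 0"
    using x by auto
  have kill: "blinfun_apply k (x - y') = 0" if k: "k \<in> F" for k
  proof -
    have "(\<lambda>n. \<bar>blinfun_apply k x - blinfun_apply k (y n)\<bar>) \<longlonglongrightarrow> \<bar>blinfun_apply k x - blinfun_apply k y'\<bar>"
      by (intro tendsto_intros blinfun.tendsto y')
    moreover have "(\<lambda>n. 1 / real (Suc n)) \<longlonglongrightarrow> 0"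
      using lim_1_over_n LIMSEQ_Suc by blast
    ultimately have "\<bar>blinfun_apply k x - blinfun_apply k y'\<bar> \<le> 0"
      using y(2)[OF k] by (intro tendsto_le[OF sequentially_bot]) auto
    then show ?thesis
      by (simp add: blinfun.diff_right)
  qed
  define x1 where "x1 = (1 / norm (x - y')) *\<^sub>R (x - y')"
  have x1: "norm x1 = 1"
    using \<open>x - y' \<noteq> 0\<close> by (simp add: x1_def)
  have kill1: "blinfun_apply k x1 = 0" if "k \<in> F" for k
    using kill[OF that] by (simp add: x1_def blinfun.scaleR_right)
  define f where "f = norming x1"
  have f: "norm f = 1" "blinfun_apply f x1 = 1"
    using norming(1)[of x1] norming(3)[of x1] x1 unfolding f_def by (metis norm_zero zero_neq_one)+
  obtain k where k: "k \<in> F" "\<forall>v\<in>Y. blinfun_apply k v = blinfun_apply f v"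
    using extend[of f] f(1) B by auto
  have "(0, k) \<in> R"
    using lin[OF k(1) k(1), of 1 0] by simp
  have new: "(x1, f) \<notin> R"
  proof
    assume "(x1, f) \<in> R"
    then have "f \<in> F"
      by (rule inF) (simp add: f(1))
    then show False
      using kill1 f(2) by fastforce
  qed
  have top: "blinfun_apply g x1 = 0 \<and> blinfun_apply f v = 0"
    if vg: "(v, g) \<in> R \<inter> UNIV" and pt: "\<And>d. d \<in> {(0, k)} \<Longrightarrow> pair_type d (v, g) = pair_type d (x1, f)" for v g
  proof
    have "pair_type (0, k) (v, g) = pair_type (0, k) (x1, f)"
      using pt by blast
    then have "blinfun_apply k v = 0" "norm g = 1"
      using kill1[OF k(1)] f(1) by (auto simp: pair_type_def)
    moreover have "v \<in> Y" "norm g = 1 \<Longrightarrow> g \<in> F"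
      using vg inF[of v g] by (auto simp: Y_def image_iff intro: bexI[of _ "(v, g)"])
    ultimately show "blinfun_apply g x1 = 0" "blinfun_apply f v = 0"
      using kill1 k(2) by auto
  qed
  have D: "{(0, k)} \<subseteq> R" "{(0, k)} \<noteq> {}" "countable {(0, k)}"
    using \<open>(0, k) \<in> R\<close> by auto
  show ?thesis
    by (intro conjI sym_separated_of_reflected_pair[OF R(3) UNIV_I new x1 f D top]) blast+
qed

section \<open>Real and complex scalars\<close>

lemma (in vector_space) card_span_le:
  assumes "|UNIV :: 'a set| \<le>o |U|" and "|A| \<le>o |U|" and "infinite U"
  shows "|span A| \<le>o |U|"
proof -
  define L where "L xs = sum_list (map (\<lambda>(c, v). scale c v) xs)" for xs :: "('a \<times> 'b) list"
  have "span A \<subseteq> L ` lists (UNIV \<times> A)"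
  proof
    fix v assume "v \<in> span A"
    then show "v \<in> L ` lists (UNIV \<times> A)"
    proof (induction rule: span_induct_alt)
      case base
      have "0 = L []"
        by (simp add: L_def)
      then show ?case
        by blast
    next
      case (step c x y)
      then obtain xs where "y = L xs" "xs \<in> lists (UNIV \<times> A)"
        by blast
      then have "scale c x + y = L ((c, x) # xs)" "(c, x) # xs \<in> lists (UNIV \<times> A)"
        using step by (auto simp: L_def)
      then show ?case
        by blast
    qed
  qed
  then have "|span A| \<le>o |lists ((UNIV :: 'a set) \<times> A)|"
    by (rule ordLeq_transitive[OF card_of_mono1 card_of_image])
  also have "|lists ((UNIV :: 'a set) \<times> A)| \<le>o |U|"
    using assms card_of_Sigma_ordLeq_infinite[OF assms(3,1), of "\<lambda>_. A"] by (intro card_lists_le) auto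
  finally show ?thesis .
qed

lemma density_character_le: "dense_subset T D \<Longrightarrow> density_character T \<le>o |D|"
  using density_character_attained[of T] by metis

definition mult_functional :: "'k::real_normed_field \<Rightarrow> ('a::real_normed_vector \<Rightarrow>\<^sub>L 'k) \<Rightarrow> 'a \<Rightarrow>\<^sub>L 'k"
  where "mult_functional c f = blinfun_compose (Blinfun (\<lambda>t. c * t)) f"

lemma mult_functional_apply [simp]: "blinfun_apply (mult_functional c f) x = c * blinfun_apply f x"
  by (simp add: mult_functional_def bounded_linear_Blinfun_apply[OF bounded_linear_mult_right])

lemma vector_space_mult_functional: "vector_space mult_functional"
  by unfold_locales (auto intro!: blinfun_eqI simp: algebra_simps blinfun.add_left)

context normed_space_over
begin

interpretation dual: vector_space "mult_functional :: 'k \<Rightarrow> ('a \<Rightarrow>\<^sub>L 'k) \<Rightarrow> 'a \<Rightarrow>\<^sub>L 'k"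
  by (rule vector_space_mult_functional)

lemma dual_span_subset: "F \<subseteq> dual_space smul \<Longrightarrow> dual.span F \<subseteq> dual_space smul"
  by (rule dual.span_minimal)
     (auto simp: dual.subspace_def dual_space_def blinfun.add_left algebra_simps)

text \<open>A total set of functionals is as good as the full dual in finite dimensions: the double annihilator of a finite set
is its span.\<close>

lemma in_span_of_annihilated:
  assumes total: "\<And>x. (\<And>f. f \<in> F \<Longrightarrow> blinfun_apply f x = 0) \<Longrightarrow> x = 0"
    and F: "F \<subseteq> dual_space smul" and A: "finite A"
    and "\<And>f. f \<in> dual.span F \<Longrightarrow> (\<And>a. a \<in> A \<Longrightarrow> blinfun_apply f a = 0) \<Longrightarrow> blinfun_apply f x = 0"
  shows "x \<in> span A"
  using A assms(4)
proof (induction A arbitrary: x rule: finite_induct)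
  case empty
  then have "x = 0"
    by (intro total) (auto intro: dual.span_base)
  then show ?case
    by simp
next
  case (insert a A)
  show ?case
  proof (cases "\<exists>k\<in>dual.span F. (\<forall>b\<in>A. blinfun_apply k b = 0) \<and> blinfun_apply k a \<noteq> 0")
    case False
    then have "x \<in> span A"
      using insert.prems by (intro insert.IH) blast
    then show ?thesis
      using span_mono by blast
  next
    case True
    then obtain k0 where k0: "k0 \<in> dual.span F" "\<And>b. b \<in> A \<Longrightarrow> blinfun_apply k0 b = 0" "blinfun_apply k0 a \<noteq> 0"
      by blast
    define c where "c = blinfun_apply k0 x / blinfun_apply k0 a"
    have "x - smul c a \<in> span A"
    proof (rule insert.IH)
      fix f assume f: "f \<in> dual.span F" "\<And>b. b \<in> A \<Longrightarrow> blinfun_apply f b = 0"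
      define f' where "f' = f - mult_functional (blinfun_apply f a / blinfun_apply k0 a) k0"
      have "f' \<in> dual.span F"
        unfolding f'_def by (intro dual.span_diff dual.span_scale f k0)
      moreover have "blinfun_apply f' b = 0" if "b \<in> insert a A" for b
        using that f k0 by (auto simp: f'_def blinfun.diff_left)
      ultimately have "blinfun_apply f' x = 0"
        by (rule insert.prems)
      then have "blinfun_apply f x = blinfun_apply f a / blinfun_apply k0 a * blinfun_apply k0 x"
        by (simp add: f'_def blinfun.diff_left)
      moreover have "blinfun_apply f (smul c a) = c * blinfun_apply f a"
        using f(1) dual_span_subset[OF F] unfolding dual_space_def by blast
      ultimately show "blinfun_apply f (x - smul c a) = 0"
        by (simp add: blinfun.diff_right c_def)
    qed
    then show ?thesis
      unfolding span_breakdown_eq by blast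
  qed
qed

text \<open>One point at a time: either a functional in the span of \<open>F\<close> vanishing on \<open>A\<close> can be added to correct the value at the new point \<open>x\<close>, or
\<open>x\<close> is a combination of \<open>A\<close> and the value is already correct.\<close>

lemma interpolation:
  assumes total: "\<And>x. (\<And>f. f \<in> F \<Longrightarrow> blinfun_apply f x = 0) \<Longrightarrow> x = 0"
    and F: "F \<subseteq> dual_space smul" and f: "f \<in> dual_space smul" and A: "finite A"
  shows "\<exists>g\<in>dual.span F. \<forall>a\<in>A. blinfun_apply g a = blinfun_apply f a"
  using A
proof (induction A rule: finite_induct)
  case empty
  then show ?case
    using dual.span_zero by blast
next
  case (insert x A)
  then obtain g where g: "g \<in> dual.span F" "\<And>a. a \<in> A \<Longrightarrow> blinfun_apply g a = blinfun_apply f a"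
    by blast
  show ?case
  proof (cases "\<exists>k\<in>dual.span F. (\<forall>a\<in>A. blinfun_apply k a = 0) \<and> blinfun_apply k x \<noteq> 0")
    case True
    then obtain k where k: "k \<in> dual.span F" "\<And>a. a \<in> A \<Longrightarrow> blinfun_apply k a = 0" "blinfun_apply k x \<noteq> 0"
      by blast
    define g' where "g' = g + mult_functional ((blinfun_apply f x - blinfun_apply g x) / blinfun_apply k x) k"
    have "g' \<in> dual.span F"
      unfolding g'_def by (intro dual.span_add dual.span_scale g k)
    moreover have "blinfun_apply g' a = blinfun_apply f a" if "a \<in> insert x A" for a
      using that g k by (auto simp: g'_def blinfun.add_left)
    ultimately show ?thesis
      by blast
  next
    case False
    then have "x \<in> span A"
      using insert.hyps(1) by (intro in_span_of_annihilated[OF total F]) blast+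
    have gD: "g \<in> dual_space smul"
      using g(1) dual_span_subset[OF F] by blast
    have "subspace {v. blinfun_apply g v = blinfun_apply f v}"
      using f gD by (auto simp: subspace_def dual_space_def blinfun.add_right)
    then have "span A \<subseteq> {v. blinfun_apply g v = blinfun_apply f v}"
      using g(2) by (intro span_minimal) auto
    then have "blinfun_apply g x = blinfun_apply f x"
      using \<open>x \<in> span A\<close> by blast
    then show ?thesis
      using g by blast
  qed
qed

text \<open>A basic neighbourhood of \<open>f\<close> restricts finitely many values, which can be interpolated.\<close>

lemma weak_star_dense_span:
  assumes total: "\<And>x. (\<And>f. f \<in> F \<Longrightarrow> blinfun_apply f x = 0) \<Longrightarrow> x = 0"
    and F: "F \<subseteq> dual_space smul"
  shows "dense_subset (weak_star smul) (dual.span F)"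
proof -
  have top: "topspace (weak_star smul) = dual_space smul"
    by (simp add: weak_star_def strong_operator_topology_topspace)
  have "f \<in> weak_star smul closure_of dual.span F" if f: "f \<in> dual_space smul" for f
    unfolding in_closure_of
  proof (intro conjI allI impI)
    show "f \<in> topspace (weak_star smul)"
      using f top by simp
    fix U assume "f \<in> U \<and> openin (weak_star smul) U"
    then obtain W where fU: "f \<in> U" and W: "open W" "U = blinfun_apply -` W \<inter> dual_space smul"
      unfolding weak_star_def openin_subtopology strong_operator_topology_def openin_pullback_topology by auto
    have "openin (product_topology (\<lambda>_. euclidean) UNIV) W" "blinfun_apply f \<in> W"
      using W fU by (auto simp: euclidean_product_topology)
    from product_topology_open_contains_basis[OF this] obtain X where X: "blinfun_apply f \<in> (\<Pi>\<^sub>E i\<in>UNIV. X i)"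
      "finite {i. X i \<noteq> UNIV}" "(\<Pi>\<^sub>E i\<in>UNIV. X i) \<subseteq> W"
      by auto
    obtain g where g: "g \<in> dual.span F" "\<And>a. X a \<noteq> UNIV \<Longrightarrow> blinfun_apply g a = blinfun_apply f a"
      using interpolation[OF total F f X(2)] by blast
    have "blinfun_apply g i \<in> X i" for i
      using X(1) g(2)[of i] by (cases "X i = UNIV") (auto simp: PiE_iff)
    then have "blinfun_apply g \<in> W"
      using X(3) by (auto simp: PiE_iff)
    then have "g \<in> U"
      using W(2) g(1) dual_span_subset[OF F] by blast
    then show "\<exists>y. y \<in> dual.span F \<and> y \<in> U"
      using g(1) by blast
  qed
  then show ?thesis
    unfolding dense_subset_def top using dual_span_subset[OF F] closure_of_subset_topspace[of "weak_star smul"] top by auto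
qed

lemma common_zero_of_few_functionals:
  assumes dens: "|U| <o density_character (weak_star smul)"
    and U: "infinite U" "|UNIV :: 'k set| \<le>o |U|"
    and F: "F \<subseteq> dual_space smul" "|F| \<le>o |U|"
  shows "\<exists>x. x \<noteq> 0 \<and> (\<forall>f\<in>F. blinfun_apply f x = 0)"
proof (rule ccontr)
  assume "\<not> ?thesis"
  then have "dense_subset (weak_star smul) (dual.span F)"
    by (intro weak_star_dense_span F) blast
  then have "density_character (weak_star smul) \<le>o |dual.span F|"
    by (rule density_character_le)
  also have "|dual.span F| \<le>o |U|"
    by (rule dual.card_span_le[OF U(2) F(2) U(1)])
  finally show False
    using dens not_ordLess_ordLeq by blast
qed

end

lemma closure_span_ne_UNIV:
  fixes Y :: "'a::real_normed_vector set"
  assumes dens: "continuum <o density_character (euclidean :: 'a topology)" and Y: "|Y| \<le>o continuum"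
  shows "closure (span Y) \<noteq> UNIV"
proof
  assume "closure (span Y) = UNIV"
  then have "dense_subset (euclidean :: 'a topology) (span Y)"
    by (simp add: dense_subset_def euclidean_closure_of)
  then have "density_character (euclidean :: 'a topology) \<le>o |span Y|"
    by (rule density_character_le)
  also have "|span Y| \<le>o continuum"
    using real_vector.card_span_le[of "UNIV :: real set" Y] Y infinite_UNIV_char_0[where 'a = real]
    unfolding continuum_def span_raw_def[symmetric] by (simp add: ordLeq_refl card_of_Card_order)
  finally show False
    using dens not_ordLess_ordLeq by blast
qed

text \<open>The weak-star compact ball in the definition of \<open>WLD\<close> is that of the space of \<open>'k\<close>-linear functionals. The maps \<open>J\<close> and \<open>\<rho>\<close> carry
the coordinates and the compactness over to the ball of real functionals.\<close>

lemma sym_separated_of_WLD: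
  fixes smul :: "'k::real_normed_field \<Rightarrow> 'a::banach \<Rightarrow> 'a" and J :: "('a \<Rightarrow>\<^sub>L real) \<Rightarrow> 'a \<Rightarrow>\<^sub>L 'k"
  defines "\<tau> \<equiv> subtopology strong_operator_topology (cball (0 :: 'a \<Rightarrow>\<^sub>L real) 1)"
  defines "\<sigma> \<equiv> subtopology (weak_star smul) (dual_ball smul)"
  assumes wld: "WLD smul" and dens: "continuum <o density_character (euclidean :: 'a topology)"
    and J: "continuous_map \<tau> \<sigma> J" "inj J"
    and \<rho>: "continuous_map \<sigma> \<tau> \<rho>" "\<And>k. k \<in> cball 0 1 \<Longrightarrow> \<rho> (J k) = k"
  shows "contains_sym_separated (sphere (0::'a) 1) \<and> contains_sym_separated (sphere (0::'a \<Rightarrow>\<^sub>L real) 1)"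
proof -
  obtain \<Gamma> :: "(('a \<Rightarrow>\<^sub>L 'k) \<Rightarrow> real) set" and C where C: "compactin (product_topology (\<lambda>_. top_of_set {-1..1::real}) \<Gamma>) C"
    "\<forall>x\<in>C. countable {\<gamma> \<in> \<Gamma>. x \<gamma> \<noteq> 0}"
    "\<sigma> homeomorphic_space subtopology (product_topology (\<lambda>_. top_of_set {-1..1::real}) \<Gamma>) C"
    using wld[unfolded WLD_def corson_compact_def, folded \<sigma>_def] by blast
  let ?Q = "product_topology (\<lambda>_. top_of_set {-1..1::real}) \<Gamma>"
  obtain h where h: "homeomorphic_map \<sigma> (subtopology ?Q C) h"
    using C(3) homeomorphic_space by blast
  have top\<tau>: "topspace \<tau> = cball 0 1"
    by (simp add: \<tau>_def strong_operator_topology_topspace)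
  have J_in: "J k \<in> topspace \<sigma>" if "k \<in> cball 0 1" for k
    using J(1) that top\<tau> by (auto simp: continuous_map_def Pi_iff)
  have CQ: "C \<subseteq> topspace ?Q"
    by (rule compactin_subset_topspace[OF C(1)])
  have hC: "h y \<in> C" if "y \<in> topspace \<sigma>" for y
    using homeomorphic_imp_surjective_map[OF h] that CQ by auto
  have "compact_space \<sigma>"
    using homeomorphic_compact_space[OF C(3)] compact_space_subtopology[OF C(1)] by blast
  moreover have "\<rho> ` topspace \<sigma> = topspace \<tau>"
  proof
    show "\<rho> ` topspace \<sigma> \<subseteq> topspace \<tau>"
      using \<rho>(1) by (auto simp: continuous_map_def)
    show "topspace \<tau> \<subseteq> \<rho> ` topspace \<sigma>"
      using \<rho>(2) J_in top\<tau> by (metis image_iff subsetI)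
  qed
  ultimately have comp: "compact_space \<tau>"
    using image_compactin[OF _ \<rho>(1), of "topspace \<sigma>"] unfolding compact_space_def by simp
  have "continuous_map \<sigma> ?Q h"
    using homeomorphic_imp_continuous_map[OF h] continuous_map_in_subtopology by blast
  then have hJ: "continuous_map \<tau> ?Q (h \<circ> J)"
    by (rule continuous_map_compose[OF J(1)])
  show ?thesis
  proof (rule sym_separated_of_corson_dual_ball[where h = "\<lambda>\<gamma> k. h (J k) \<gamma>" and \<Gamma> = \<Gamma>, folded \<tau>_def, OF comp])
    show "continuous_map \<tau> euclideanreal (\<lambda>k. h (J k) \<gamma>)" if "\<gamma> \<in> \<Gamma>" for \<gamma>
    proof -
      have "continuous_map \<tau> (top_of_set {-1..1::real}) (\<lambda>k. (h \<circ> J) k \<gamma>)"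
        using hJ that unfolding continuous_map_componentwise by blast
      then show ?thesis
        by (simp add: continuous_map_in_subtopology o_def)
    qed
    show "k = k'" if k: "k \<in> cball 0 1" "k' \<in> cball 0 1" and eq: "\<And>\<gamma>. \<gamma> \<in> \<Gamma> \<Longrightarrow> h (J k) \<gamma> = h (J k') \<gamma>" for k k'
    proof -
      have "h (J k) \<in> extensional \<Gamma>" "h (J k') \<in> extensional \<Gamma>"
        using hC[OF J_in[OF k(1)]] hC[OF J_in[OF k(2)]] CQ by (auto simp: PiE_def)
      then have "h (J k) = h (J k')"
        using eq by (meson extensionalityI)
      then have "J k = J k'"
        using homeomorphic_imp_injective_map[OF h] J_in k by (meson inj_onD)
      then show ?thesis
        using J(2) by (meson injD)
    qed
    show "countable {\<gamma> \<in> \<Gamma>. h (J k) \<gamma> \<noteq> 0}" if "k \<in> cball 0 1" for k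
      by (rule bspec[OF C(2) hC[OF J_in[OF that]]])
    show "closure (span Y) \<noteq> UNIV" if "|Y| \<le>o continuum" for Y :: "'a set"
      by (rule closure_span_ne_UNIV[OF dens that])
  qed
qed

text \<open>The complex-linear functional with real part \<open>g\<close>.\<close>

definition complexify :: "(complex \<Rightarrow> 'a::real_normed_vector \<Rightarrow> 'a) \<Rightarrow> ('a \<Rightarrow>\<^sub>L real) \<Rightarrow> 'a \<Rightarrow>\<^sub>L complex"
  where "complexify smul g = Blinfun (\<lambda>x. Complex (blinfun_apply g x) (- blinfun_apply g (smul \<i> x)))"

locale complex_normed_space = normed_space_over smul for smul :: "complex \<Rightarrow> 'a::real_normed_vector \<Rightarrow> 'a"
begin

lemma smul_scaleR: "smul c (r *\<^sub>R x) = r *\<^sub>R smul c x"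
  by (metis scale_of_real scale_scale mult.commute)

lemma smul_Complex: "smul (Complex a b) x = a *\<^sub>R x + b *\<^sub>R smul \<i> x"
proof -
  have "Complex a b = of_real a + of_real b * \<i>"
    by (simp add: complex_eq_iff)
  then show ?thesis
    by (simp only: scale_left_distrib scale_of_real flip: scale_scale)
qed

lemma complexify_apply:
  "blinfun_apply (complexify smul g) x = Complex (blinfun_apply g x) (- blinfun_apply g (smul \<i> x))"
proof -
  have "bounded_linear (\<lambda>x. Complex (blinfun_apply g x) (- blinfun_apply g (smul \<i> x)))"
  proof (rule bounded_linear_intro[where K = "2 * norm g"])
    fix x y and r :: real
    show "Complex (blinfun_apply g (x + y)) (- blinfun_apply g (smul \<i> (x + y))) =
        Complex (blinfun_apply g x) (- blinfun_apply g (smul \<i> x)) + Complex (blinfun_apply g y) (- blinfun_apply g (smul \<i> y))"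
      by (simp add: scale_right_distrib blinfun.add_right complex_eq_iff)
    show "Complex (blinfun_apply g (r *\<^sub>R x)) (- blinfun_apply g (smul \<i> (r *\<^sub>R x))) =
        r *\<^sub>R Complex (blinfun_apply g x) (- blinfun_apply g (smul \<i> x))"
      by (simp add: smul_scaleR blinfun.scaleR_right complex_eq_iff)
    have "norm (Complex (blinfun_apply g x) (- blinfun_apply g (smul \<i> x))) \<le> \<bar>blinfun_apply g x\<bar> + \<bar>blinfun_apply g (smul \<i> x)\<bar>"
      using cmod_le[of "Complex (blinfun_apply g x) (- blinfun_apply g (smul \<i> x))"] by simp
    also have "\<dots> \<le> norm g * norm x + norm g * norm x"
    proof (rule add_mono)
      show "\<bar>blinfun_apply g x\<bar> \<le> norm g * norm x"
        using norm_blinfun[of g x] by simp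
      show "\<bar>blinfun_apply g (smul \<i> x)\<bar> \<le> norm g * norm x"
        using norm_blinfun[of g "smul \<i> x"] by (simp add: norm_scale)
    qed
    finally show "norm (Complex (blinfun_apply g x) (- blinfun_apply g (smul \<i> x))) \<le> norm x * (2 * norm g)"
      by (simp add: algebra_simps)
  qed
  then show ?thesis
    by (simp add: complexify_def bounded_linear_Blinfun_apply)
qed

lemma complexify_in_dual_space: "complexify smul g \<in> dual_space smul"
proof -
  have ii: "smul \<i> (smul \<i> x) = - x" for x
    by (simp add: scale_minus_left)
  have "blinfun_apply (complexify smul g) (smul c x) = c * blinfun_apply (complexify smul g) x" for c x
  proof (cases c)
    case (Complex a b)
    have "smul \<i> (smul c x) = a *\<^sub>R smul \<i> x - b *\<^sub>R x"
      by (simp add: Complex smul_Complex scale_right_distrib smul_scaleR ii)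
    then show ?thesis
      by (simp add: complexify_apply Complex smul_Complex blinfun.add_right blinfun.diff_right blinfun.scaleR_right
          blinfun.minus_right complex_eq_iff)
  qed
  then show ?thesis
    by (simp add: dual_space_def)
qed

text \<open>Rotating \<open>x\<close> by a unimodular scalar makes the value real and non-negative, hence equal to the value of \<open>g\<close>.\<close>

lemma norm_complexify: "norm (complexify smul g) = norm g"
proof (rule antisym)
  show "norm (complexify smul g) \<le> norm g"
  proof (rule norm_blinfun_bound)
    fix x
    define z where "z = blinfun_apply (complexify smul g) x"
    show "norm (blinfun_apply (complexify smul g) x) \<le> norm g * norm x"
    proof (cases "z = 0")
      case False
      define u where "u = cnj z / of_real (norm z)"
      have "cnj z * z = of_real (norm z) * of_real (norm z)"
        using complex_norm_square[of z] by (simp add: power2_eq_square mult.commute)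
      then have u: "norm u = 1" "u * z = of_real (norm z)"
        using False by (simp_all add: u_def norm_divide)
      have "blinfun_apply (complexify smul g) (smul u x) = of_real (norm z)"
        using complexify_in_dual_space[of g] u(2) by (simp add: dual_space_def z_def)
      then have "blinfun_apply g (smul u x) = norm z"
        by (simp add: complexify_apply complex_eq_iff)
      then have "norm z \<le> norm g * norm (smul u x)"
        using norm_blinfun[of g "smul u x"] by simp
      then show ?thesis
        by (simp add: norm_scale u(1) z_def)
    qed (simp add: z_def)
  qed simp
  show "norm g \<le> norm (complexify smul g)"
  proof (rule norm_blinfun_bound)
    fix x
    have "\<bar>blinfun_apply g x\<bar> \<le> norm (blinfun_apply (complexify smul g) x)"
      using abs_Re_le_cmod[of "blinfun_apply (complexify smul g) x"] by (simp add: complexify_apply)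
    also have "\<dots> \<le> norm (complexify smul g) * norm x"
      by (rule norm_blinfun)
    finally show "norm (blinfun_apply g x) \<le> norm (complexify smul g) * norm x"
      by simp
  qed simp
qed

lemma complexify_add: "complexify smul (f + g) = complexify smul f + complexify smul g"
  by (rule blinfun_eqI) (simp add: complexify_apply blinfun.add_left complex_eq_iff)

lemma complexify_diff: "complexify smul (f - g) = complexify smul f - complexify smul g"
  by (rule blinfun_eqI) (simp add: complexify_apply blinfun.diff_left complex_eq_iff)

lemma inj_complexify: "inj (complexify smul)"
  using complexify_diff norm_complexify by (intro injI) (metis norm_eq_zero right_minus_eq)

lemma contains_sym_separated_dual_sphere:
  assumes "contains_sym_separated (sphere (0 :: 'a \<Rightarrow>\<^sub>L real) 1)"
  shows "contains_sym_separated (dual_sphere smul)"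
proof -
  obtain A where A: "A \<subseteq> sphere (0 :: 'a \<Rightarrow>\<^sub>L real) 1" "uncountable A" "sym_one_plus_separated norm A"
    using assms unfolding contains_sym_separated_def by blast
  have "uncountable (complexify smul ` A)"
    using A(2) inj_complexify countable_image_inj_on inj_on_subset by blast
  moreover have "complexify smul ` A \<subseteq> dual_sphere smul"
    using A(1) complexify_in_dual_space norm_complexify by (auto simp: dual_sphere_def)
  moreover have "sym_one_plus_separated norm (complexify smul ` A)"
    using A(3) unfolding sym_one_plus_separated_def
    by (auto simp: complexify_add[symmetric] complexify_diff[symmetric] norm_complexify)
  ultimately show ?thesis
    unfolding contains_sym_separated_def by blast
qed

lemma common_zero_of_few_real_functionals:
  fixes F :: "('a \<Rightarrow>\<^sub>L real) set"
  assumes dens: "exp2 continuum <o density_character (weak_star smul)"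
    and F: "|F| \<le>o exp2 continuum"
  shows "\<exists>x. x \<noteq> 0 \<and> (\<forall>f\<in>F. blinfun_apply f x = 0)"
proof -
  have "|UNIV :: complex set| \<le>o |UNIV :: (real \<times> real) set|"
    by (rule card_of_ordLeqI[where f = "\<lambda>z. (Re z, Im z)"]) (auto simp: inj_on_def complex_eq_iff)
  moreover have "|UNIV :: real set| \<le>o |UNIV :: ((real \<Rightarrow> bool) \<Rightarrow> bool) set|"
    by (rule ordLeq_transitive[OF card_le_predicates card_le_predicates])
  moreover have inf: "infinite (UNIV :: ((real \<Rightarrow> bool) \<Rightarrow> bool) set)"
    by (intro infinite_predicates infinite_UNIV_char_0)
  ultimately have card: "|UNIV :: complex set| \<le>o |UNIV :: ((real \<Rightarrow> bool) \<Rightarrow> bool) set|"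
    by (meson card_prod_le ordLeq_transitive)
  have "|complexify smul ` F| \<le>o |UNIV :: ((real \<Rightarrow> bool) \<Rightarrow> bool) set|"
    unfolding exp2_continuum[symmetric] by (rule ordLeq_transitive[OF card_of_image F])
  moreover have "complexify smul ` F \<subseteq> dual_space smul"
    using complexify_in_dual_space by blast
  ultimately obtain x where "x \<noteq> 0" "\<forall>f\<in>complexify smul ` F. blinfun_apply f x = 0"
    using common_zero_of_few_functionals[OF dens[unfolded exp2_continuum] inf card, of "complexify smul ` F"] by blast
  then show ?thesis
    by (intro exI[of _ x]) (auto simp: complexify_apply complex_eq_iff)
qed

end

lemma sym_separated_of_real_WLD:
  assumes wld: "WLD (scaleR :: real \<Rightarrow> 'a::banach \<Rightarrow> 'a)"
    and dens: "continuum <o density_character (euclidean :: 'a topology)"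
  shows "contains_sym_separated (sphere (0::'a) 1) \<and> contains_sym_separated (sphere (0::'a \<Rightarrow>\<^sub>L real) 1)"
proof -
  have "dual_ball (scaleR :: real \<Rightarrow> 'a \<Rightarrow> 'a) = cball 0 1"
    by (auto simp: dual_ball_def dual_space_scaleR)
  then have "subtopology (weak_star (scaleR :: real \<Rightarrow> 'a \<Rightarrow> 'a)) (dual_ball scaleR) =
      subtopology strong_operator_topology (cball 0 1)"
    by (simp add: weak_star_def dual_space_scaleR)
  then show ?thesis
    by (intro sym_separated_of_WLD[OF wld dens, of "\<lambda>k. k" "\<lambda>k. k"]) (simp_all add: inj_on_def)
qed

lemma sym_separated_of_complex_WLD:
  fixes smul :: "complex \<Rightarrow> 'a::banach \<Rightarrow> 'a"
  assumes "normed_space_over smul" and wld: "WLD smul"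
    and dens: "continuum <o density_character (euclidean :: 'a topology)"
  shows "contains_sym_separated (sphere (0::'a) 1) \<and> contains_sym_separated (dual_sphere smul)"
proof -
  interpret complex_normed_space smul
    using assms(1) by (simp add: complex_normed_space_def)
  define \<tau> where "\<tau> = subtopology strong_operator_topology (cball (0 :: 'a \<Rightarrow>\<^sub>L real) 1)"
  define \<sigma> where "\<sigma> = subtopology (weak_star smul) (dual_ball smul)"
  define \<rho> where "\<rho> f = blinfun_compose (Blinfun Re) f" for f :: "'a \<Rightarrow>\<^sub>L complex"
  have Re: "blinfun_apply (Blinfun Re) z = Re z" for z
    by (simp add: bounded_linear_Blinfun_apply bounded_linear_Re)
  have \<rho>: "blinfun_apply (\<rho> f) x = Re (blinfun_apply f x)" for f x
    by (simp add: \<rho>_def Re)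
  have "continuous_map \<tau> strong_operator_topology (complexify smul)"
    unfolding continuous_on_strong_operator_topo_iff_coordinatewise
  proof
    fix x
    have ev: "continuous_map \<tau> euclideanreal (\<lambda>k. blinfun_apply k v)" for v
      unfolding \<tau>_def by (intro continuous_map_from_subtopology strong_operator_topology_continuous_evaluation)
    have "continuous_map \<tau> euclidean (\<lambda>k. of_real (blinfun_apply k x) + (- \<i>) * of_real (blinfun_apply k (smul \<i> x)))"
    proof (rule continuous_map_add)
      show "continuous_map \<tau> euclidean (\<lambda>k. complex_of_real (blinfun_apply k x))"
        using continuous_map_compose[OF ev, of euclidean complex_of_real x] by (simp add: o_def continuous_on_of_real)
      show "continuous_map \<tau> euclidean (\<lambda>k. (- \<i>) * complex_of_real (blinfun_apply k (smul \<i> x)))"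
        using continuous_map_compose[OF ev, of euclidean "\<lambda>t. (- \<i>) * complex_of_real t" "smul \<i> x"]
        by (simp add: o_def continuous_on_of_real continuous_on_mult)
    qed
    moreover have "blinfun_apply (complexify smul k) x =
        of_real (blinfun_apply k x) + (- \<i>) * of_real (blinfun_apply k (smul \<i> x))" for k
      by (simp add: complexify_apply complex_eq_iff)
    ultimately show "continuous_map \<tau> euclidean (\<lambda>k. blinfun_apply (complexify smul k) x)"
      by simp
  qed
  moreover have "complexify smul k \<in> dual_ball smul" if "k \<in> topspace \<tau>" for k
    using that complexify_in_dual_space norm_complexify by (auto simp: dual_ball_def \<tau>_def)
  ultimately have J: "continuous_map \<tau> \<sigma> (complexify smul)"
    unfolding \<sigma>_def weak_star_def continuous_map_in_subtopology using complexify_in_dual_space by auto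
  have "continuous_map \<sigma> strong_operator_topology \<rho>"
    unfolding continuous_on_strong_operator_topo_iff_coordinatewise
  proof
    fix x
    have "continuous_map \<sigma> euclidean (\<lambda>f. blinfun_apply f x)"
      unfolding \<sigma>_def weak_star_def by (intro continuous_map_from_subtopology strong_operator_topology_continuous_evaluation)
    from continuous_map_compose[OF this, of euclidean Re] show "continuous_map \<sigma> euclidean (\<lambda>f. blinfun_apply (\<rho> f) x)"
      by (simp add: o_def \<rho> continuous_on_Re)
  qed
  moreover have "\<rho> f \<in> cball 0 1" if "f \<in> topspace \<sigma>" for f
  proof -
    have "norm f \<le> 1"
      using that by (auto simp: \<sigma>_def dual_ball_def)
    have "norm (\<rho> f) \<le> norm f"
      using norm_blinfun[of f] abs_Re_le_cmod by (intro norm_blinfun_bound) (auto simp: \<rho> intro: order_trans)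
    then show ?thesis
      using \<open>norm f \<le> 1\<close> by simp
  qed
  ultimately have \<rho>_cont: "continuous_map \<sigma> \<tau> \<rho>"
    unfolding \<tau>_def continuous_map_in_subtopology by auto
  have "\<rho> (complexify smul k) = k" for k
    by (rule blinfun_eqI) (simp add: \<rho> complexify_apply)
  then have "contains_sym_separated (sphere (0::'a) 1) \<and> contains_sym_separated (sphere (0::'a \<Rightarrow>\<^sub>L real) 1)"
    using sym_separated_of_WLD[OF wld dens J[unfolded \<tau>_def \<sigma>_def] inj_complexify \<rho>_cont[unfolded \<tau>_def \<sigma>_def]] by blast
  then show ?thesis
    using contains_sym_separated_dual_sphere by blast
qed

theorem theoremA:
  shows
   "(exp2 continuum <o density_character (weak_star (scaleR :: real \<Rightarrow> 'a::banach \<Rightarrow> 'a)) \<longrightarrow>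
        (\<exists>A. A \<subseteq> sphere (0::'a) 1 \<and> uncountable A \<and> sym_one_plus_separated norm A) \<and>
        (\<exists>A. A \<subseteq> dual_sphere (scaleR :: real \<Rightarrow> 'a \<Rightarrow> 'a) \<and> uncountable A \<and>
             sym_one_plus_separated norm A)) \<and>
   (\<forall>smul :: complex \<Rightarrow> 'a \<Rightarrow> 'a. normed_space_over smul \<longrightarrow>
        exp2 continuum <o density_character (weak_star smul) \<longrightarrow>
        (\<exists>A. A \<subseteq> sphere (0::'a) 1 \<and> uncountable A \<and> sym_one_plus_separated norm A) \<and>
        (\<exists>A. A \<subseteq> dual_sphere smul \<and> uncountable A \<and> sym_one_plus_separated norm A)) \<and>
   (WLD (scaleR :: real \<Rightarrow> 'a \<Rightarrow> 'a) \<longrightarrow>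
        continuum <o density_character (euclidean :: 'a topology) \<longrightarrow>
        (\<exists>A. A \<subseteq> sphere (0::'a) 1 \<and> uncountable A \<and> sym_one_plus_separated norm A) \<and>
        (\<exists>A. A \<subseteq> dual_sphere (scaleR :: real \<Rightarrow> 'a \<Rightarrow> 'a) \<and> uncountable A \<and>
             sym_one_plus_separated norm A)) \<and>
   (\<forall>smul :: complex \<Rightarrow> 'a \<Rightarrow> 'a. normed_space_over smul \<longrightarrow> WLD smul \<longrightarrow>
        continuum <o density_character (euclidean :: 'a topology) \<longrightarrow>
        (\<exists>A. A \<subseteq> sphere (0::'a) 1 \<and> uncountable A \<and> sym_one_plus_separated norm A) \<and>
        (\<exists>A. A \<subseteq> dual_sphere smul \<and> uncountable A \<and> sym_one_plus_separated norm A)) \<and>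
   (\<forall>(\<Gamma> :: 'i set) (A :: ('i \<Rightarrow> real) set).
        A \<subseteq> c0_sphere \<Gamma> \<longrightarrow> one_plus_separated sup_norm A \<longrightarrow> |A| \<le>o cardSuc natLeq) \<and>
   (\<forall>(\<Gamma> :: 'i set) (A :: ('i \<Rightarrow> complex) set).
        A \<subseteq> c0_sphere \<Gamma> \<longrightarrow> one_plus_separated sup_norm A \<longrightarrow> |A| \<le>o cardSuc natLeq)"
proof (intro conjI[of "_ \<longrightarrow> _"] conjI[of "All _"] allI impI)
  have sphere: "dual_sphere (scaleR :: real \<Rightarrow> 'a \<Rightarrow> 'a) = sphere 0 1"
    by (auto simp: dual_sphere_def dual_space_scaleR)
  {
    assume dens: "exp2 continuum <o density_character (weak_star (scaleR :: real \<Rightarrow> 'a \<Rightarrow> 'a))"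
    have "|UNIV :: real set| \<le>o |UNIV :: ((real \<Rightarrow> bool) \<Rightarrow> bool) set|"
      by (rule ordLeq_transitive[OF card_le_predicates card_le_predicates])
    moreover have "infinite (UNIV :: ((real \<Rightarrow> bool) \<Rightarrow> bool) set)"
      by (intro infinite_predicates infinite_UNIV_char_0)
    ultimately have "\<exists>x. x \<noteq> 0 \<and> (\<forall>f\<in>F. blinfun_apply f x = 0)" if "|F| \<le>o exp2 continuum" for F :: "('a \<Rightarrow>\<^sub>L real) set"
      using normed_space_over.common_zero_of_few_functionals[OF normed_space_over_scaleR,
          of "UNIV :: ((real \<Rightarrow> bool) \<Rightarrow> bool) set" F] dens that
      by (simp add: exp2_continuum dual_space_scaleR)
    then show "(\<exists>A. A \<subseteq> sphere (0::'a) 1 \<and> uncountable A \<and> sym_one_plus_separated norm A) \<and>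
        (\<exists>A. A \<subseteq> dual_sphere (scaleR :: real \<Rightarrow> 'a \<Rightarrow> 'a) \<and> uncountable A \<and> sym_one_plus_separated norm A)"
      unfolding sphere contains_sym_separated_def[symmetric] by (rule sym_separated_of_common_zeros)
  next
    assume "WLD (scaleR :: real \<Rightarrow> 'a \<Rightarrow> 'a)" "continuum <o density_character (euclidean :: 'a topology)"
    then show "(\<exists>A. A \<subseteq> sphere (0::'a) 1 \<and> uncountable A \<and> sym_one_plus_separated norm A) \<and>
        (\<exists>A. A \<subseteq> dual_sphere (scaleR :: real \<Rightarrow> 'a \<Rightarrow> 'a) \<and> uncountable A \<and> sym_one_plus_separated norm A)"
      unfolding sphere contains_sym_separated_def[symmetric] by (rule sym_separated_of_real_WLD)
  }
next
  fix smul :: "complex \<Rightarrow> 'a \<Rightarrow> 'a"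
  assume n: "normed_space_over smul"
  interpret complex_normed_space smul
    using n by (simp add: complex_normed_space_def)
  {
    assume "exp2 continuum <o density_character (weak_star smul)"
    then have "contains_sym_separated (sphere (0::'a) 1) \<and> contains_sym_separated (sphere (0::'a \<Rightarrow>\<^sub>L real) 1)"
      by (intro sym_separated_of_common_zeros common_zero_of_few_real_functionals)
    then show "(\<exists>A. A \<subseteq> sphere (0::'a) 1 \<and> uncountable A \<and> sym_one_plus_separated norm A) \<and>
        (\<exists>A. A \<subseteq> dual_sphere smul \<and> uncountable A \<and> sym_one_plus_separated norm A)"
      unfolding contains_sym_separated_def[symmetric] using contains_sym_separated_dual_sphere by blast
  next
    assume "WLD smul" "continuum <o density_character (euclidean :: 'a topology)"
    then show "(\<exists>A. A \<subseteq> sphere (0::'a) 1 \<and> uncountable A \<and> sym_one_plus_separated norm A) \<and>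
        (\<exists>A. A \<subseteq> dual_sphere smul \<and> uncountable A \<and> sym_one_plus_separated norm A)"
      unfolding contains_sym_separated_def[symmetric] by (rule sym_separated_of_complex_WLD[OF n])
  }
qed (rule separated_c0_sphere_le; assumption)+

end
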